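(* Let $(M^{2n},\omega)$ be a $b$-symplectic manifold with critical set $Z$ and let $F=(f_1,\dots,f_n)$ be a $b$-integrable system such that $f_1=c\log|t|$ defines an $S^1$-action in a neighborhood of $Z$, where $t$ is a defining function of $Z$. Denote by $T$ the union of the exceptional orbits of the $S^1$-action defined by $c\log|t|$. Then the system $F$ has singularities at the set $T$, i.e. the points of $T$ are not regular points of $F$.
   Context: Let $Z\subset M^{2n}$ be a hypersurface. ${}^bTM$ is the bundle whose sections are vector fields tangent to $Z$, with dual ${}^bT^*M$. A $b$-symplectic form is a closed nondegenerate section of $\Lambda^2({}^bT^*M)$; it is dual to a Poisson structure inducing on $Z$ (the critical set) a codimension-one symplectic foliation. A $b$-function is smooth off $Z$ and of the form $c\log|t|+g$ near $Z$, with $c\in\mathbb{R}$, $g$ smooth, $t$ a local defining function; its $b$-Hamiltonian vector field is given by $\iota_{X_f}\omega=-df$. A $b$-integrable system is an $n$-tuple of pairwise Poisson commuting $b$-functions with $df_1\wedge\dots\wedge df_n\neq0$, as a section of $\Lambda^n({}^bT^*M)$, on a dense subset of $M$ and on a dense subset of $Z$. A point is regular if $X_{f_1},\dots,X_{f_n}$ are linearly independent at it as smooth vector fields, and singular otherwise. "$f_1$ defines an $S^1$-action" means the flow of $X_{f_1}$ induces an $S^1$-action; here $c\ne0$, so this action has no fixed points near $Z$ and is transverse, in $Z$, to the symplectic leaves. Standing assumption: the symplectic foliation of $Z$ contains a compact leaf, so that $Z$ is a symplectic mapping torus. An exceptional orbit is an orbit whose (finite) isotropy group is strictly larger than that of generic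 (principal) orbits. *)

theory Defs
  imports "HOL-Analysis.Analysis"
begin

section \<open>Smooth manifolds\<close>

primrec C_k_on :: "nat \<Rightarrow> 'a::euclidean_space set \<Rightarrow> ('a \<Rightarrow> 'b::real_normed_vector) \<Rightarrow> bool"
  where
    "C_k_on 0 S f \<longleftrightarrow> continuous_on S f"
  | "C_k_on (Suc k) S f \<longleftrightarrow> (\<forall>x\<in>S. f differentiable (at x)) \<and>
       (\<forall>v. C_k_on k S (\<lambda>x. frechet_derivative f (at x) v))"

text \<open>Only meaningful for open \<open>S\<close>.\<close>

definition C_inf_on :: "'a::euclidean_space set \<Rightarrow> ('a \<Rightarrow> 'b::real_normed_vector) \<Rightarrow> bool"
  where "C_inf_on S f \<longleftrightarrow> (\<forall>k. C_k_on k S f)"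

text \<open>
  A manifold is a topological space given by a whole type \<open>'m\<close>, with a (not necessarily maximal)
  smooth atlas: a set of charts \<open>(V, \<phi>)\<close> modelled on the Euclidean space \<open>'e\<close>.  The dimension
  is \<open>DIM('e)\<close>.  The Hausdorff and second countability axioms are sort constraints on \<open>'m\<close>.
\<close>

type_synonym ('m, 'e) atlas = "('m set \<times> ('m \<Rightarrow> 'e)) set"

definition smooth_atlas :: "('m::topological_space, 'e::euclidean_space) atlas \<Rightarrow> bool"
  where "smooth_atlas A \<longleftrightarrow>
    (\<Union>(V, \<phi>)\<in>A. V) = UNIV \<and>
    (\<forall>(V, \<phi>)\<in>A. open V \<and> open (\<phi> ` V) \<and> homeomorphism V (\<phi> ` V) \<phi> (inv_into V \<phi>)) \<and>
    (\<forall>(V, \<phi>)\<in>A. \<forall>(W, \<psi>)\<in>A. C_inf_on (\<phi> ` (V \<inter> W)) (\<psi> \<circ> inv_into V \<phi>))"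

definition smooth_on :: "('m::topological_space, 'e::euclidean_space) atlas \<Rightarrow> 'm set \<Rightarrow> ('m \<Rightarrow> real) \<Rightarrow> bool"
  where "smooth_on A U f \<longleftrightarrow> (\<forall>(V, \<phi>)\<in>A. C_inf_on (\<phi> ` (V \<inter> U)) (f \<circ> inv_into V \<phi>))"

definition smooth_at :: "('m::topological_space, 'e::euclidean_space) atlas \<Rightarrow> 'm \<Rightarrow> ('m \<Rightarrow> real) \<Rightarrow> bool"
  where "smooth_at A p f \<longleftrightarrow> (\<exists>U. open U \<and> p \<in> U \<and> smooth_on A U f)"

text \<open>
  Tangent vectors are derivations of the functions that are smooth near \<open>p\<close>; the value \<open>0\<close>
  elsewhere makes their representation unique.
\<close>

type_synonym 'm tvec = "('m \<Rightarrow> real) \<Rightarrow> real"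
type_synonym 'm vfield = "'m \<Rightarrow> 'm tvec"

definition tangent_space :: "('m::topological_space, 'e::euclidean_space) atlas \<Rightarrow> 'm \<Rightarrow> 'm tvec set"
  where "tangent_space A p = {D.
    (\<forall>f. \<not> smooth_at A p f \<longrightarrow> D f = 0) \<and>
    (\<forall>f g a b. smooth_at A p f \<longrightarrow> smooth_at A p g \<longrightarrow>
       D (\<lambda>q. a * f q + b * g q) = a * D f + b * D g) \<and>
    (\<forall>f g. smooth_at A p f \<longrightarrow> smooth_at A p g \<longrightarrow>
       D (\<lambda>q. f q * g q) = f p * D g + g p * D f)}"

definition vector_fields :: "('m::topological_space, 'e::euclidean_space) atlas \<Rightarrow> 'm vfield set"
  where "vector_fields A = {X.
    (\<forall>p. X p \<in> tangent_space A p) \<and>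
    (\<forall>U f. open U \<longrightarrow> smooth_on A U f \<longrightarrow> smooth_on A U (\<lambda>p. X p f))}"

definition vf_add :: "'m vfield \<Rightarrow> 'm vfield \<Rightarrow> 'm vfield"
  where "vf_add X Y = (\<lambda>p f. X p f + Y p f)"

definition vf_scale :: "('m \<Rightarrow> real) \<Rightarrow> 'm vfield \<Rightarrow> 'm vfield"
  where "vf_scale h X = (\<lambda>p f. h p * X p f)"

definition lie_bracket :: "('m::topological_space, 'e::euclidean_space) atlas \<Rightarrow> 'm vfield \<Rightarrow> 'm vfield \<Rightarrow> 'm vfield"
  where "lie_bracket A X Y = (\<lambda>p f.
    if smooth_at A p f then X p (\<lambda>q. Y q f) - Y p (\<lambda>q. X q f) else 0)"

definition integral_curve :: "('m::topological_space, 'e::euclidean_space) atlas \<Rightarrow> 'm vfield \<Rightarrow> real set \<Rightarrow> (real \<Rightarrow> 'm) \<Rightarrow> bool"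
  where "integral_curve A X I \<gamma> \<longleftrightarrow> (\<forall>s\<in>I. \<forall>h. smooth_at A (\<gamma> s) h \<longrightarrow>
    ((\<lambda>r. h (\<gamma> r)) has_real_derivative X (\<gamma> s) h) (at s within I))"

section \<open>Hypersurfaces and the b-tangent bundle\<close>

definition defining_function_on ::
  "('m::topological_space, 'e::euclidean_space) atlas \<Rightarrow> 'm set \<Rightarrow> 'm set \<Rightarrow> ('m \<Rightarrow> real) \<Rightarrow> bool"
  where "defining_function_on A Z U t \<longleftrightarrow>
    smooth_on A U t \<and> (\<forall>q\<in>U. t q = 0 \<longleftrightarrow> q \<in> Z) \<and>
    (\<forall>q\<in>Z \<inter> U. \<exists>D\<in>tangent_space A q. D t \<noteq> 0)"

definition hypersurface :: "('m::topological_space, 'e::euclidean_space) atlas \<Rightarrow> 'm set \<Rightarrow> bool"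
  where "hypersurface A Z \<longleftrightarrow> closed Z \<and>
    (\<forall>p\<in>Z. \<exists>U t. open U \<and> p \<in> U \<and> defining_function_on A Z U t)"

definition tangent_to :: "('m::topological_space, 'e::euclidean_space) atlas \<Rightarrow> 'm set \<Rightarrow> 'm \<Rightarrow> 'm tvec set"
  where "tangent_to A Z p = {D \<in> tangent_space A p.
    \<forall>U h. open U \<longrightarrow> p \<in> U \<longrightarrow> smooth_on A U h \<longrightarrow> (\<forall>q\<in>Z \<inter> U. h q = 0) \<longrightarrow> D h = 0}"

definition b_vector_fields :: "('m::topological_space, 'e::euclidean_space) atlas \<Rightarrow> 'm set \<Rightarrow> 'm vfield set"
  where "b_vector_fields A Z = {X \<in> vector_fields A. \<forall>p\<in>Z. X p \<in> tangent_to A Z p}"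

text \<open>
  The b-tangent bundle is the bundle whose sections are the b-vector fields, so its fibre at \<open>p\<close> is
  the module of b-vector fields modulo its product with the ideal of functions vanishing at \<open>p\<close>.
  The following predicate says that \<open>X\<close> vanishes at \<open>p\<close> as a section of this bundle, which for
  \<open>p \<in> Z\<close> is stronger than \<open>X p = 0\<close>.
\<close>

definition b_zero_at :: "('m::topological_space, 'e::euclidean_space) atlas \<Rightarrow> 'm set \<Rightarrow> 'm \<Rightarrow> 'm vfield \<Rightarrow> bool"
  where "b_zero_at A Z p X \<longleftrightarrow> (\<exists>(k::nat) h Y.
    (\<forall>i<k. smooth_on A UNIV (h i) \<and> h i p = 0 \<and> Y i \<in> b_vector_fields A Z) \<and>
    X = (\<lambda>q f. \<Sum>i<k. h i q * Y i q f))"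

section \<open>b-symplectic forms\<close>

text \<open>
  Sections of the second exterior power of the b-cotangent bundle are the alternating
  \<open>C\<^sup>\<infinity>\<close>-bilinear maps from b-vector fields to smooth functions.  Such a map is unconstrained
  on arguments that are not b-vector fields.
\<close>

type_synonym 'm two_form = "'m vfield \<Rightarrow> 'm vfield \<Rightarrow> 'm \<Rightarrow> real"

definition b_two_form :: "('m::topological_space, 'e::euclidean_space) atlas \<Rightarrow> 'm set \<Rightarrow> 'm two_form \<Rightarrow> bool"
  where "b_two_form A Z \<omega> \<longleftrightarrow>
    (\<forall>v\<in>b_vector_fields A Z. \<forall>w\<in>b_vector_fields A Z. smooth_on A UNIV (\<omega> v w)) \<and>
    (\<forall>v\<in>b_vector_fields A Z. \<forall>p. \<omega> v v p = 0) \<and>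
    (\<forall>u\<in>b_vector_fields A Z. \<forall>v\<in>b_vector_fields A Z. \<forall>w\<in>b_vector_fields A Z. \<forall>p.
       \<omega> (vf_add u v) w p = \<omega> u w p + \<omega> v w p \<and>
       \<omega> w (vf_add u v) p = \<omega> w u p + \<omega> w v p) \<and>
    (\<forall>h. smooth_on A UNIV h \<longrightarrow>
       (\<forall>v\<in>b_vector_fields A Z. \<forall>w\<in>b_vector_fields A Z. \<forall>p.
          \<omega> (vf_scale h v) w p = h p * \<omega> v w p \<and>
          \<omega> v (vf_scale h w) p = h p * \<omega> v w p))"

definition b_closed :: "('m::topological_space, 'e::euclidean_space) atlas \<Rightarrow> 'm set \<Rightarrow> 'm two_form \<Rightarrow> bool"
  where "b_closed A Z \<omega> \<longleftrightarrow>
    (\<forall>u\<in>b_vector_fields A Z. \<forall>v\<in>b_vector_fields A Z. \<forall>w\<in>b_vector_fields A Z. \<forall>p.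
       u p (\<omega> v w) - v p (\<omega> u w) + w p (\<omega> u v)
       - \<omega> (lie_bracket A u v) w p + \<omega> (lie_bracket A u w) v p - \<omega> (lie_bracket A v w) u p = 0)"

definition b_nondegenerate :: "('m::topological_space, 'e::euclidean_space) atlas \<Rightarrow> 'm set \<Rightarrow> 'm two_form \<Rightarrow> bool"
  where "b_nondegenerate A Z \<omega> \<longleftrightarrow>
    (\<forall>p. \<forall>v\<in>b_vector_fields A Z.
       (\<forall>w\<in>b_vector_fields A Z. \<omega> v w p = 0) \<longrightarrow> b_zero_at A Z p v)"

definition b_symplectic_manifold :: "('m::topological_space, 'e::euclidean_space) atlas \<Rightarrow> 'm set \<Rightarrow> 'm two_form \<Rightarrow> bool"
  where "b_symplectic_manifold A Z \<omega> \<longleftrightarrow>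
    smooth_atlas A \<and> hypersurface A Z \<and>
    b_two_form A Z \<omega> \<and> b_closed A Z \<omega> \<and> b_nondegenerate A Z \<omega>"

section \<open>b-functions and b-integrable systems\<close>

text \<open>The value of a b-function on \<open>Z\<close>, where it is singular in general, is irrelevant.\<close>

definition b_function :: "('m::topological_space, 'e::euclidean_space) atlas \<Rightarrow> 'm set \<Rightarrow> ('m \<Rightarrow> real) \<Rightarrow> bool"
  where "b_function A Z f \<longleftrightarrow> smooth_on A (- Z) f \<and>
    (\<exists>c. \<forall>p\<in>Z. \<exists>U t g. open U \<and> p \<in> U \<and> defining_function_on A Z U t \<and> smooth_on A U g \<and>
       (\<forall>q\<in>U - Z. f q = c * ln \<bar>t q\<bar> + g q))"

text \<open>
  The b-one-form \<open>df\<close>, as a map on b-vector fields.  For \<open>f = c log|t| + g\<close> near \<open>Z\<close>, the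
  function \<open>v f = c (v t) / t + v g\<close> extends smoothly across \<open>Z\<close>, because \<open>v\<close> is tangent to \<open>Z\<close>.
\<close>

definition b_diff :: "'m::t2_space set \<Rightarrow> ('m \<Rightarrow> real) \<Rightarrow> 'm vfield \<Rightarrow> 'm \<Rightarrow> real"
  where "b_diff Z f v p = (if p \<in> Z then Lim (at p within - Z) (\<lambda>q. v q f) else v p f)"

definition b_hamiltonian_field ::
  "('m::t2_space, 'e::euclidean_space) atlas \<Rightarrow> 'm set \<Rightarrow> 'm two_form \<Rightarrow> ('m \<Rightarrow> real) \<Rightarrow> 'm vfield"
  where "b_hamiltonian_field A Z \<omega> f = (THE X. X \<in> b_vector_fields A Z \<and>
    (\<forall>v\<in>b_vector_fields A Z. \<forall>p. \<omega> X v p = - b_diff Z f v p))"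

definition poisson_bracket ::
  "('m::t2_space, 'e::euclidean_space) atlas \<Rightarrow> 'm set \<Rightarrow> 'm two_form \<Rightarrow> ('m \<Rightarrow> real) \<Rightarrow> ('m \<Rightarrow> real) \<Rightarrow> 'm \<Rightarrow> real"
  where "poisson_bracket A Z \<omega> f g =
    \<omega> (b_hamiltonian_field A Z \<omega> f) (b_hamiltonian_field A Z \<omega> g)"

text \<open>\<open>df\<^sub>1 \<and> \<dots> \<and> df\<^sub>n\<close>, evaluated on the b-vector fields \<open>v 1, \<dots>, v n\<close> at \<open>p\<close>.\<close>

definition b_wedge :: "'m::t2_space set \<Rightarrow> nat \<Rightarrow> (nat \<Rightarrow> 'm \<Rightarrow> real) \<Rightarrow> (nat \<Rightarrow> 'm vfield) \<Rightarrow> 'm \<Rightarrow> real"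
  where "b_wedge Z n f v p =
    (\<Sum>\<sigma> | \<sigma> permutes {1..n}. of_int (sign \<sigma>) * (\<Prod>i=1..n. b_diff Z (f i) (v (\<sigma> i)) p))"

definition b_wedge_nonzero_set ::
  "('m::t2_space, 'e::euclidean_space) atlas \<Rightarrow> 'm set \<Rightarrow> nat \<Rightarrow> (nat \<Rightarrow> 'm \<Rightarrow> real) \<Rightarrow> 'm set"
  where "b_wedge_nonzero_set A Z n f =
    {p. \<exists>v. (\<forall>i\<in>{1..n}. v i \<in> b_vector_fields A Z) \<and> b_wedge Z n f v p \<noteq> 0}"

definition b_integrable_system ::
  "('m::t2_space, 'e::euclidean_space) atlas \<Rightarrow> 'm set \<Rightarrow> 'm two_form \<Rightarrow> nat \<Rightarrow> (nat \<Rightarrow> 'm \<Rightarrow> real) \<Rightarrow> bool"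
  where "b_integrable_system A Z \<omega> n f \<longleftrightarrow>
    (\<forall>i\<in>{1..n}. b_function A Z (f i)) \<and>
    (\<forall>i\<in>{1..n}. \<forall>j\<in>{1..n}. \<forall>p. poisson_bracket A Z \<omega> (f i) (f j) p = 0) \<and>
    closure (b_wedge_nonzero_set A Z n f) = UNIV \<and>
    Z \<subseteq> closure (b_wedge_nonzero_set A Z n f \<inter> Z)"

definition regular_point ::
  "('m::t2_space, 'e::euclidean_space) atlas \<Rightarrow> 'm set \<Rightarrow> 'm two_form \<Rightarrow> nat \<Rightarrow> (nat \<Rightarrow> 'm \<Rightarrow> real) \<Rightarrow> 'm \<Rightarrow> bool"
  where "regular_point A Z \<omega> n f p \<longleftrightarrow>
    (\<forall>a::nat \<Rightarrow> real. (\<forall>h. (\<Sum>i=1..n. a i * b_hamiltonian_field A Z \<omega> (f i) p h) = 0) \<longrightarrow>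
       (\<forall>i\<in>{1..n}. a i = 0))"

section \<open>The symplectic foliation\<close>

text \<open>
  The symplectic leaf of the dual Poisson structure through \<open>p\<close> consists of the points reachable
  from \<open>p\<close> along piecewise integral curves of Hamiltonian vector fields of smooth functions.
\<close>

definition hamiltonian_path_rel ::
  "('m::t2_space, 'e::euclidean_space) atlas \<Rightarrow> 'm set \<Rightarrow> 'm two_form \<Rightarrow> ('m \<times> 'm) set"
  where "hamiltonian_path_rel A Z \<omega> = {(x, y). \<exists>h \<gamma> a b. a \<le> b \<and> smooth_on A UNIV h \<and>
    integral_curve A (b_hamiltonian_field A Z \<omega> h) {a..b} \<gamma> \<and> \<gamma> a = x \<and> \<gamma> b = y}"

definition symplectic_leaf ::
  "('m::t2_space, 'e::euclidean_space) atlas \<Rightarrow> 'm set \<Rightarrow> 'm two_form \<Rightarrow> 'm \<Rightarrow> 'm set"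
  where "symplectic_leaf A Z \<omega> p = {q. (p, q) \<in> (hamiltonian_path_rel A Z \<omega>)\<^sup>*}"

section \<open>Circle actions\<close>

text \<open>
  Smoothness of an action of the unit circle on the open set \<open>U\<close> is expressed in charts of \<open>U\<close>
  and in the angular coordinate of the circle.
\<close>

definition circle_action ::
  "('m::topological_space, 'e::euclidean_space) atlas \<Rightarrow> 'm set \<Rightarrow> (complex \<Rightarrow> 'm \<Rightarrow> 'm) \<Rightarrow> bool"
  where "circle_action A U act \<longleftrightarrow>
    (\<forall>z\<in>sphere 0 1. act z ` U \<subseteq> U) \<and>
    (\<forall>x\<in>U. act 1 x = x) \<and>
    (\<forall>z\<in>sphere 0 1. \<forall>w\<in>sphere 0 1. \<forall>x\<in>U. act (z * w) x = act z (act w x)) \<and>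
    continuous_on (sphere 0 1 \<times> U) (\<lambda>(z, x). act z x) \<and>
    (\<forall>(V, \<phi>)\<in>A. \<forall>(W, \<psi>)\<in>A.
       C_inf_on {(s::real, y). y \<in> \<phi> ` (V \<inter> U) \<and> act (cis s) (inv_into V \<phi> y) \<in> W}
         (\<lambda>(s, y). \<psi> (act (cis s) (inv_into V \<phi> y))))"

text \<open>The flow of \<open>X\<close> on \<open>U\<close> is periodic with period \<open>\<tau>\<close> and factors through the circle action.\<close>

definition flow_induces_circle_action ::
  "('m::topological_space, 'e::euclidean_space) atlas \<Rightarrow> 'm set \<Rightarrow> 'm vfield \<Rightarrow> (complex \<Rightarrow> 'm \<Rightarrow> 'm) \<Rightarrow> bool"
  where "flow_induces_circle_action A U X act \<longleftrightarrow> circle_action A U act \<and>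
    (\<exists>\<tau>>0. \<forall>x\<in>U. integral_curve A X UNIV (\<lambda>s. act (cis (2 * pi * s / \<tau>)) x))"

definition isotropy_group :: "(complex \<Rightarrow> 'm \<Rightarrow> 'm) \<Rightarrow> 'm \<Rightarrow> complex set"
  where "isotropy_group act x = {z \<in> sphere 0 1. act z x = x}"

definition circle_orbit :: "(complex \<Rightarrow> 'm \<Rightarrow> 'm) \<Rightarrow> 'm \<Rightarrow> 'm set"
  where "circle_orbit act x = (\<lambda>z. act z x) ` sphere 0 1"

text \<open>
  \<open>H\<close> is the principal isotropy group of the action on the connected component of \<open>x\<close> in \<open>U\<close>.
  Different components of \<open>U\<close> may have different principal isotropy groups.
\<close>

definition principal_isotropy ::
  "'m::topological_space set \<Rightarrow> (complex \<Rightarrow> 'm \<Rightarrow> 'm) \<Rightarrow> 'm \<Rightarrow> complex set \<Rightarrow> bool"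
  where "principal_isotropy U act x H \<longleftrightarrow>
    (\<exists>W. open W \<and> W \<subseteq> connected_component_set U x \<and> connected_component_set U x \<subseteq> closure W \<and>
       (\<forall>y\<in>W. isotropy_group act y = H))"

definition exceptional_orbits ::
  "'m::topological_space set \<Rightarrow> (complex \<Rightarrow> 'm \<Rightarrow> 'm) \<Rightarrow> 'm set set"
  where "exceptional_orbits U act = {circle_orbit act x | x. x \<in> U \<and>
    finite (isotropy_group act x) \<and>
    (\<exists>H. principal_isotropy U act x H \<and> H \<subset> isotropy_group act x)}"

end

theory Submission
  imports Defs "HOL-Real_Asymp.Real_Asymp"
begin

text \<open>
  Let \<open>p\<close> be a regular point on an exceptional orbit and let \<open>z\<close> be in the isotropy group of \<open>p\<close>.
  The Hamiltonian fields \<open>X\<^sub>1, \<dots>, X\<^sub>n\<close> commute with the action, so \<open>z\<close> fixes the \<open>n\<close>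
  vectors \<open>X\<^sub>j p\<close>.  It also preserves \<open>n\<close> smooth functions with independent differentials at \<open>p\<close>
  that are annihilated by all \<open>X\<^sub>j p\<close>: these are \<open>f\<^sub>1, \<dots>, f\<^sub>n\<close> if \<open>p\<close> is not in \<open>Z\<close>, and
  \<open>t\<close> and \<open>f\<^sub>i - (c\<^sub>i / c) f\<^sub>1\<close> for \<open>i \<ge> 2\<close> if \<open>p \<in> Z\<close>, where \<open>c\<^sub>i\<close> is the coefficient of the
  logarithm in \<open>f\<^sub>i\<close>.  As the dimension is \<open>2n\<close>, the common kernel of these differentials is spanned by the
  \<open>X\<^sub>j p\<close>.  Hence the differential of \<open>z\<close> at \<open>p\<close> is unipotent; being of finite order, it is the
  identity, and averaging over the powers of \<open>z\<close> shows that \<open>z\<close> acts trivially near \<open>p\<close>.  Principal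
  orbits are dense, so \<open>z\<close> belongs to the principal isotropy group: the orbit is not exceptional.
\<close>

section \<open>Calculus of smooth functions\<close>

text \<open>Two features of the setting determine the work. \<open>b_hamiltonian_field\<close> is a
  definite description, so nothing is known about it before the equation
  \<open>\<omega> X v = - df(v)\<close> has been solved by a smooth b-field. This calls for local
  frames of the b-tangent bundle, for smooth inversion of the matrix of \<omega> in a frame and,
  since nondegeneracy is phrased through \<open>b_zero_at\<close>, for uniqueness of frame
  coefficients. Moreover the \<open>f i\<close> have no meaningful values on \<open>Z\<close>, and
  \<open>b_diff\<close> is a limit there. Identities at points of \<open>Z\<close> are therefore
  proved on the dense complement and extended by continuity; the smooth extensions exist because a
  smooth function vanishing on \<open>Z\<close> is divisible by a defining function, which rests on
  Hadamard's lemma. Closedness of \<omega> serves to make the Hamiltonian fields commute, and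
  \<open>t\<close> is invariant because \<open>f 1\<close> Poisson commutes with itself. Unipotency
  is concrete: if \<open>g\<close> is the differential of \<open>z\<close> at \<open>p\<close>, then
  \<open>g - 1\<close> maps into the span of the Hamiltonian vectors, which \<open>g\<close> fixes,
  so \<open>g^i = 1 + i (g - 1)\<close> for all \<open>i\<close>.\<close>

lemma C_k_on_cong:
  assumes "open S" "\<And>x. x \<in> S \<Longrightarrow> f x = g x"
  shows "C_k_on k S f \<longleftrightarrow> C_k_on k S g"
proof -
  have imp: "C_k_on k S f \<Longrightarrow> C_k_on k S g" if "\<And>x. x \<in> S \<Longrightarrow> f x = g x" for f g :: "'a \<Rightarrow> 'b"
    using that
  proof (induction k arbitrary: f g)
    case 0
    then show ?case by (metis C_k_on.simps(1) continuous_on_cong)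
  next
    case (Suc k)
    have d: "(g has_derivative frechet_derivative f (at x)) (at x)" if "x \<in> S" for x
      using Suc.prems that assms(1) by (auto intro!: has_derivative_transform_within_open[of f _ x UNIV S g]
          simp: frechet_derivative_works)
    then have "frechet_derivative f (at x) v = frechet_derivative g (at x) v" if "x \<in> S" for x v
      using that frechet_derivative_at by metis
    then show ?case using Suc.IH[of "\<lambda>x. frechet_derivative f (at x) v" "\<lambda>x. frechet_derivative g (at x) v" for v]
      Suc.prems differentiableI[OF d] by auto
  qed
  show ?thesis using imp[of f g] imp[of g f] assms(2) by auto
qed

text \<open>The definition is phrased with \<open>frechet_derivative\<close>, a choice of
  derivative. By uniqueness of derivatives an explicit \<open>f'\<close> can be fed into the
  induction instead; openness of \<open>S\<close> lets the two be exchanged on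
  \<open>S\<close>.\<close>

lemma C_k_on_SucI:
  assumes "open S" "\<And>x. x \<in> S \<Longrightarrow> (f has_derivative f' x) (at x)" "\<And>v. C_k_on k S (\<lambda>x. f' x v)"
  shows "C_k_on (Suc k) S f"
proof -
  have "f' x v = frechet_derivative f (at x) v" if "x \<in> S" for x v
    using assms(2)[OF that] frechet_derivative_at by metis
  then have "C_k_on k S (\<lambda>x. frechet_derivative f (at x) v)" for v
    using assms(3)[of v] C_k_on_cong[OF assms(1), of "\<lambda>x. f' x v" "\<lambda>x. frechet_derivative f (at x) v"] by auto
  then show ?thesis using assms(2) by (auto simp: differentiable_def)
qed

lemma C_k_on_SucD:
  assumes "C_k_on (Suc k) S f"
  shows "\<And>x. x \<in> S \<Longrightarrow> (f has_derivative frechet_derivative f (at x)) (at x)"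
    "\<And>v. C_k_on k S (\<lambda>x. frechet_derivative f (at x) v)"
  using assms by (auto simp: frechet_derivative_works)

lemma C_k_on_mono: "C_k_on (Suc k) S f \<Longrightarrow> C_k_on k S f"
proof (induction k arbitrary: f)
  case 0
  then show ?case
    by (auto intro!: continuous_at_imp_continuous_on differentiable_imp_continuous_within)
next
  case (Suc k)
  then show ?case by (metis C_k_on.simps(2))
qed

lemma C_k_on_imp_continuous: "C_k_on k S f \<Longrightarrow> continuous_on S f"
  by (induction k) (auto dest: C_k_on_mono simp del: C_k_on.simps(2))

lemma C_k_on_subset: "C_k_on k S f \<Longrightarrow> T \<subseteq> S \<Longrightarrow> C_k_on k T f"
  by (induction k arbitrary: f) (auto intro: continuous_on_subset)

lemma C_k_on_local:
  assumes "\<And>x. x \<in> S \<Longrightarrow> \<exists>T. open T \<and> x \<in> T \<and> C_k_on k T f"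
  shows "C_k_on k S f"
  using assms
proof (induction k arbitrary: f)
  case 0
  then show ?case
    by (metis C_k_on.simps(1) continuous_at_imp_continuous_on continuous_on_eq_continuous_at)
next
  case (Suc k)
  have "f differentiable (at x)" if "x \<in> S" for x
    using Suc.prems[OF that] by auto
  moreover have "C_k_on k S (\<lambda>x. frechet_derivative f (at x) v)" for v
    by (rule Suc.IH) (use Suc.prems in force)
  ultimately show ?case by simp
qed

lemma C_k_on_const: "C_k_on k S (\<lambda>x. c)"
  by (induction k arbitrary: c) auto

lemma C_k_on_bounded_linear:
  assumes "bounded_linear f" "open S" shows "C_k_on k S f"
proof (cases k)
  case 0
  then show ?thesis using assms linear_continuous_on by auto
next
  case (Suc m)
  then show ?thesis using assms
    by (auto simp del: C_k_on.simps intro!: C_k_on_SucI[where f'="\<lambda>x. f"] bounded_linear_imp_has_derivative C_k_on_const)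
qed

lemma C_k_on_add:
  assumes "open S" "C_k_on k S f" "C_k_on k S g" shows "C_k_on k S (\<lambda>x. f x + g x)"
  using assms(2,3)
proof (induction k arbitrary: f g)
  case 0 then show ?case by (auto intro: continuous_on_add)
next
  case (Suc k)
  show ?case
    by (rule C_k_on_SucI[OF assms(1) has_derivative_add[OF C_k_on_SucD(1)[OF Suc.prems(1)] C_k_on_SucD(1)[OF Suc.prems(2)]]])
      (auto intro!: Suc.IH C_k_on_SucD(2) Suc.prems simp del: C_k_on.simps)
qed

text \<open>Products, scaling and inner products are all instances. The product rule gives
  \<open>B (f x) (g' x v) + B (f' x v) (g x)\<close>, to which the induction hypothesis, general in
  \<open>f\<close> and \<open>g\<close>, applies.\<close>

lemma C_k_on_bilinear:
  assumes "bounded_bilinear B" "open S" "C_k_on k S f" "C_k_on k S g"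
  shows "C_k_on k S (\<lambda>x. B (f x) (g x))"
  using assms(3,4)
proof (induction k arbitrary: f g)
  case 0 then show ?case using bounded_bilinear.continuous_on[OF assms(1)] by auto
next
  case (Suc k)
  show ?case
    by (rule C_k_on_SucI[OF assms(2) bounded_bilinear.FDERIV[OF assms(1) C_k_on_SucD(1)[OF Suc.prems(1)] C_k_on_SucD(1)[OF Suc.prems(2)]]])
      (assumption, assumption, (rule C_k_on_add[OF assms(2)]; rule Suc.IH; (rule C_k_on_SucD(2) | rule C_k_on_mono); rule Suc.prems))
qed

lemma C_k_on_linear_comp:
  assumes "bounded_linear L" "open S" "C_k_on k S f"
  shows "C_k_on k S (\<lambda>x. L (f x))"
  using assms(3)
proof (induction k arbitrary: f)
  case 0 then show ?case using bounded_linear.continuous_on[OF assms(1)] by auto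
next
  case (Suc k)
  show ?case
    by (rule C_k_on_SucI[OF assms(2) bounded_linear.has_derivative[OF assms(1) C_k_on_SucD(1)[OF Suc.prems]]])
      (auto intro!: Suc.IH C_k_on_SucD(2) Suc.prems simp del: C_k_on.simps)
qed

lemma C_k_on_sum:
  assumes "open S" "\<And>i. i \<in> I \<Longrightarrow> C_k_on k S (f i)" shows "C_k_on k S (\<lambda>x. \<Sum>i\<in>I. f i x)"
  using assms(2)
proof (induction I rule: infinite_finite_induct)
  case (insert x F)
  then show ?case using C_k_on_add[OF assms(1), of k "f x" "\<lambda>y. \<Sum>i\<in>F. f i y"] by auto
qed (auto intro: C_k_on_const)

lemma linear_expand:
  fixes D :: "'b::euclidean_space \<Rightarrow> 'c::real_vector"
  assumes "linear D" shows "D v = (\<Sum>b\<in>Basis. (v \<bullet> b) *\<^sub>R D b)"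
proof -
  have "D v = D (\<Sum>b\<in>Basis. (v \<bullet> b) *\<^sub>R b)" by (simp add: euclidean_representation)
  then show ?thesis using assms by (simp add: linear_sum linear_scale)
qed

text \<open>In the chain rule both the derivative of \<open>g\<close> and the vector it is applied
  to vary with the point. Expanding that vector in the standard basis leaves products of components
  of \<open>f'\<close> with compositions of \<open>f\<close> and derivatives of \<open>g\<close> in
  fixed directions, to which the induction hypothesis, general in \<open>g\<close>, applies.\<close>

lemma C_k_on_compose:
  fixes f :: "'a::euclidean_space \<Rightarrow> 'b::euclidean_space"
  assumes "open S" "open T" "f ` S \<subseteq> T" "C_k_on k S f" "C_k_on k T g"
  shows "C_k_on k S (\<lambda>x. g (f x))"
  using assms(4,5)
proof (induction k arbitrary: g)
  case 0 then show ?case using assms(3) by (auto intro: continuous_on_compose2)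
next
  case (Suc k)
  have g': "(g has_derivative frechet_derivative g (at (f x))) (at (f x))" if "x \<in> S" for x
    using C_k_on_SucD(1)[OF Suc.prems(2)] that assms(3) by auto
  show ?case
  proof (rule C_k_on_SucI[OF assms(1) has_derivative_compose[OF C_k_on_SucD(1)[OF Suc.prems(1)] g']])
    fix v
    have "C_k_on k S (\<lambda>x. \<Sum>b\<in>Basis. (frechet_derivative f (at x) v \<bullet> b) *\<^sub>R frechet_derivative g (at (f x)) b)"
      by (intro C_k_on_sum assms C_k_on_bilinear[OF bounded_bilinear_scaleR] C_k_on_linear_comp[OF bounded_linear_inner_left]
           C_k_on_SucD(2)[OF Suc.prems(1)] Suc.IH[OF C_k_on_mono[OF Suc.prems(1)] C_k_on_SucD(2)[OF Suc.prems(2)]])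
    moreover have "frechet_derivative g (at (f x)) (frechet_derivative f (at x) v) =
       (\<Sum>b\<in>Basis. (frechet_derivative f (at x) v \<bullet> b) *\<^sub>R frechet_derivative g (at (f x)) b)" if "x \<in> S" for x
      using linear_expand has_derivative_linear[OF g'[OF that]] by blast
    ultimately show "C_k_on k S (\<lambda>x. frechet_derivative g (at (f x)) (frechet_derivative f (at x) v))"
      using C_k_on_cong[OF assms(1)] by (metis (no_types, lifting))
  qed
qed

text \<open>The derivative of \<open>1/f\<close> is a polynomial in \<open>1/f\<close> and
  \<open>f'\<close>, so regularity of \<open>1/f\<close> at order \<open>k\<close> yields order
  \<open>k + 1\<close>.\<close>

lemma C_k_on_inverse:
  fixes f :: "'a::euclidean_space \<Rightarrow> real"
  assumes "open S" "C_k_on k S f" "\<And>x. x \<in> S \<Longrightarrow> f x \<noteq> 0"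
  shows "C_k_on k S (\<lambda>x. inverse (f x))"
  using assms(2)
proof (induction k)
  case 0 then show ?case using assms(3) by (auto intro!: continuous_on_inverse)
next
  case (Suc k)
  note I = Suc.IH[OF C_k_on_mono[OF Suc.prems]]
  have "C_k_on k S (\<lambda>x. (-1) * (inverse (f x) * frechet_derivative f (at x) v * inverse (f x)))" for v
    by (intro C_k_on_bilinear[OF bounded_bilinear_mult] C_k_on_const I C_k_on_SucD(2) Suc.prems assms(1))
  then show ?case
    by (intro C_k_on_SucI[OF assms(1) Deriv.has_derivative_inverse[OF assms(3) C_k_on_SucD(1)[OF Suc.prems]]]) auto
qed

section \<open>Germs of smooth functions\<close>

definition C_inf_at :: "'a::euclidean_space \<Rightarrow> ('a \<Rightarrow> 'b::real_normed_vector) \<Rightarrow> bool"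
  where "C_inf_at y f \<longleftrightarrow> (\<exists>S. open S \<and> y \<in> S \<and> C_inf_on S f)"

text \<open>On open sets smoothness is a local matter, so the calculus below works with germs and
  does not track domains that shrink with every operation.\<close>

lemma C_inf_on_iff_at:
  "open S \<Longrightarrow> C_inf_on S f \<longleftrightarrow> (\<forall>y\<in>S. C_inf_at y f)"
  unfolding C_inf_on_def C_inf_at_def using C_k_on_local[of S _ f] by metis

lemma C_inf_at_eventually: "C_inf_at y f \<Longrightarrow> eventually (\<lambda>z. C_inf_at z f) (nhds y)"
  by (auto simp: C_inf_at_def eventually_nhds)

lemma C_inf_at_cong:
  assumes "eventually (\<lambda>z. f z = g z) (nhds y)" shows "C_inf_at y f \<longleftrightarrow> C_inf_at y g"
proof -
  have imp: "C_inf_at y f \<Longrightarrow> C_inf_at y g" if ev: "eventually (\<lambda>z. f z = g z) (nhds y)" for f g :: "'a \<Rightarrow> 'b"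
  proof -
    assume "C_inf_at y f"
    then obtain S where S: "open S" "y \<in> S" "C_inf_on S f" unfolding C_inf_at_def by blast
    obtain T where T: "open T" "y \<in> T" "\<forall>z\<in>T. f z = g z"
      using ev unfolding eventually_nhds by blast
    have "C_k_on k (S \<inter> T) f" for k
      using S(3) by (auto simp: C_inf_on_def intro: C_k_on_subset)
    moreover have "C_k_on k (S \<inter> T) f \<longleftrightarrow> C_k_on k (S \<inter> T) g" for k
      by (rule C_k_on_cong) (use S T in auto)
    ultimately have "C_inf_on (S \<inter> T) g" by (simp add: C_inf_on_def)
    then show "C_inf_at y g"
      unfolding C_inf_at_def using S T by (intro exI[of _ "S \<inter> T"]) auto
  qed
  have "eventually (\<lambda>z. g z = f z) (nhds y)" using assms by eventually_elim simp
  then show ?thesis using assms imp[of f g] imp[of g f] by blast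
qed

lemma C_inf_at_common_nhd:
  assumes "C_inf_at y f" "C_inf_at y g"
  shows "\<exists>S. open S \<and> y \<in> S \<and> (\<forall>k. C_k_on k S f) \<and> (\<forall>k. C_k_on k S g)"
proof -
  obtain S T where "open S" "y \<in> S" "C_inf_on S f" "open T" "y \<in> T" "C_inf_on T g"
    using assms by (auto simp: C_inf_at_def)
  then show ?thesis
    by (intro exI[of _ "S \<inter> T"]) (auto simp: C_inf_on_def intro: C_k_on_subset)
qed

lemma C_inf_at_const: "C_inf_at y (\<lambda>x. c)"
  by (auto simp: C_inf_at_def C_inf_on_def intro!: exI[of _ UNIV] C_k_on_const)

lemma C_inf_at_bounded_linear: "bounded_linear f \<Longrightarrow> C_inf_at y f"
  by (auto simp: C_inf_at_def C_inf_on_def intro!: exI[of _ UNIV] C_k_on_bounded_linear)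

lemma C_inf_at_bilinear:
  assumes "bounded_bilinear B" "C_inf_at y f" "C_inf_at y g"
  shows "C_inf_at y (\<lambda>x. B (f x) (g x))"
proof -
  obtain S where S: "open S" "y \<in> S" "\<forall>k. C_k_on k S f" "\<forall>k. C_k_on k S g"
    using C_inf_at_common_nhd[OF assms(2,3)] by blast
  then show ?thesis unfolding C_inf_at_def C_inf_on_def
    by (intro exI[of _ S]) (auto intro: C_k_on_bilinear[OF assms(1)])
qed

lemmas C_inf_at_mult = C_inf_at_bilinear[OF bounded_bilinear_mult]
lemmas C_inf_at_scaleR = C_inf_at_bilinear[OF bounded_bilinear_scaleR]

lemma C_inf_at_add:
  assumes "C_inf_at y f" "C_inf_at y g" shows "C_inf_at y (\<lambda>x. f x + g x)"
proof -
  obtain S where S: "open S" "y \<in> S" "\<forall>k. C_k_on k S f" "\<forall>k. C_k_on k S g"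
    using C_inf_at_common_nhd[OF assms] by blast
  then show ?thesis unfolding C_inf_at_def C_inf_on_def
    by (intro exI[of _ S]) (auto intro: C_k_on_add)
qed

lemma C_inf_at_sum:
  assumes "\<And>i. i \<in> I \<Longrightarrow> C_inf_at y (f i)" shows "C_inf_at y (\<lambda>x. \<Sum>i\<in>I. f i x)"
  using assms
  by (induction I rule: infinite_finite_induct) (auto intro: C_inf_at_const C_inf_at_add)

lemma C_inf_at_linear_comp:
  assumes "bounded_linear L" "C_inf_at y f" shows "C_inf_at y (\<lambda>x. L (f x))"
  using assms C_k_on_linear_comp[OF assms(1), of _ _ f] unfolding C_inf_at_def C_inf_on_def by auto

lemma C_inf_at_diff:
  assumes "C_inf_at y f" "C_inf_at y g" shows "C_inf_at y (\<lambda>x. f x - g x)"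
  using C_inf_at_add[OF assms(1) C_inf_at_linear_comp[OF bounded_linear_minus[OF bounded_linear_ident] assms(2)]]
  by simp

lemma C_inf_at_componentwise:
  fixes f :: "'a::euclidean_space \<Rightarrow> 'b::euclidean_space"
  assumes "\<And>b. b \<in> Basis \<Longrightarrow> C_inf_at y (\<lambda>x. f x \<bullet> b)" shows "C_inf_at y f"
proof -
  have "C_inf_at y (\<lambda>x. \<Sum>b\<in>Basis. (f x \<bullet> b) *\<^sub>R b)"
    by (intro C_inf_at_sum assms C_inf_at_scaleR C_inf_at_const)
  then show ?thesis by (simp add: euclidean_representation)
qed

lemma C_inf_at_continuous: "C_inf_at y f \<Longrightarrow> continuous (at y) f"
  unfolding C_inf_at_def C_inf_on_def
  using C_k_on_imp_continuous continuous_on_eq_continuous_at by blast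

lemma C_inf_at_differentiable:
  "C_inf_at y f \<Longrightarrow> (f has_derivative frechet_derivative f (at y)) (at y)"
  unfolding C_inf_at_def C_inf_on_def using C_k_on_SucD(1) by blast

lemma C_inf_at_frechet:
  "C_inf_at y f \<Longrightarrow> C_inf_at y (\<lambda>x. frechet_derivative f (at x) v)"
  unfolding C_inf_at_def C_inf_on_def using C_k_on_SucD(2) by blast

lemma C_inf_at_compose:
  fixes f :: "'a::euclidean_space \<Rightarrow> 'b::euclidean_space"
  assumes "C_inf_at y f" "C_inf_at (f y) g" shows "C_inf_at y (\<lambda>x. g (f x))"
proof -
  obtain S T where S: "open S" "y \<in> S" "C_inf_on S f" and T: "open T" "f y \<in> T" "C_inf_on T g"
    using assms by (auto simp: C_inf_at_def)
  have "continuous_on S f" using S C_k_on_imp_continuous unfolding C_inf_on_def by blast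
  then have o: "open (S \<inter> f -` T)" using S T by (simp add: continuous_open_preimage)
  have "C_k_on k (S \<inter> f -` T) (\<lambda>x. g (f x))" for k
    by (rule C_k_on_compose[OF o T(1)]) (use S T in \<open>auto simp: C_inf_on_def intro: C_k_on_subset\<close>)
  then show ?thesis unfolding C_inf_at_def C_inf_on_def using o S T by blast
qed

lemma C_inf_at_inverse:
  fixes f :: "'a::euclidean_space \<Rightarrow> real"
  assumes "C_inf_at y f" "f y \<noteq> 0" shows "C_inf_at y (\<lambda>x. inverse (f x))"
proof -
  have "C_inf_at (f y) (inverse :: real \<Rightarrow> real)"
    unfolding C_inf_at_def C_inf_on_def
    using C_k_on_inverse[OF _ C_k_on_bounded_linear[OF bounded_linear_ident], of "- {0}"] assms
    by (intro exI[of _ "- {0}"]) auto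
  from C_inf_at_compose[OF assms(1) this] show ?thesis .
qed

lemma has_real_derivative_ln_abs:
  assumes "x \<noteq> 0" shows "((\<lambda>x::real. ln \<bar>x\<bar>) has_real_derivative inverse x) (at x)"
proof (cases "x > 0")
  case True
  have "(ln has_real_derivative inverse x) (at x)" using True by (simp add: DERIV_ln)
  then show ?thesis
    by (rule has_field_derivative_transform_within_open[where S="{0<..}"]) (use True in auto)
next
  case False
  have "((\<lambda>x. ln (- x)) has_real_derivative inverse x) (at x)"
    using False assms by (auto intro!: derivative_eq_intros simp: divide_simps)
  then show ?thesis
    by (rule has_field_derivative_transform_within_open[where S="{..<0}"]) (use False assms in auto)
qed

lemma C_inf_at_ln_abs:
  fixes f :: "'a::euclidean_space \<Rightarrow> real"
  assumes "C_inf_at y f" "f y \<noteq> 0" shows "C_inf_at y (\<lambda>x. ln \<bar>f x\<bar>)"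
proof -
  have "C_k_on k (- {0::real}) (\<lambda>x. ln \<bar>x\<bar>)" for k
  proof (cases k)
    case 0 then show ?thesis by (auto intro!: continuous_intros)
  next
    case (Suc m)
    have "((\<lambda>x. ln \<bar>x\<bar>) has_derivative (\<lambda>v. inverse x * v)) (at x)" if "x \<noteq> 0" for x :: real
      using has_real_derivative_ln_abs[OF that] by (simp add: has_field_derivative_def)
    then show ?thesis unfolding Suc
      by (intro C_k_on_SucI[where f'="\<lambda>x v. inverse x * v"] C_k_on_bilinear[OF bounded_bilinear_mult] C_k_on_const
          C_k_on_inverse[OF _ C_k_on_bounded_linear[OF bounded_linear_ident]]) auto
  qed
  then have "C_inf_at (f y) (\<lambda>x::real. ln \<bar>x\<bar>)"
    unfolding C_inf_at_def C_inf_on_def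
    by (intro exI[of _ "- {0}"]) (use assms in auto)
  from C_inf_at_compose[OF assms(1) this] show ?thesis .
qed

lemma C_inf_on_continuous: "C_inf_on S f \<Longrightarrow> continuous_on S f"
  unfolding C_inf_on_def using C_k_on_imp_continuous by blast

lemma C_inf_on_frechet: "C_inf_on S f \<Longrightarrow> C_inf_on S (\<lambda>x. frechet_derivative f (at x) v)"
  unfolding C_inf_on_def using C_k_on_SucD(2) by blast

lemma C_inf_on_differentiable:
  "C_inf_on S f \<Longrightarrow> x \<in> S \<Longrightarrow> (f has_derivative frechet_derivative f (at x)) (at x)"
  unfolding C_inf_on_def using C_k_on_SucD(1) by blast

lemma C_inf_on_subset: "C_inf_on S f \<Longrightarrow> T \<subseteq> S \<Longrightarrow> C_inf_on T f"
  unfolding C_inf_on_def using C_k_on_subset by blast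

section \<open>Parameter integrals and Hadamard's lemma\<close>

lemma continuous_on_hadamard_integrand:
  fixes G :: "'a::euclidean_space \<Rightarrow> real"
  assumes "bounded_linear L"
    and seg: "\<forall>y\<in>S. \<forall>s\<in>{0..1}. y - s *\<^sub>R L (y - a) \<in> S"
    and G: "C_inf_on S G" "continuous_on {0..1} \<rho>" "T \<subseteq> S"
  shows "continuous_on (T \<times> {0..1}) (\<lambda>(y, s). \<rho> s * G (y - s *\<^sub>R L (y - a)))"
proof -
  interpret L: bounded_linear L by fact
  have 1: "continuous_on (T \<times> {0..1}) (\<lambda>p. \<rho> (snd p))"
    by (rule continuous_on_compose2[OF G(2)]) (auto intro: continuous_intros)
  have 2: "continuous_on (T \<times> {0..1}) (\<lambda>p. G (fst p - snd p *\<^sub>R L (fst p - a)))"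
    by (rule continuous_on_compose2[OF C_inf_on_continuous[OF G(1)]])
      (use seg G(3) in \<open>auto intro!: continuous_intros L.continuous_on\<close>)
  show ?thesis using continuous_on_mult[OF 1 2] by (simp add: split_beta)
qed

text \<open>Differentiating under the integral in direction \<open>v\<close> gives the derivative of
  \<open>G\<close> along \<open>v\<close> minus \<open>s\<close> times its derivative along
  \<open>L v\<close>. The extra factor \<open>s\<close> is absorbed by the weight
  \<open>\<rho>\<close>; with \<open>\<rho>\<close> and \<open>G\<close> arbitrary the two resulting
  integrals have the same shape and the induction closes.\<close>

lemma C_k_on_hadamard_integral:
  fixes G :: "'a::euclidean_space \<Rightarrow> real"
  assumes "open S" "bounded_linear L"
    and seg: "\<forall>y\<in>S. \<forall>s\<in>{0..1}. y - s *\<^sub>R L (y - a) \<in> S"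
  shows "C_inf_on S G \<Longrightarrow> continuous_on {0..1} \<rho> \<Longrightarrow>
    C_k_on k S (\<lambda>y. integral {0..1} (\<lambda>s. \<rho> s * G (y - s *\<^sub>R L (y - a))))"
proof (induction k arbitrary: G \<rho>)
  case 0
  note cont = continuous_on_hadamard_integrand[OF assms(2) seg]
  from 0 show ?case
    using integral_continuous_on_param[of S 0 "1::real", unfolded box_real, OF cont[OF 0 order_refl]] by simp
next
  case (Suc k)
  interpret L: bounded_linear L by fact
  note cont = continuous_on_hadamard_integrand[OF assms(2) seg]
  let ?D = "\<lambda>v x. frechet_derivative G (at x) v"
  let ?z = "\<lambda>y s. y - s *\<^sub>R L (y - a)"
  \<comment> \<open>The derivative of the integrand as a bounded linear map, the form in which the
    Leibniz rule takes it; in finite dimension its continuity can be checked on each vector.\<close>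
  define F where "F y s = Blinfun (\<lambda>v. \<rho> s * ?D (v - s *\<^sub>R L v) (?z y s))" for y s
  have lin: "linear (\<lambda>v. ?D v x)" if "x \<in> S" for x
    using C_inf_on_differentiable[OF Suc.prems(1) that] has_derivative_linear by blast
  have blin: "bounded_linear (\<lambda>v. \<rho> s * ?D (v - s *\<^sub>R L v) (?z y s))" if "y \<in> S" "s \<in> {0..1}" for y s
  proof -
    have "bounded_linear (\<lambda>v. ?D v (?z y s))"
      using lin[OF seg[rule_format, OF that]] linear_conv_bounded_linear by blast
    then show ?thesis
      by (intro bounded_linear_const_mult bounded_linear_compose[OF \<open>bounded_linear (\<lambda>v. ?D v (?z y s))\<close>]
          bounded_linear_sub bounded_linear_ident bounded_linear_const_scaleR L.bounded_linear_axioms)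
  qed
  have F: "blinfun_apply (F y s) v = \<rho> s * ?D (v - s *\<^sub>R L v) (?z y s)" if "y \<in> S" "s \<in> {0..1}" for y s v
    unfolding F_def using bounded_linear_Blinfun_apply[OF blin[OF that]] by simp
  have F2: "blinfun_apply (F y s) v = \<rho> s * ?D v (?z y s) - (\<rho> s * s) * ?D (L v) (?z y s)" if "y \<in> S" "s \<in> {0..1}" for y s v
    using F[OF that] lin[OF seg[rule_format, OF that]] by (simp add: linear_diff linear_scale algebra_simps)
  have c1: "continuous_on (T \<times> {0..1}) (\<lambda>(y, s). \<rho> s * ?D v (?z y s))" if "T \<subseteq> S" for T v
    using cont[OF C_inf_on_frechet[OF Suc.prems(1)] Suc.prems(2) that] .
  have \<rho>2: "continuous_on {0..1} (\<lambda>s. \<rho> s * s)" using Suc.prems(2) by (intro continuous_intros)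
  have c2: "continuous_on (T \<times> {0..1}) (\<lambda>(y, s). (\<rho> s * s) * ?D (L v) (?z y s))" if "T \<subseteq> S" for T v
    using cont[OF C_inf_on_frechet[OF Suc.prems(1)] \<rho>2 that] .
  have cF: "continuous_on (T \<times> cbox 0 1) (\<lambda>(y, s). F y s)" if "T \<subseteq> S" for T
  proof (rule continuous_on_blinfun_componentwise)
    fix v :: 'a
    have "continuous_on (T \<times> {0..1}) (\<lambda>p. (\<lambda>(y, s). \<rho> s * ?D v (?z y s)) p - (\<lambda>(y, s). (\<rho> s * s) * ?D (L v) (?z y s)) p)"
      by (intro continuous_on_diff c1 c2 that)
    then show "continuous_on (T \<times> cbox 0 1) (\<lambda>x. blinfun_apply (case x of (y, s) \<Rightarrow> F y s) v)"
      unfolding cbox_interval by (rule continuous_on_eq) (use that F2 in auto)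
  qed
  have int: "(\<lambda>s. f (y, s)) integrable_on {0..1}" if "continuous_on ({y} \<times> {0..1}) f"
    for y :: 'a and f :: "'a \<times> real \<Rightarrow> 'z::banach"
  proof -
    have "continuous_on {0..1} (\<lambda>s. f (y, s))"
      by (rule continuous_on_compose2[OF that]) (auto intro!: continuous_intros)
    then show ?thesis by (simp add: integrable_continuous_real)
  qed
  show ?case
  proof (rule C_k_on_SucI[OF assms(1)])
    fix y assume y: "y \<in> S"
    obtain e where e: "e > 0" "ball y e \<subseteq> S" using assms(1) y open_contains_ball by blast
    have "((\<lambda>x. integral (cbox 0 1) (\<lambda>s. \<rho> s * G (?z x s))) has_derivative
        blinfun_apply (integral (cbox 0 1) (F y))) (at y within ball y e)"
    proof (rule leibniz_rule)
      fix x s assume x: "x \<in> ball y e" and s: "s \<in> cbox (0::real) 1"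
      have xs: "x \<in> S" "s \<in> {0..1}" using x s e by auto
      have "((\<lambda>x. ?z x s) has_derivative (\<lambda>v. v - s *\<^sub>R L v)) (at x)"
      proof -
        have "((\<lambda>x. L (x - a)) has_derivative (\<lambda>v. L v)) (at x)"
          by (rule L.has_derivative) (auto intro!: derivative_eq_intros)
        then show ?thesis by (auto intro!: derivative_eq_intros)
      qed
      from has_derivative_compose[OF this C_inf_on_differentiable[OF Suc.prems(1) seg[rule_format, OF xs]]]
      have "((\<lambda>x. G (?z x s)) has_derivative (\<lambda>v. ?D (v - s *\<^sub>R L v) (?z x s))) (at x)" .
      then have "((\<lambda>x. \<rho> s * G (?z x s)) has_derivative (\<lambda>v. \<rho> s * ?D (v - s *\<^sub>R L v) (?z x s))) (at x)"
        by (rule has_derivative_mult_right)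
      then show "((\<lambda>x. \<rho> s * G (?z x s)) has_derivative blinfun_apply (F x s)) (at x within ball y e)"
        using F[OF xs] by (metis (no_types, lifting) ext has_derivative_at_withinI)
    next
      fix x assume "x \<in> ball y e"
      then have "x \<in> S" using e by auto
      then show "(\<lambda>s. \<rho> s * G (?z x s)) integrable_on cbox 0 1"
        using int[OF cont[OF Suc.prems, of "{x}"]] by (simp add: cbox_interval)
    next
      show "continuous_on (ball y e \<times> cbox 0 1) (\<lambda>(x, s). F x s)" by (rule cF[OF e(2)])
    qed (use e in auto)
    then have 1: "((\<lambda>x. integral {0..1} (\<lambda>s. \<rho> s * G (?z x s))) has_derivative
        blinfun_apply (integral {0..1} (F y))) (at y)"
      using e by (simp add: at_within_open[of y "ball y e"])
    have iF: "F y integrable_on {0..1}"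
      using int[OF cF[of "{y}", unfolded cbox_interval]] y by simp
    have "blinfun_apply (integral {0..1} (F y)) v = integral {0..1} (\<lambda>s. \<rho> s * ?D v (?z y s)) -
       integral {0..1} (\<lambda>s. (\<rho> s * s) * ?D (L v) (?z y s))" for v
    proof -
      have "blinfun_apply (integral {0..1} (F y)) v = integral {0..1} (\<lambda>s. blinfun_apply (F y s) v)"
        using integral_linear[OF iF blinfun.bounded_linear_left[of v]] by (simp add: o_def)
      also have "\<dots> = integral {0..1} (\<lambda>s. \<rho> s * ?D v (?z y s) - (\<rho> s * s) * ?D (L v) (?z y s))"
        by (rule integral_cong) (use F2[OF y] in auto)
      also have "\<dots> = integral {0..1} (\<lambda>s. \<rho> s * ?D v (?z y s)) - integral {0..1} (\<lambda>s. (\<rho> s * s) * ?D (L v) (?z y s))"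
        using int[OF c1[of "{y}" v]] int[OF c2[of "{y}" v]] y
        by (intro integral_diff) auto
      finally show ?thesis .
    qed
    then have eq: "blinfun_apply (integral {0..1} (F y)) = (\<lambda>v. integral {0..1} (\<lambda>s. \<rho> s * ?D v (?z y s)) + (-1) *
           integral {0..1} (\<lambda>s. (\<rho> s * s) * ?D (L v) (?z y s)))" by (auto simp: fun_eq_iff)
    show "((\<lambda>x. integral {0..1} (\<lambda>s. \<rho> s * G (?z x s))) has_derivative
        (\<lambda>v. integral {0..1} (\<lambda>s. \<rho> s * ?D v (?z y s)) + (-1) *
           integral {0..1} (\<lambda>s. (\<rho> s * s) * ?D (L v) (?z y s)))) (at y)"
      using 1 unfolding eq .
  next
    fix v
    show "C_k_on k S (\<lambda>y. integral {0..1} (\<lambda>s. \<rho> s * ?D v (?z y s)) + (-1) *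
           integral {0..1} (\<lambda>s. (\<rho> s * s) * ?D (L v) (?z y s)))"
      by (intro C_k_on_add C_k_on_bilinear[OF bounded_bilinear_mult] C_k_on_const assms(1) Suc.IH
          C_inf_on_frechet Suc.prems \<rho>2)
  qed
qed

text \<open>The derivative of \<open>G\<close> is integrated along the segment from \<open>y\<close>
  to \<open>y - L (y - a)\<close>. Three choices of \<open>L\<close> occur: the identity for
  derivations at a point, the projection to a line for division by a coordinate, and the projection
  to time for expanding a flow. The last conclusion identifies the coefficients where the segment
  degenerates to a point.\<close>

lemma hadamard:
  fixes G :: "'a::euclidean_space \<Rightarrow> real"
  assumes "open S" "bounded_linear L" "C_inf_on S G"
    and seg: "\<forall>y\<in>S. \<forall>s\<in>{0..1}. y - s *\<^sub>R L (y - a) \<in> S"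
  shows "\<exists>h. (\<forall>v. C_inf_on S (h v)) \<and>
    (\<forall>y\<in>S. G y - G (y - L (y - a)) = (\<Sum>b\<in>Basis. (L (y - a) \<bullet> b) * h b y)) \<and>
    (\<forall>y\<in>S. \<forall>v. L (y - a) = 0 \<longrightarrow> h v y = frechet_derivative G (at y) v)"
proof -
  let ?D = "\<lambda>v x. frechet_derivative G (at x) v"
  let ?z = "\<lambda>y s. y - s *\<^sub>R L (y - a)"
  define h where "h v y = integral {0..1} (\<lambda>s. 1 * ?D v (?z y s))" for v y
  have "C_inf_on S (h v)" for v
    unfolding C_inf_on_def h_def
    using C_k_on_hadamard_integral[OF assms(1,2) seg C_inf_on_frechet[OF assms(3)], of "\<lambda>s. 1"] by auto
  moreover have "G y - G (y - L (y - a)) = (\<Sum>b\<in>Basis. (L (y - a) \<bullet> b) * h b y)" if y: "y \<in> S" for y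
  proof -
    let ?w = "L (y - a)"
    have lin: "linear (\<lambda>v. ?D v x)" if "x \<in> S" for x
      using C_inf_on_differentiable[OF assms(3) that] has_derivative_linear by blast
    have zc: "continuous_on {0..1} (?z y)" by (intro continuous_intros)
    have cD: "continuous_on {0..1} (\<lambda>s. ?D v (?z y s))" for v
      by (rule continuous_on_compose2[OF C_inf_on_continuous[OF C_inf_on_frechet[OF assms(3)]] zc]) (use seg y in auto)
    have "((\<lambda>s. ?D (- ?w) (?z y s)) has_integral (G (?z y 1) - G (?z y 0))) {0..1}"
    proof (rule fundamental_theorem_of_calculus)
      fix s :: real assume s: "s \<in> {0..1}"
      have "((\<lambda>s. ?z y s) has_derivative (\<lambda>r. r *\<^sub>R (- ?w))) (at s within {0..1})"
        by (auto intro!: derivative_eq_intros)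
      from has_derivative_compose[OF this C_inf_on_differentiable[OF assms(3) seg[rule_format, OF y s]]]
      show "((\<lambda>s. G (?z y s)) has_vector_derivative ?D (- ?w) (?z y s)) (at s within {0..1})"
        using lin[OF seg[rule_format, OF y s]] by (simp add: has_vector_derivative_def linear_scale[where f="\<lambda>v. ?D v (?z y s)"] del: scaleR_minus_right)
    qed auto
    then have "G (?z y 0) - G (?z y 1) = - integral {0..1} (\<lambda>s. ?D (- ?w) (?z y s))"
      by (simp add: integral_unique)
    also have "integral {0..1} (\<lambda>s. ?D (- ?w) (?z y s)) = integral {0..1} (\<lambda>s. - (\<Sum>b\<in>Basis. (?w \<bullet> b) * ?D b (?z y s)))"
    proof (rule integral_cong)
      fix s :: real assume s: "s \<in> {0..1}"
      show "?D (- ?w) (?z y s) = - (\<Sum>b\<in>Basis. (?w \<bullet> b) * ?D b (?z y s))"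
        using linear_expand[OF lin[OF seg[rule_format, OF y s]], of ?w] linear_neg[OF lin[OF seg[rule_format, OF y s]]] by simp
    qed
    also have "\<dots> = - (\<Sum>b\<in>Basis. (?w \<bullet> b) * integral {0..1} (?D b \<circ> ?z y))"
      using cD by (subst integral_neg, subst integral_sum) (auto simp: o_def intro!: integrable_continuous_real continuous_intros)
    finally show ?thesis by (simp add: h_def o_def)
  qed
  moreover have "h v y = frechet_derivative G (at y) v" if "L (y - a) = 0" for v y
    unfolding h_def using that by simp
  ultimately show ?thesis by blast
qed

section \<open>Smooth bump functions\<close>

definition flat_exp :: "nat \<Rightarrow> real \<Rightarrow> real"
  where "flat_exp j x = (if x \<le> 0 then 0 else inverse x ^ j * exp (- inverse x))"

lemma flat_exp_tendsto: "(flat_exp j \<longlongrightarrow> 0) (at 0)"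
proof -
  have "((\<lambda>x::real. inverse x ^ j * exp (- inverse x)) \<longlongrightarrow> 0) (at_right 0)"
    by real_asymp
  then have "(flat_exp j \<longlongrightarrow> 0) (at_right 0)"
    by (rule Lim_transform_eventually) (auto simp: flat_exp_def eventually_at_filter)
  moreover have "(flat_exp j \<longlongrightarrow> 0) (at_left 0)"
    by (rule tendsto_eventually) (auto simp: flat_exp_def eventually_at_filter)
  ultimately show ?thesis by (simp add: filterlim_split_at)
qed

text \<open>The powers \<open>inverse x ^ j\<close> make the linear span of the family closed under
  differentiation, so that one induction proves all members smooth. At \<open>0\<close> the
  difference quotient of \<open>flat_exp j\<close> is \<open>flat_exp (Suc j)\<close>, which tends
  to \<open>0\<close>.\<close>

lemma flat_exp_deriv:
  "(flat_exp j has_real_derivative (- real j * flat_exp (Suc j) x + flat_exp (Suc (Suc j)) x)) (at x)"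
proof (cases "x = 0")
  case True
  have "((\<lambda>h. (flat_exp j (0 + h) - flat_exp j 0) / h) \<longlongrightarrow> 0) (at 0)"
    using flat_exp_tendsto[of "Suc j"]
    by (rule Lim_transform_eventually) (auto simp: flat_exp_def eventually_at_filter field_simps)
  then show ?thesis unfolding True DERIV_def by (simp add: flat_exp_def)
next
  case False
  show ?thesis
  proof (cases "x > 0")
    case True
    have "(inverse has_real_derivative - (inverse x * inverse x)) (at x)"
      using DERIV_inverse[of x UNIV] True by (simp add: power2_eq_square)
    then have "((\<lambda>x. inverse x ^ j * exp (- inverse x)) has_real_derivative
        (- real j * flat_exp (Suc j) x + flat_exp (Suc (Suc j)) x)) (at x)"
      using True
      by (cases j) (auto intro!: derivative_eq_intros simp: flat_exp_def algebra_simps,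
          metis One_nat_def mult.commute neq0_conv power_minus_mult)
    then show ?thesis
      by (rule has_field_derivative_transform_within_open[where S="{0<..}"]) (use True in \<open>auto simp: flat_exp_def\<close>)
  next
    case False
    have "((\<lambda>x. 0) has_real_derivative (- real j * flat_exp (Suc j) x + flat_exp (Suc (Suc j)) x)) (at x)"
      using False by (auto simp: flat_exp_def)
    then show ?thesis
      by (rule has_field_derivative_transform_within_open[where S="{..<0}"]) (use False \<open>x \<noteq> 0\<close> in \<open>auto simp: flat_exp_def\<close>)
  qed
qed

lemma C_inf_at_flat_exp: "C_inf_at x (flat_exp j)"
proof -
  have "C_k_on k UNIV (flat_exp j)" for k j
  proof (induction k arbitrary: j)
    case 0
    show ?case by (auto intro!: continuous_at_imp_continuous_on DERIV_isCont[OF flat_exp_deriv])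
  next
    case (Suc k)
    have "C_k_on k UNIV (\<lambda>x. ((- real j) * flat_exp (Suc j) x + flat_exp (Suc (Suc j)) x) * v)" for v
      by (intro C_k_on_bilinear[OF bounded_bilinear_mult] C_k_on_add C_k_on_const Suc open_UNIV)
    then show ?case
      by (intro C_k_on_SucI[OF open_UNIV flat_exp_deriv[unfolded has_field_derivative_def]])
  qed
  then show ?thesis unfolding C_inf_at_def C_inf_on_def by blast
qed

text \<open>With \<open>p\<close> positive exactly inside radius \<open>e\<close> and
  \<open>q\<close> positive exactly outside radius \<open>e/2\<close>, the quotient
  \<open>p / (p + q)\<close> has the required values. The denominator never vanishes because the two
  regions cover the space, and the squared distance keeps both functions smooth at the
  centre.\<close>

lemma bump_function:
  fixes y0 :: "'a::euclidean_space"
  assumes "e > 0"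
  shows "\<exists>\<eta>::'a \<Rightarrow> real. (\<forall>y. C_inf_at y \<eta>) \<and> (\<forall>y. dist y0 y < e/2 \<longrightarrow> \<eta> y = 1) \<and> (\<forall>y. e \<le> dist y0 y \<longrightarrow> \<eta> y = 0)"
proof -
  define r where "r y = (y - y0) \<bullet> (y - y0)" for y
  define p q where "p y = flat_exp 0 (e\<^sup>2 - r y)" and "q y = flat_exp 0 (r y - (e/2)\<^sup>2)" for y
  have r: "C_inf_at y r" for y
    unfolding r_def
    by (intro C_inf_at_bilinear[OF bounded_bilinear_inner] C_inf_at_diff C_inf_at_const C_inf_at_bounded_linear bounded_linear_ident)
  have pC: "C_inf_at y p" for y
    unfolding p_def by (rule C_inf_at_compose[where g="flat_exp 0"]) (intro C_inf_at_diff C_inf_at_const r C_inf_at_flat_exp)+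
  have qC: "C_inf_at y q" for y
    unfolding q_def by (rule C_inf_at_compose[where g="flat_exp 0"]) (intro C_inf_at_diff C_inf_at_const r C_inf_at_flat_exp)+
  have rd: "r y = (dist y0 y)\<^sup>2" for y
    by (simp add: r_def dist_norm power2_norm_eq_inner inner_diff inner_commute)
  have nn: "p y \<ge> 0" "q y \<ge> 0" for y by (auto simp: p_def q_def flat_exp_def)
  have p0: "p y > 0" if "dist y0 y < e" for y
    using that power_strict_mono[OF that, of 2] by (simp add: p_def flat_exp_def rd)
  have q0: "q y > 0" if "dist y0 y > e/2" for y
    using that power_strict_mono[OF that, of 2] assms by (simp add: q_def flat_exp_def rd)
  have pos: "p y + q y > 0" for y
    using p0[of y] q0[of y] nn[of y] assms by (cases "dist y0 y < e") (auto intro: add_pos_nonneg add_nonneg_pos)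
  have "C_inf_at y (\<lambda>y. p y * inverse (p y + q y))" for y
    using pos[of y] by (intro C_inf_at_mult pC C_inf_at_inverse C_inf_at_add qC) auto
  moreover have "p y * inverse (p y + q y) = 1" if "dist y0 y < e/2" for y
  proof -
    have "q y = 0" using power_mono[of "dist y0 y" "e/2" 2] that by (simp add: q_def flat_exp_def rd)
    moreover have "p y > 0" using p0[of y] that assms by auto
    ultimately show ?thesis by simp
  qed
  moreover have "p y * inverse (p y + q y) = 0" if "e \<le> dist y0 y" for y
    using that power_mono[OF that, of 2] assms by (simp add: p_def flat_exp_def rd)
  ultimately show ?thesis by blast
qed

text \<open>
  The joint map \<open>(y, u) \<mapsto> (y, M y u)\<close> is injective with invertible derivative, and the derivative of its
  inverse is expressed through the inverse itself; this makes the inverse smooth by bootstrapping.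
\<close>

lemma C_inf_on_linear_inverse:
  fixes M :: "'a::euclidean_space \<Rightarrow> 'b::euclidean_space \<Rightarrow> 'b"
  assumes S: "open S" and lin: "\<And>y. y \<in> S \<Longrightarrow> linear (M y)" and inj: "\<And>y. y \<in> S \<Longrightarrow> inj (M y)"
    and M: "\<And>u. C_inf_on S (\<lambda>y. M y u)"
  shows "C_inf_on (S \<times> UNIV) (\<lambda>(y, v). inv (M y) v)"
proof -
  define Q where "Q p = inv (M (fst p)) (snd p)" for p
  have bij: "bij (M y)" if "y \<in> S" for y
    using lin[OF that] inj[OF that] linear_injective_imp_surjective by (auto simp: bij_def)
  have QM: "Q (y, M y u) = u" if "y \<in> S" for y u using inj[OF that] by (simp add: Q_def)
  have MQ: "M y (Q (y, v)) = v" if "y \<in> S" for y v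
    using bij[OF that] by (simp add: Q_def bij_is_surj surj_f_inv_f)
  define D where "D y w u = frechet_derivative (\<lambda>y. M y u) (at y) w" for y w u
  have D: "((\<lambda>y. M y u) has_derivative (\<lambda>w. D y w u)) (at y)" if "y \<in> S" for y u
    unfolding D_def using C_inf_on_differentiable[OF M that] .
  define F where "F p = (fst p, M (fst p) (snd p))" for p
  define F' where "F' p = (\<lambda>d. (fst d, (\<Sum>b\<in>Basis. (snd p \<bullet> b) *\<^sub>R D (fst p) (fst d) b) + M (fst p) (snd d)))" for p
  \<comment> \<open>Separates the variables: smoothness is given for each fixed \<open>u\<close>,
    and linearity reduces the joint dependence on \<open>(y, u)\<close> to the finitely many
    \<open>u\<close> in the basis.\<close>
  have Mx: "M y u = (\<Sum>b\<in>Basis. (u \<bullet> b) *\<^sub>R M y b)" if "y \<in> S" for y u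
    using linear_expand[OF lin[OF that]] .
  have open2: "open (S \<times> (UNIV :: 'b set))" using S by (simp add: open_Times)
  have F: "(F has_derivative F' p) (at p)" if p: "p \<in> S \<times> UNIV" for p
  proof -
    have pS: "fst p \<in> S" using p by auto
    have "((\<lambda>q. M (fst q) b) has_derivative (\<lambda>d. D (fst p) (fst d) b)) (at p)" for b
      using has_derivative_compose[OF has_derivative_fst[OF has_derivative_ident] D[OF pS]] .
    then have "((\<lambda>q. \<Sum>b\<in>Basis. (snd q \<bullet> b) *\<^sub>R M (fst q) b) has_derivative
       (\<lambda>d. \<Sum>b\<in>Basis. (snd p \<bullet> b) *\<^sub>R D (fst p) (fst d) b + (snd d \<bullet> b) *\<^sub>R M (fst p) b)) (at p)"
      by (intro has_derivative_sum has_derivative_scaleR has_derivative_inner_left has_derivative_snd has_derivative_ident)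
    then have "((\<lambda>q. M (fst q) (snd q)) has_derivative
       (\<lambda>d. \<Sum>b\<in>Basis. (snd p \<bullet> b) *\<^sub>R D (fst p) (fst d) b + (snd d \<bullet> b) *\<^sub>R M (fst p) b)) (at p)"
    proof (rule has_derivative_transform_within_open[OF _ open2 p])
      show "(\<Sum>b\<in>Basis. (snd q \<bullet> b) *\<^sub>R M (fst q) b) = M (fst q) (snd q)" if "q \<in> S \<times> UNIV" for q
        by (rule Mx[symmetric]) (use that in auto)
    qed
    then have "((\<lambda>q. M (fst q) (snd q)) has_derivative (\<lambda>d. (\<Sum>b\<in>Basis. (snd p \<bullet> b) *\<^sub>R D (fst p) (fst d) b) + M (fst p) (snd d))) (at p)"
      by (simp only: sum.distrib Mx[OF pS, symmetric])
    then show ?thesis unfolding F_def F'_def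
      by (intro has_derivative_Pair has_derivative_fst has_derivative_ident)
  qed
  \<comment> \<open>The inverse of \<open>F'\<close>: the second component of \<open>F' d\<close> is
    solved for \<open>snd d\<close>, with \<open>Q (fst q, _)\<close> inverting
    \<open>M (fst q)\<close>.\<close>
  define G' where "G' q = (\<lambda>d. (fst d, Q (fst q, snd d - (\<Sum>b\<in>Basis. (Q q \<bullet> b) *\<^sub>R D (fst q) (fst d) b))))" for q
  have G: "((\<lambda>q. (fst q, Q q)) has_derivative G' q) (at q)" if q: "q \<in> S \<times> UNIV" for q
  proof -
    define p where "p = (fst q, Q q)"
    have p: "p \<in> S \<times> UNIV" "fst p \<in> S" "F p = q" using q MQ[of "fst q" "snd q"] by (auto simp: p_def F_def)
    \<comment> \<open>Continuity of \<open>Q\<close> is not known beforehand. The strong inverse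
      theorem takes continuity of \<open>F\<close>, a left inverse of \<open>F\<close> and a right
      inverse of its derivative, and differentiability of \<open>Q\<close> comes out.\<close>
    have "((\<lambda>q. (fst q, Q q)) has_derivative G' q) (at (F p))"
    proof (rule has_derivative_inverse_strong[OF open2 p(1) _ _ F[OF p(1)]])
      show "continuous_on (S \<times> UNIV) F"
        using F by (meson continuous_at_imp_continuous_on has_derivative_continuous)
      show "(fst (F x), Q (F x)) = x" if "x \<in> S \<times> UNIV" for x
        using that QM by (auto simp: F_def)
      show "F' p \<circ> G' q = id"
        using MQ[of "fst q"] q by (auto simp: F'_def G'_def p_def fun_eq_iff)
    qed
    then show ?thesis using p by simp
  qed
  have Q': "(Q has_derivative (\<lambda>d. Q (fst q, snd d - (\<Sum>b\<in>Basis. (Q q \<bullet> b) *\<^sub>R D (fst q) (fst d) b)))) (at q)"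
    if "q \<in> S \<times> UNIV" for q
    using has_derivative_snd[OF G[OF that]] by (simp add: G'_def)
  have "C_k_on k (S \<times> UNIV) Q" for k
  proof (induction k)
    case 0
    show ?case using Q' by simp (meson continuous_at_imp_continuous_on has_derivative_continuous)
  next
    case (Suc k)
    show ?case
    proof (rule C_k_on_SucI[OF open2 Q'])
      fix d :: "'a \<times> 'b"
      have fst: "C_k_on k (S \<times> UNIV) (fst :: 'a \<times> 'b \<Rightarrow> 'a)"
        by (rule C_k_on_bounded_linear[OF bounded_linear_fst open2])
      have "C_k_on k S (\<lambda>y. D y (fst d) b)" for b
        unfolding D_def using C_inf_on_frechet[OF M] by (simp add: C_inf_on_def)
      then have Dk: "C_k_on k (S \<times> (UNIV :: 'b set)) (\<lambda>q. D (fst q) (fst d) b)" for b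
        using C_k_on_compose[OF open2 S _ fst, of "\<lambda>y. D y (fst d) b"] by auto
      let ?r = "\<lambda>q. (fst q, snd d - (\<Sum>b\<in>Basis. (Q q \<bullet> b) *\<^sub>R D (fst q) (fst d) b))"
      have "C_k_on k (S \<times> UNIV) (\<lambda>q. snd d + (-1) *\<^sub>R (\<Sum>b\<in>Basis. (Q q \<bullet> b) *\<^sub>R D (fst q) (fst d) b))"
        by (intro C_k_on_add open2 C_k_on_const C_k_on_bilinear[OF bounded_bilinear_scaleR] C_k_on_sum Dk
            C_k_on_linear_comp[OF bounded_linear_inner_left] Suc)
      then have c2: "C_k_on k (S \<times> UNIV) (\<lambda>q. snd d - (\<Sum>b\<in>Basis. (Q q \<bullet> b) *\<^sub>R D (fst q) (fst d) b))" by simp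
      have "C_k_on k (S \<times> UNIV) (\<lambda>q. (fst q, 0) + (0, snd d - (\<Sum>b\<in>Basis. (Q q \<bullet> b) *\<^sub>R D (fst q) (fst d) b)))"
        by (intro C_k_on_add open2 C_k_on_linear_comp[OF _ open2 fst, of "\<lambda>x. (x, 0)"]
            C_k_on_linear_comp[OF _ open2 c2, of "\<lambda>x. (0, x)"] bounded_linear_Pair bounded_linear_ident bounded_linear_zero)
      then have "C_k_on k (S \<times> UNIV) ?r" by simp
      then show "C_k_on k (S \<times> UNIV) (\<lambda>q. Q (?r q))"
        by (rule C_k_on_compose[OF open2 open2 _ _ Suc, rotated]) auto
    qed
  qed
  moreover have "Q = (\<lambda>(y, v). inv (M y) v)" by (auto simp: Q_def)
  ultimately show ?thesis by (simp add: C_inf_on_def)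
qed


text \<open>
  After the change of coordinates \<open>\<Phi> y = y + (\<tau> y - w \<bullet> (y - y0)) w\<close>, which turns \<open>\<tau>\<close> into the
  coordinate in the direction \<open>w\<close>, the quotient is given by Hadamard's lemma.
\<close>

lemma C_inf_at_divide_by_defining_function:
  fixes \<tau> g :: "'a::euclidean_space \<Rightarrow> real"
  assumes \<tau>: "C_inf_at y0 \<tau>" and g: "C_inf_at y0 g" and \<tau>0: "\<tau> y0 = 0"
    and w0: "frechet_derivative \<tau> (at y0) w0 \<noteq> 0"
    and zero: "eventually (\<lambda>y. \<tau> y = 0 \<longrightarrow> g y = 0) (nhds y0)"
  shows "\<exists>h. C_inf_at y0 h \<and> eventually (\<lambda>y. g y = \<tau> y * h y) (nhds y0)"
proof -
  define D where "D v y = frechet_derivative \<tau> (at y) v" for v y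
  have linD0: "linear (\<lambda>v. D v y0)"
    unfolding D_def using C_inf_at_differentiable[OF \<tau>] has_derivative_linear by blast
  \<comment> \<open>A unit vector, with the sign chosen so that \<open>\<tau>\<close> increases
    along it near \<open>y0\<close>.\<close>
  define w where "w = (sgn (D w0 y0) / norm w0) *\<^sub>R w0"
  have w0': "w0 \<noteq> 0" using w0 linear_0[OF linD0] by (auto simp: D_def)
  have "norm w = 1" using w0 w0' by (simp add: w_def D_def abs_sgn_eq)
  then have w1: "w \<bullet> w = 1" by (simp add: norm_eq_1)
  have Dw0: "D w y0 > 0"
    using w0 w0' by (simp add: w_def linear_scale[OF linD0] D_def[symmetric] sgn_if)
  have "eventually (\<lambda>y. C_inf_at y \<tau> \<and> C_inf_at y g \<and> (\<tau> y = 0 \<longrightarrow> g y = 0) \<and> D w y > 0) (nhds y0)"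
  proof -
    have "continuous (at y0) (D w)"
      unfolding D_def by (intro C_inf_at_continuous C_inf_at_frechet \<tau>)
    then have "(D w \<longlongrightarrow> D w y0) (nhds y0)" by (simp add: continuous_at tendsto_at_iff_tendsto_nhds)
    then have "eventually (\<lambda>y. D w y > 0) (nhds y0)" using Dw0 order_tendstoD(1) by blast
    then show ?thesis using C_inf_at_eventually[OF \<tau>] C_inf_at_eventually[OF g] zero by eventually_elim auto
  qed
  then obtain e where e: "e > 0" "\<forall>y\<in>ball y0 e. C_inf_at y \<tau> \<and> C_inf_at y g \<and> (\<tau> y = 0 \<longrightarrow> g y = 0) \<and> D w y > 0"
    unfolding eventually_nhds_metric by (auto simp: dist_commute)
  define B where "B = ball y0 e"
  have B: "open B" "y0 \<in> B" "convex B" using e by (auto simp: B_def)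
  have \<tau>B: "C_inf_on B \<tau>" "C_inf_on B g" using e(2) by (auto simp: C_inf_on_iff_at B_def)
  have dB: "(\<tau> has_derivative (\<lambda>v. D v y)) (at y)" if "y \<in> B" for y
    unfolding D_def using C_inf_on_differentiable[OF \<tau>B(1) that] .
  have Dpos: "D w y > 0" if "y \<in> B" for y using e(2) that by (auto simp: B_def)
  define \<Phi> where "\<Phi> y = y + (\<tau> y - w \<bullet> (y - y0)) *\<^sub>R w" for y
  have \<Phi>w: "w \<bullet> (\<Phi> y - y0) = \<tau> y" for y
    by (simp add: \<Phi>_def inner_diff_right inner_add_right w1 algebra_simps)
  \<comment> \<open>Points with equal images have equal \<open>\<tau>\<close>, hence differ by a
    multiple of \<open>w\<close>; by the mean value theorem \<open>\<tau>\<close> is strictly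
    increasing along \<open>w\<close> inside the convex ball.\<close>
  have inj: "inj_on \<Phi> B"
  proof (rule inj_onI, rule ccontr)
    fix x y assume xy: "x \<in> B" "y \<in> B" "\<Phi> x = \<Phi> y" "x \<noteq> y"
    have t: "\<tau> x = \<tau> y" using \<Phi>w[of x] \<Phi>w[of y] xy by simp
    define r where "r = w \<bullet> (y - x)"
    have yx: "y = x + r *\<^sub>R w"
      using xy(3) t unfolding \<Phi>_def r_def by (simp add: inner_diff_right algebra_simps)
    then have r: "r \<noteq> 0" using xy(4) by auto
    define \<gamma> where "\<gamma> s = x + (s * r) *\<^sub>R w" for s
    have \<gamma>B: "\<gamma> s \<in> B" if "0 \<le> s" "s \<le> 1" for s
      using convexD_alt[OF B(3) xy(1,2) that] by (simp add: yx \<gamma>_def algebra_simps scaleR_add_left[symmetric])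
    have d\<gamma>: "((\<lambda>s. \<tau> (\<gamma> s)) has_real_derivative r * D w (\<gamma> s)) (at s)" if "0 \<le> s" "s \<le> 1" for s
    proof -
      have "(\<gamma> has_derivative (\<lambda>h. (h * r) *\<^sub>R w)) (at s)"
        unfolding \<gamma>_def by (auto intro!: derivative_eq_intros)
      from has_derivative_compose[OF this dB[OF \<gamma>B[OF that]]] show ?thesis
        unfolding has_field_derivative_def
        by (rule has_derivative_eq_rhs)
          (simp add: fun_eq_iff linear_scale[OF has_derivative_linear[OF dB[OF \<gamma>B[OF that]]]])
    qed
    obtain s where s: "0 < s" "s < 1" "\<tau> (\<gamma> 1) - \<tau> (\<gamma> 0) = (1 - 0) * (r * D w (\<gamma> s))"
      using MVT2[of 0 1 "\<lambda>s. \<tau> (\<gamma> s)" "\<lambda>s. r * D w (\<gamma> s)"] d\<gamma> by auto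
    then have "r * D w (\<gamma> s) = 0" using t yx by (simp add: \<gamma>_def)
    then show False using r Dpos[OF \<gamma>B[of s]] s by simp
  qed
  define W where "W = \<Phi> ` B"
  define \<Psi> where "\<Psi> = inv_into B \<Phi>"
  have \<Psi>\<Phi>: "\<Psi> (\<Phi> y) = y" if "y \<in> B" for y using inj that by (simp add: \<Psi>_def)
  have \<Psi>B: "\<Psi> z \<in> B" "\<Phi> (\<Psi> z) = z" if "z \<in> W" for z
    using that \<Psi>\<Phi> by (auto simp: W_def)
  have d\<Phi>: "(\<Phi> has_derivative (\<lambda>v. v + (D v y - w \<bullet> v) *\<^sub>R w)) (at y)" if "y \<in> B" for y
    unfolding \<Phi>_def by (auto intro!: derivative_eq_intros dB[OF that])
  have cont: "continuous_on B \<Phi>"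
    using d\<Phi> by (meson continuous_at_imp_continuous_on has_derivative_continuous)
  have oW: "open W" unfolding W_def by (rule invariance_of_domain[OF cont B(1) inj])
  \<comment> \<open>The derivative of \<open>\<Phi>\<close> is the identity plus a map of rank one,
    so its inverse is given by the Sherman-Morrison formula; the denominator is \<open>D w\<close>,
    which is positive on \<open>B\<close>.\<close>
  have d\<Psi>: "(\<Psi> has_derivative (\<lambda>u. u + ((u \<bullet> w - D u (\<Psi> z)) * inverse (D w (\<Psi> z))) *\<^sub>R w)) (at z)" if z: "z \<in> W" for z
  proof -
    let ?y = "\<Psi> z"
    have lin: "linear (\<lambda>v. D v ?y)" using has_derivative_linear[OF dB[OF \<Psi>B(1)[OF z]]] .
    have "(\<Psi> has_derivative (\<lambda>u. u + ((u \<bullet> w - D u ?y) * inverse (D w ?y)) *\<^sub>R w)) (at (\<Phi> ?y))"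
    proof (rule has_derivative_inverse_strong[OF B(1) \<Psi>B(1)[OF z] cont \<Psi>\<Phi> d\<Phi>[OF \<Psi>B(1)[OF z]]])
      show "(\<lambda>v. v + (D v ?y - w \<bullet> v) *\<^sub>R w) \<circ> (\<lambda>u. u + ((u \<bullet> w - D u ?y) * inverse (D w ?y)) *\<^sub>R w) = id"
      proof (rule ext)
        fix u
        define \<beta> where "\<beta> = (u \<bullet> w - D u ?y) * inverse (D w ?y)"
        have "\<beta> * D w ?y = u \<bullet> w - D u ?y" using Dpos[OF \<Psi>B(1)[OF z]] by (simp add: \<beta>_def)
        moreover have "D (u + \<beta> *\<^sub>R w) ?y = D u ?y + \<beta> * D w ?y" by (simp add: linear_add[OF lin] linear_scale[OF lin])
        ultimately have "D (u + \<beta> *\<^sub>R w) ?y - w \<bullet> (u + \<beta> *\<^sub>R w) = - \<beta>"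
          by (simp add: inner_add_right w1 inner_commute)
        then show "((\<lambda>v. v + (D v ?y - w \<bullet> v) *\<^sub>R w) \<circ> (\<lambda>u. u + ((u \<bullet> w - D u ?y) * inverse (D w ?y)) *\<^sub>R w)) u = id u"
          by (simp add: \<beta>_def[symmetric])
      qed
    qed
    then show ?thesis using \<Psi>B(2)[OF z] by simp
  qed
  have \<Psi>k: "C_k_on k W \<Psi>" for k
  proof (induction k)
    case 0
    show ?case using d\<Psi> by simp (meson continuous_at_imp_continuous_on has_derivative_continuous)
  next
    case (Suc k)
    have Dk: "C_k_on k W (\<lambda>z. D v (\<Psi> z))" for v
      by (rule C_k_on_compose[OF oW B(1) _ Suc])
        (use \<Psi>B(1) C_inf_on_frechet[OF \<tau>B(1)] in \<open>auto simp: D_def C_inf_on_def\<close>)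
    have "C_k_on k W (\<lambda>z. u + ((u \<bullet> w + (-1) * D u (\<Psi> z)) * inverse (D w (\<Psi> z))) *\<^sub>R w)" for u
      using Dpos \<Psi>B(1)
      by (intro C_k_on_add oW C_k_on_const C_k_on_bilinear[OF bounded_bilinear_scaleR]
          C_k_on_bilinear[OF bounded_bilinear_mult] Dk C_k_on_inverse) force
    then show ?case by (intro C_k_on_SucI[OF oW d\<Psi>]) auto
  qed
  have \<Phi>0: "\<Phi> y0 = y0" by (simp add: \<Phi>_def \<tau>0)
  then have "y0 \<in> W" using B(2) by (force simp: W_def)
  then obtain d where d: "d > 0" "ball y0 d \<subseteq> W" using oW open_contains_ball by blast
  define G where "G z = g (\<Psi> z)" for z
  have "C_k_on k W G" for k
    unfolding G_def by (rule C_k_on_compose[OF oW B(1) _ \<Psi>k]) (use \<Psi>B(1) \<tau>B(2) in \<open>auto simp: C_inf_on_def\<close>)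
  then have G: "C_inf_on (ball y0 d) G" using d(2) by (auto simp: C_inf_on_def intro: C_k_on_subset)
  \<comment> \<open>Moving towards the hyperplane through \<open>y0\<close> orthogonal to
    \<open>w\<close> does not increase the distance to \<open>y0\<close>, so the segments of
    Hadamard's lemma stay in the ball.\<close>
  have seg: "y - s *\<^sub>R ((w \<bullet> (y - y0)) *\<^sub>R w) \<in> ball y0 d" if "y \<in> ball y0 d" "s \<in> {0..1}" for y s
  proof -
    let ?v = "y - y0" and ?a = "w \<bullet> (y - y0)"
    have "(norm (?v - (s * ?a) *\<^sub>R w))\<^sup>2 = (norm ?v)\<^sup>2 - (2 * s - s\<^sup>2) * ?a\<^sup>2"
      unfolding power2_norm_eq_inner
      by (simp add: inner_diff w1 inner_commute power2_eq_square algebra_simps)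
    moreover have "2 * s - s\<^sup>2 \<ge> 0" using that(2) mult_left_le_one_le[of s s] by (auto simp: power2_eq_square)
    ultimately have "(norm (?v - (s * ?a) *\<^sub>R w))\<^sup>2 \<le> (norm ?v)\<^sup>2" by simp
    then have "norm (?v - (s * ?a) *\<^sub>R w) \<le> norm ?v" using power2_le_imp_le norm_ge_zero by blast
    moreover have "y - s *\<^sub>R (?a *\<^sub>R w) - y0 = ?v - (s * ?a) *\<^sub>R w" by simp
    ultimately show ?thesis using that(1) by (metis dist_commute dist_norm mem_ball order_le_less_trans)
  qed
  have bl: "bounded_linear (\<lambda>v. (w \<bullet> v) *\<^sub>R w)"
    by (intro bounded_linear_scaleR_const bounded_linear_inner_right)
  obtain h where h: "\<forall>v. C_inf_on (ball y0 d) (h v)"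
    "\<forall>y\<in>ball y0 d. G y - G (y - (w \<bullet> (y - y0)) *\<^sub>R w) = (\<Sum>b\<in>Basis. (((w \<bullet> (y - y0)) *\<^sub>R w) \<bullet> b) * h b y)"
    using hadamard[OF open_ball bl G, of y0] seg by blast
  define H where "H z = (\<Sum>b\<in>Basis. (w \<bullet> b) * h b z)" for z
  have HC: "C_inf_at z H" if "z \<in> ball y0 d" for z
    unfolding H_def using h(1) that
    by (intro C_inf_at_sum C_inf_at_mult C_inf_at_const) (auto simp: C_inf_on_iff_at)
  \<comment> \<open>The endpoint of the segment lies in that hyperplane, which corresponds to the
    zero set of \<open>\<tau>\<close>, where \<open>g\<close> vanishes; only the Hadamard remainder
    is left.\<close>
  have GH: "G z = (w \<bullet> (z - y0)) * H z" if z: "z \<in> ball y0 d" for z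
  proof -
    let ?z = "z - (w \<bullet> (z - y0)) *\<^sub>R w"
    have z': "?z \<in> W" using seg[OF z, of 1] d(2) by auto
    have "\<tau> (\<Psi> ?z) = w \<bullet> (?z - y0)" using \<Phi>w[of "\<Psi> ?z"] \<Psi>B(2)[OF z'] by simp
    also have "\<dots> = 0" by (simp add: inner_diff_right w1)
    finally have "G ?z = 0" using e(2) \<Psi>B(1)[OF z'] by (auto simp: G_def B_def)
    then show ?thesis using h(2)[rule_format, OF z] by (simp add: H_def sum_distrib_left mult_ac)
  qed
  have \<Phi>C: "C_inf_at y \<Phi>" if "y \<in> B" for y
  proof -
    have id: "C_inf_at y (\<lambda>y. y)" by (rule C_inf_at_bounded_linear[OF bounded_linear_ident])
    have "C_inf_at y \<tau>" using \<tau>B(1) that B(1) by (auto simp: C_inf_on_iff_at)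
    then show ?thesis
      unfolding \<Phi>_def
      by (rule C_inf_at_add[OF id C_inf_at_scaleR[OF C_inf_at_diff[OF _
          C_inf_at_linear_comp[OF bounded_linear_inner_right C_inf_at_diff[OF id C_inf_at_const]]] C_inf_at_const]])
  qed
  have "C_inf_at y0 (\<lambda>y. H (\<Phi> y))"
    by (rule C_inf_at_compose[OF \<Phi>C[OF B(2)]]) (use HC \<Phi>0 d in auto)
  moreover have "eventually (\<lambda>y. g y = \<tau> y * H (\<Phi> y)) (nhds y0)"
  proof -
    have "(\<Phi> \<longlongrightarrow> \<Phi> y0) (nhds y0)"
      using C_inf_at_continuous[OF \<Phi>C[OF B(2)]] by (simp add: continuous_at tendsto_at_iff_tendsto_nhds)
    then have "eventually (\<lambda>y. \<Phi> y \<in> ball y0 d) (nhds y0)"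
      using topological_tendstoD[of \<Phi> "\<Phi> y0" "nhds y0" "ball y0 d"] \<Phi>0 d by auto
    moreover have "eventually (\<lambda>y. y \<in> B) (nhds y0)" using B by (simp add: eventually_nhds_in_open)
    ultimately show ?thesis
    proof eventually_elim
      case (elim y)
      show ?case using GH[OF elim(1)] \<Phi>w[of y] \<Psi>\<Phi>[OF elim(2)] by (simp add: G_def)
    qed
  qed
  ultimately show ?thesis by blast
qed

section \<open>Smooth manifolds\<close>

locale smooth_manifold =
  fixes A :: "('m::t2_space, 'e::euclidean_space) atlas"
  assumes atlas: "smooth_atlas A"
begin

lemma chart_at: "\<exists>V \<phi>. (V, \<phi>) \<in> A \<and> p \<in> V"
proof -
  have "p \<in> (\<Union>(V, \<phi>)\<in>A. V)" using atlas unfolding smooth_atlas_def by simp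
  then show ?thesis by auto
qed

lemma chartD:
  assumes "(V, \<phi>) \<in> A"
  shows "open V" "open (\<phi> ` V)" "homeomorphism V (\<phi> ` V) \<phi> (inv_into V \<phi>)"
proof -
  have "\<forall>(V, \<phi>)\<in>A. open V \<and> open (\<phi> ` V) \<and> homeomorphism V (\<phi> ` V) \<phi> (inv_into V \<phi>)"
    using atlas unfolding smooth_atlas_def by (elim conjE)
  then show "open V" "open (\<phi> ` V)" "homeomorphism V (\<phi> ` V) \<phi> (inv_into V \<phi>)" using assms by auto
qed

lemma chart_inv [simp]: "(V, \<phi>) \<in> A \<Longrightarrow> p \<in> V \<Longrightarrow> inv_into V \<phi> (\<phi> p) = p"
  using chartD(3) by (auto simp: homeomorphism_def)

lemma chart_inv': "(V, \<phi>) \<in> A \<Longrightarrow> y \<in> \<phi> ` V \<Longrightarrow> \<phi> (inv_into V \<phi> y) = y"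
  by (rule f_inv_into_f)

lemma chart_open: assumes "(V, \<phi>) \<in> A" "open N" shows "open (\<phi> ` (V \<inter> N))"
proof -
  have "\<phi> ` (V \<inter> N) = \<phi> ` V \<inter> inv_into V \<phi> -` N" using assms by force
  moreover have "continuous_on (\<phi> ` V) (inv_into V \<phi>)" using chartD(3)[OF assms(1)] by (simp add: homeomorphism_def)
  ultimately show ?thesis using chartD(2)[OF assms(1)] assms(2) by (simp add: continuous_open_preimage)
qed

lemma chart_open_vimage: assumes "(V, \<phi>) \<in> A" "open S" shows "open (V \<inter> \<phi> -` S)"
  using chartD[OF assms(1)] assms(2) by (simp add: homeomorphism_def continuous_open_preimage)

lemma eventually_chart:
  assumes "(V, \<phi>) \<in> A" "p \<in> V"
  shows "eventually P (nhds p) \<longleftrightarrow> eventually (\<lambda>y. P (inv_into V \<phi> y)) (nhds (\<phi> p))"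
proof
  assume "eventually P (nhds p)"
  then obtain N where N: "open N" "p \<in> N" "\<forall>q\<in>N. P q" unfolding eventually_nhds by blast
  have "\<forall>y\<in>\<phi> ` (V \<inter> N). P (inv_into V \<phi> y)" using N assms by auto
  moreover have "open (\<phi> ` (V \<inter> N))" "\<phi> p \<in> \<phi> ` (V \<inter> N)" using chart_open[OF assms(1) N(1)] N assms by auto
  ultimately show "eventually (\<lambda>y. P (inv_into V \<phi> y)) (nhds (\<phi> p))" unfolding eventually_nhds by blast
next
  assume "eventually (\<lambda>y. P (inv_into V \<phi> y)) (nhds (\<phi> p))"
  then obtain S where S: "open S" "\<phi> p \<in> S" "\<forall>y\<in>S. P (inv_into V \<phi> y)" unfolding eventually_nhds by blast
  have "\<forall>q\<in>V \<inter> \<phi> -` S. P q" using S assms by (metis IntD1 IntD2 chart_inv vimage_eq)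
  then show "eventually P (nhds p)"
    unfolding eventually_nhds using chart_open_vimage[OF assms(1) S(1)] S(2) assms(2) by blast
qed

lemma eventually_chart_image:
  assumes "(V, \<phi>) \<in> A" "p \<in> V"
  shows "eventually (\<lambda>y. y \<in> \<phi> ` V) (nhds (\<phi> p))"
  using chartD(2)[OF assms(1)] assms(2) by (simp add: eventually_nhds_in_open)

lemma chart_transition:
  assumes "(V, \<phi>) \<in> A" "(W, \<psi>) \<in> A" "p \<in> V" "p \<in> W"
  shows "C_inf_at (\<phi> p) (\<lambda>y. \<psi> (inv_into V \<phi> y))"
proof -
  have "C_inf_on (\<phi> ` (V \<inter> W)) (\<psi> \<circ> inv_into V \<phi>)"
    using atlas assms(1,2) unfolding smooth_atlas_def by fast
  then show ?thesis
    unfolding C_inf_at_def using chart_open[OF assms(1) chartD(1)[OF assms(2)]] assms(3,4) by (auto simp: o_def)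
qed

text \<open>\<open>smooth_on\<close> quantifies over all charts. Smooth transition maps carry
  smoothness from one chart at \<open>p\<close> to every other, so a single chart decides.\<close>

lemma smooth_at_iff:
  assumes "(V, \<phi>) \<in> A" "p \<in> V"
  shows "smooth_at A p f \<longleftrightarrow> C_inf_at (\<phi> p) (\<lambda>y. f (inv_into V \<phi> y))"
proof
  assume "smooth_at A p f"
  then obtain U where U: "open U" "p \<in> U" "smooth_on A U f" by (auto simp: smooth_at_def)
  then have "C_inf_on (\<phi> ` (V \<inter> U)) (f \<circ> inv_into V \<phi>)" using assms by (auto simp: smooth_on_def)
  then show "C_inf_at (\<phi> p) (\<lambda>y. f (inv_into V \<phi> y))"
    unfolding C_inf_at_def using chart_open[OF assms(1) U(1)] assms(2) U(2) by (auto simp: o_def)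
next
  assume "C_inf_at (\<phi> p) (\<lambda>y. f (inv_into V \<phi> y))"
  then obtain S where S: "open S" "\<phi> p \<in> S" "C_inf_on S (\<lambda>y. f (inv_into V \<phi> y))" unfolding C_inf_at_def by blast
  let ?U = "V \<inter> \<phi> -` S"
  have "C_inf_on (\<psi> ` (W \<inter> ?U)) (f \<circ> inv_into W \<psi>)" if W: "(W, \<psi>) \<in> A" for W \<psi>
    unfolding C_inf_on_iff_at[OF chart_open[OF W chart_open_vimage[OF assms(1) S(1)]]]
  proof safe
    fix q assume q: "q \<in> W" "q \<in> V" "\<phi> q \<in> S"
    have "C_inf_at (\<psi> q) (\<lambda>y. \<phi> (inv_into W \<psi> y))" by (rule chart_transition[OF W assms(1) q(1,2)])
    moreover have "C_inf_at (\<phi> (inv_into W \<psi> (\<psi> q))) (\<lambda>y. f (inv_into V \<phi> y))"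
      using S q W by (auto simp: C_inf_on_iff_at)
    ultimately have C: "C_inf_at (\<psi> q) (\<lambda>y. f (inv_into V \<phi> (\<phi> (inv_into W \<psi> y))))" by (rule C_inf_at_compose)
    have "eventually (\<lambda>y. inv_into W \<psi> y \<in> V) (nhds (\<psi> q))"
      using eventually_chart[OF W q(1), of "\<lambda>q. q \<in> V"] chartD(1)[OF assms(1)] q(2)
      by (simp add: eventually_nhds_in_open)
    then have "eventually (\<lambda>y. f (inv_into V \<phi> (\<phi> (inv_into W \<psi> y))) = (f \<circ> inv_into W \<psi>) y) (nhds (\<psi> q))"
      by eventually_elim (use assms in auto)
    from C_inf_at_cong[OF this] show "C_inf_at (\<psi> q) (f \<circ> inv_into W \<psi>)" using C by (simp add: o_def)
  qed
  then have "smooth_on A ?U f" by (auto simp: smooth_on_def)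
  then show "smooth_at A p f"
    unfolding smooth_at_def using chart_open_vimage[OF assms(1) S(1)] S(2) assms(2) by blast
qed

lemma smooth_on_iff: "open U \<Longrightarrow> smooth_on A U f \<longleftrightarrow> (\<forall>p\<in>U. smooth_at A p f)"
proof
  assume U: "open U" and f: "\<forall>p\<in>U. smooth_at A p f"
  have "C_inf_on (\<phi> ` (V \<inter> U)) (f \<circ> inv_into V \<phi>)" if V: "(V, \<phi>) \<in> A" for V \<phi>
    using f smooth_at_iff[OF V] unfolding C_inf_on_iff_at[OF chart_open[OF V U]] o_def by auto
  then show "smooth_on A U f" by (auto simp: smooth_on_def)
qed (auto simp: smooth_at_def)

lemma smooth_at_eventually: "smooth_at A p f \<Longrightarrow> eventually (\<lambda>q. smooth_at A q f) (nhds p)"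
  unfolding smooth_at_def eventually_nhds by blast

lemma smooth_at_imp_cong:
  assumes "eventually (\<lambda>q. f q = g q) (nhds p)" "smooth_at A p f" shows "smooth_at A p g"
proof -
  obtain V \<phi> where V: "(V, \<phi>) \<in> A" "p \<in> V" using chart_at by blast
  show ?thesis
    using assms(2) C_inf_at_cong[OF assms(1)[unfolded eventually_chart[OF V, of "\<lambda>q. f q = g q"]]]
    unfolding smooth_at_iff[OF V] by simp
qed

lemma smooth_at_cong:
  assumes "eventually (\<lambda>q. f q = g q) (nhds p)" shows "smooth_at A p f \<longleftrightarrow> smooth_at A p g"
proof -
  have ev: "eventually (\<lambda>q. g q = f q) (nhds p)" using assms by eventually_elim simp
  show ?thesis using smooth_at_imp_cong[OF assms] smooth_at_imp_cong[OF ev] by (rule iffI)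
qed

lemma smooth_at_const: "smooth_at A p (\<lambda>q. c)"
proof -
  obtain V \<phi> where V: "(V, \<phi>) \<in> A" "p \<in> V" using chart_at by blast
  show ?thesis unfolding smooth_at_iff[OF V] by (rule C_inf_at_const)
qed

lemma smooth_at_mult:
  assumes "smooth_at A p f" "smooth_at A p g" shows "smooth_at A p (\<lambda>q. f q * g q)"
proof -
  obtain V \<phi> where V: "(V, \<phi>) \<in> A" "p \<in> V" using chart_at by blast
  show ?thesis using assms unfolding smooth_at_iff[OF V] by (rule C_inf_at_mult)
qed

lemma smooth_at_add:
  assumes "smooth_at A p f" "smooth_at A p g" shows "smooth_at A p (\<lambda>q. f q + g q)"
proof -
  obtain V \<phi> where V: "(V, \<phi>) \<in> A" "p \<in> V" using chart_at by blast
  show ?thesis using assms unfolding smooth_at_iff[OF V] by (rule C_inf_at_add)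
qed

lemma smooth_at_diff:
  assumes "smooth_at A p f" "smooth_at A p g" shows "smooth_at A p (\<lambda>q. f q - g q)"
proof -
  obtain V \<phi> where V: "(V, \<phi>) \<in> A" "p \<in> V" using chart_at by blast
  show ?thesis using assms unfolding smooth_at_iff[OF V] by (rule C_inf_at_diff)
qed

lemma smooth_at_minus: "smooth_at A p f \<Longrightarrow> smooth_at A p (\<lambda>q. - f q)"
  using smooth_at_diff[OF smooth_at_const[of p 0], of f] by simp

lemma smooth_at_sum: "(\<And>i. i \<in> I \<Longrightarrow> smooth_at A p (f i)) \<Longrightarrow> smooth_at A p (\<lambda>q. \<Sum>i\<in>I. f i q)"
  by (induction I rule: infinite_finite_induct) (auto intro: smooth_at_const smooth_at_add)

lemma smooth_at_inverse: "smooth_at A p f \<Longrightarrow> f p \<noteq> 0 \<Longrightarrow> smooth_at A p (\<lambda>q. inverse (f q))"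
proof -
  obtain V \<phi> where V: "(V, \<phi>) \<in> A" "p \<in> V" using chart_at by blast
  show "smooth_at A p f \<Longrightarrow> f p \<noteq> 0 \<Longrightarrow> smooth_at A p (\<lambda>q. inverse (f q))"
    unfolding smooth_at_iff[OF V] by (rule C_inf_at_inverse) (use V in auto)
qed

lemma smooth_at_ln_abs: "smooth_at A p f \<Longrightarrow> f p \<noteq> 0 \<Longrightarrow> smooth_at A p (\<lambda>q. ln \<bar>f q\<bar>)"
proof -
  obtain V \<phi> where V: "(V, \<phi>) \<in> A" "p \<in> V" using chart_at by blast
  show "smooth_at A p f \<Longrightarrow> f p \<noteq> 0 \<Longrightarrow> smooth_at A p (\<lambda>q. ln \<bar>f q\<bar>)"
    unfolding smooth_at_iff[OF V] by (rule C_inf_at_ln_abs) (use V in auto)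
qed

lemma smooth_at_compose_chart:
  fixes G :: "'e \<Rightarrow> real"
  assumes "(V, \<phi>) \<in> A" "p \<in> V" "C_inf_at (\<phi> p) G"
  shows "smooth_at A p (\<lambda>q. G (\<phi> q))"
proof -
  have "eventually (\<lambda>y. G y = G (\<phi> (inv_into V \<phi> y))) (nhds (\<phi> p))"
    using eventually_chart_image[OF assms(1,2)] by eventually_elim (simp add: chart_inv'[OF assms(1)])
  from C_inf_at_cong[OF this] show ?thesis using assms(3) unfolding smooth_at_iff[OF assms(1,2)] by simp
qed

lemma smooth_at_coord: "(V, \<phi>) \<in> A \<Longrightarrow> p \<in> V \<Longrightarrow> smooth_at A p (\<lambda>q. \<phi> q \<bullet> b)"
  using smooth_at_compose_chart[of V \<phi> p "\<lambda>y. y \<bullet> b"] C_inf_at_bounded_linear[OF bounded_linear_inner_left] by blast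

lemma chart_tendsto: assumes "(V, \<phi>) \<in> A" "p \<in> V" shows "(\<phi> \<longlongrightarrow> \<phi> p) (nhds p)"
proof -
  have "continuous_on V \<phi>" using chartD(3)[OF assms(1)] by (simp add: homeomorphism_def)
  then have "isCont \<phi> p" using chartD(1)[OF assms(1)] assms(2) continuous_on_eq_continuous_at by blast
  then show ?thesis by (simp add: continuous_at tendsto_at_iff_tendsto_nhds)
qed

lemma smooth_at_tendsto: assumes "smooth_at A p f" shows "(f \<longlongrightarrow> f p) (nhds p)"
proof -
  obtain V \<phi> where V: "(V, \<phi>) \<in> A" "p \<in> V" using chart_at by blast
  have "continuous (at (\<phi> p)) (\<lambda>y. f (inv_into V \<phi> y))"
    using assms unfolding smooth_at_iff[OF V] by (rule C_inf_at_continuous)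
  then have "((\<lambda>y. f (inv_into V \<phi> y)) \<longlongrightarrow> f (inv_into V \<phi> (\<phi> p))) (nhds (\<phi> p))"
    unfolding continuous_at by (subst tendsto_at_iff_tendsto_nhds[symmetric])
  then have "((\<lambda>y. f (inv_into V \<phi> y)) \<longlongrightarrow> f p) (nhds (\<phi> p))" by (simp add: V)
  then show ?thesis unfolding tendsto_def using eventually_chart[OF V] by auto
qed

lemma smooth_at_eventually_neq:
  "smooth_at A p f \<Longrightarrow> f p \<noteq> c \<Longrightarrow> eventually (\<lambda>q. f q \<noteq> c) (nhds p)"
  using smooth_at_tendsto tendsto_imp_eventually_ne by blast

section \<open>Tangent vectors as derivations\<close>

abbreviation T where "T \<equiv> tangent_space A"

lemma tangent_lincomb:
  "D \<in> T p \<Longrightarrow> smooth_at A p f \<Longrightarrow> smooth_at A p g \<Longrightarrow> D (\<lambda>q. a * f q + b * g q) = a * D f + b * D g"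
  by (simp add: tangent_space_def)

lemma tangent_mult:
  "D \<in> T p \<Longrightarrow> smooth_at A p f \<Longrightarrow> smooth_at A p g \<Longrightarrow> D (\<lambda>q. f q * g q) = f p * D g + g p * D f"
  by (simp add: tangent_space_def)

lemma tangent_not_smooth: "D \<in> T p \<Longrightarrow> \<not> smooth_at A p f \<Longrightarrow> D f = 0"
  by (simp add: tangent_space_def)

lemma tangent_add:
  "D \<in> T p \<Longrightarrow> smooth_at A p f \<Longrightarrow> smooth_at A p g \<Longrightarrow> D (\<lambda>q. f q + g q) = D f + D g"
  using tangent_lincomb[of D p f g 1 1] by simp

lemma tangent_diff:
  "D \<in> T p \<Longrightarrow> smooth_at A p f \<Longrightarrow> smooth_at A p g \<Longrightarrow> D (\<lambda>q. f q - g q) = D f - D g"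
  using tangent_lincomb[of D p f g 1 "-1"] by simp

lemma tangent_cmult: "D \<in> T p \<Longrightarrow> smooth_at A p f \<Longrightarrow> D (\<lambda>q. c * f q) = c * D f"
  using tangent_lincomb[of D p f f c 0] by simp

lemma tangent_const: assumes "D \<in> T p" shows "D (\<lambda>q. c) = 0"
  using tangent_mult[OF assms smooth_at_const[of p 1] smooth_at_const[of p 1]]
    tangent_cmult[OF assms smooth_at_const[of p 1], of c] by simp

lemma tangent_sum:
  assumes "D \<in> T p" "\<And>i. i \<in> I \<Longrightarrow> smooth_at A p (f i)"
  shows "D (\<lambda>q. \<Sum>i\<in>I. f i q) = (\<Sum>i\<in>I. D (f i))"
  using assms(2)
proof (induction I rule: infinite_finite_induct)
  case (insert x F)
  then show ?case using tangent_add[OF assms(1), of "f x" "\<lambda>q. \<Sum>i\<in>F. f i q"] smooth_at_sum[of F p f] by auto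
qed (auto simp: tangent_const[OF assms(1)])

text \<open>
  Multiplication by the indicator function of a neighbourhood, which is smooth at \<open>p\<close>, shows that
  derivations are local.
\<close>

lemma tangent_cong:
  assumes D: "D \<in> T p" and ev: "eventually (\<lambda>q. f q = g q) (nhds p)" shows "D f = D g"
proof (cases "smooth_at A p f")
  case True
  then have g: "smooth_at A p g" using smooth_at_cong[OF ev] by simp
  obtain N where N: "open N" "p \<in> N" "\<forall>q\<in>N. f q = g q" using ev unfolding eventually_nhds by blast
  define k :: "'m \<Rightarrow> real" where "k q = (if q \<in> N then 1 else 0)" for q
  have "eventually (\<lambda>q. 1 = k q) (nhds p)" using N by (auto simp: eventually_nhds k_def)
  from smooth_at_imp_cong[OF this smooth_at_const] have k: "smooth_at A p k" .
  have "(\<lambda>q. k q * (f q - g q)) = (\<lambda>q. 0)" using N by (auto simp: k_def)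
  then have "D (\<lambda>q. k q * (f q - g q)) = 0" using tangent_const[OF D] by metis
  moreover have "D (\<lambda>q. k q * (f q - g q)) = k p * D (\<lambda>q. f q - g q) + (f p - g p) * D k"
    by (rule tangent_mult[OF D k smooth_at_diff[OF True g]])
  ultimately have "D (\<lambda>q. f q - g q) = 0" using N by (simp add: k_def)
  then show ?thesis using tangent_diff[OF D True g] by simp
next
  case False
  then show ?thesis using smooth_at_cong[OF ev] tangent_not_smooth[OF D] by simp
qed

abbreviation chart_fun :: "'m set \<Rightarrow> ('m \<Rightarrow> 'e) \<Rightarrow> ('m \<Rightarrow> real) \<Rightarrow> 'e \<Rightarrow> real"
  where "chart_fun V \<phi> f \<equiv> (\<lambda>y. f (inv_into V \<phi> y))"

text \<open>The default \<open>0\<close> is the convention of \<open>tangent_space\<close>; with it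
  \<open>tvec\<close> and \<open>coords\<close> are literally inverse to each other, as
  \<open>tangent_eq_tvec\<close> and \<open>coords_tvec\<close> show.\<close>

definition tvec :: "'m set \<Rightarrow> ('m \<Rightarrow> 'e) \<Rightarrow> 'm \<Rightarrow> 'e \<Rightarrow> 'm tvec"
  where "tvec V \<phi> p \<xi> f = (if smooth_at A p f then frechet_derivative (chart_fun V \<phi> f) (at (\<phi> p)) \<xi> else 0)"

lemma chart_fun_derivative:
  assumes "(V, \<phi>) \<in> A" "p \<in> V" "smooth_at A p f"
  shows "(chart_fun V \<phi> f has_derivative frechet_derivative (chart_fun V \<phi> f) (at (\<phi> p))) (at (\<phi> p))"
    "(chart_fun V \<phi> f has_derivative (\<lambda>\<xi>. tvec V \<phi> p \<xi> f)) (at (\<phi> p))"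
proof -
  show "(chart_fun V \<phi> f has_derivative frechet_derivative (chart_fun V \<phi> f) (at (\<phi> p))) (at (\<phi> p))"
    by (rule C_inf_at_differentiable) (use assms smooth_at_iff[OF assms(1,2)] in simp)
  then show "(chart_fun V \<phi> f has_derivative (\<lambda>\<xi>. tvec V \<phi> p \<xi> f)) (at (\<phi> p))"
    using assms(3) by (simp add: tvec_def)
qed

lemma tvec_linear:
  assumes "(V, \<phi>) \<in> A" "p \<in> V" shows "linear (\<lambda>\<xi>. tvec V \<phi> p \<xi> f)"
  using has_derivative_linear[OF chart_fun_derivative(2)[OF assms]]
  by (cases "smooth_at A p f") (auto simp: tvec_def linear_iff)

lemma tvec_tangent:
  assumes "(V, \<phi>) \<in> A" "p \<in> V" shows "tvec V \<phi> p \<xi> \<in> T p"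
proof -
  have "tvec V \<phi> p \<xi> (\<lambda>q. a * f q + b * g q) = a * tvec V \<phi> p \<xi> f + b * tvec V \<phi> p \<xi> g"
    if "smooth_at A p f" "smooth_at A p g" for f g a b
  proof -
    have "(chart_fun V \<phi> (\<lambda>q. a * f q + b * g q) has_derivative
       (\<lambda>\<xi>. a * tvec V \<phi> p \<xi> f + b * tvec V \<phi> p \<xi> g)) (at (\<phi> p))"
      by (intro has_derivative_add has_derivative_mult_right chart_fun_derivative(2)[OF assms] that)
    from frechet_derivative_at[OF this] show ?thesis
      using that by (auto simp: tvec_def smooth_at_add smooth_at_mult smooth_at_const fun_eq_iff)
  qed
  moreover have "tvec V \<phi> p \<xi> (\<lambda>q. f q * g q) = f p * tvec V \<phi> p \<xi> g + g p * tvec V \<phi> p \<xi> f"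
    if "smooth_at A p f" "smooth_at A p g" for f g
  proof -
    have "(chart_fun V \<phi> (\<lambda>q. f q * g q) has_derivative
       (\<lambda>\<xi>. f p * tvec V \<phi> p \<xi> g + tvec V \<phi> p \<xi> f * g p)) (at (\<phi> p))"
      using has_derivative_mult[OF chart_fun_derivative(2)[OF assms that(1)] chart_fun_derivative(2)[OF assms that(2)]]
      by (simp add: assms)
    from fun_cong[OF frechet_derivative_at[OF this], of \<xi>] show ?thesis
      using that by (simp add: tvec_def smooth_at_mult mult.commute)
  qed
  ultimately show ?thesis by (auto simp: tangent_space_def tvec_def)
qed

definition coords :: "('m \<Rightarrow> 'e) \<Rightarrow> 'm tvec \<Rightarrow> 'e"
  where "coords \<phi> D = (\<Sum>b\<in>Basis. D (\<lambda>q. \<phi> q \<bullet> b) *\<^sub>R b)"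

lemma coords_inner [simp]: "b \<in> Basis \<Longrightarrow> coords \<phi> D \<bullet> b = D (\<lambda>q. \<phi> q \<bullet> b)"
  by (simp add: coords_def inner_sum_left inner_Basis if_distrib cong: if_cong)

text \<open>Hadamard's lemma at \<open>\<phi> p\<close>, with \<open>L\<close> the identity, writes
  \<open>f\<close> near \<open>p\<close> as a constant plus a sum of products of centred coordinates
  with smooth functions \<open>h b\<close>. The Leibniz rule leaves only the values of the
  \<open>h b\<close> at \<open>\<phi> p\<close>, and these are the partial derivatives of
  \<open>f\<close>.\<close>

lemma tangent_eq_tvec:
  assumes V: "(V, \<phi>) \<in> A" "p \<in> V" and D: "D \<in> T p"
  shows "D = tvec V \<phi> p (coords \<phi> D)"
proof
  fix f
  show "D f = tvec V \<phi> p (coords \<phi> D) f"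
  proof (cases "smooth_at A p f")
    case True
    let ?F = "chart_fun V \<phi> f" and ?y = "\<phi> p"
    obtain S where S: "open S" "?y \<in> S" "C_inf_on S ?F"
      using True unfolding smooth_at_iff[OF V] C_inf_at_def by blast
    obtain d where d: "d > 0" "ball ?y d \<subseteq> S" using S open_contains_ball by blast
    have seg: "\<forall>y\<in>ball ?y d. \<forall>s\<in>{0..1}. y - s *\<^sub>R (y - ?y) \<in> ball ?y d"
    proof (intro ballI)
      fix y s assume y: "y \<in> ball ?y d" and s: "s \<in> {0..1::real}"
      have "y - s *\<^sub>R (y - ?y) = (1 - s) *\<^sub>R y + s *\<^sub>R ?y" by (simp add: algebra_simps)
      then show "y - s *\<^sub>R (y - ?y) \<in> ball ?y d" using convexD_alt[OF convex_ball y, of ?y s] s d by auto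
    qed
    obtain h where h: "\<forall>v. C_inf_on (ball ?y d) (h v)"
      "\<forall>y\<in>ball ?y d. ?F y - ?F (y - (y - ?y)) = (\<Sum>b\<in>Basis. ((y - ?y) \<bullet> b) * h b y)"
      "\<forall>y\<in>ball ?y d. \<forall>v. y - ?y = 0 \<longrightarrow> h v y = frechet_derivative ?F (at y) v"
      using hadamard[OF open_ball bounded_linear_ident C_inf_on_subset[OF S(3) d(2)] seg] by blast
    have hC: "C_inf_at ?y (h b)" for b using h(1) d by (auto simp: C_inf_on_iff_at)
    let ?g = "\<lambda>b q. (\<phi> q \<bullet> b - ?y \<bullet> b) * h b (\<phi> q)"
    have sc: "smooth_at A p (\<lambda>q. \<phi> q \<bullet> b - ?y \<bullet> b)" for b
      by (rule smooth_at_diff[OF smooth_at_coord[OF V] smooth_at_const])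
    have sh: "smooth_at A p (\<lambda>q. h b (\<phi> q))" for b by (rule smooth_at_compose_chart[OF V hC])
    have sg: "smooth_at A p (?g b)" for b by (rule smooth_at_mult[OF sc sh])
    have "eventually (\<lambda>q. \<phi> q \<in> ball ?y d \<and> q \<in> V) (nhds p)"
      using topological_tendstoD[OF chart_tendsto[OF V], of "ball ?y d"] d chartD(1)[OF V(1)] V(2)
      by (intro eventually_conj) (auto simp: eventually_nhds_in_open)
    then have "eventually (\<lambda>q. f q = f p + (\<Sum>b\<in>Basis. ?g b q)) (nhds p)"
    proof eventually_elim
      case (elim q)
      then show ?case using h(2)[rule_format, of "\<phi> q"] V by (simp add: inner_diff_left)
    qed
    then have "D f = D (\<lambda>q. f p + (\<Sum>b\<in>Basis. ?g b q))" by (rule tangent_cong[OF D])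
    also have "\<dots> = (\<Sum>b\<in>Basis. D (?g b))"
    proof -
      have "D (\<lambda>q. f p + (\<Sum>b\<in>Basis. ?g b q)) = D (\<lambda>q. f p) + D (\<lambda>q. \<Sum>b\<in>Basis. ?g b q)"
        by (rule tangent_add[OF D smooth_at_const smooth_at_sum]) (rule sg)
      also have "D (\<lambda>q. \<Sum>b\<in>Basis. ?g b q) = (\<Sum>b\<in>Basis. D (?g b))" by (rule tangent_sum[OF D sg])
      finally show ?thesis by (simp add: tangent_const[OF D])
    qed
    also have "\<dots> = (\<Sum>b\<in>Basis. (coords \<phi> D \<bullet> b) * frechet_derivative ?F (at ?y) b)"
    proof (rule sum.cong[OF refl])
      fix b :: 'e assume b: "b \<in> Basis"
      have "D (\<lambda>q. \<phi> q \<bullet> b - ?y \<bullet> b) = D (\<lambda>q. \<phi> q \<bullet> b)"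
        using tangent_diff[OF D smooth_at_coord[OF V] smooth_at_const] tangent_const[OF D] by simp
      then show "D (?g b) = (coords \<phi> D \<bullet> b) * frechet_derivative ?F (at ?y) b"
        using tangent_mult[OF D sc sh] h(3) b d by simp
    qed
    also have "\<dots> = frechet_derivative ?F (at ?y) (coords \<phi> D)"
      using linear_expand[OF has_derivative_linear[OF chart_fun_derivative(1)[OF V True]], of "coords \<phi> D"] by simp
    finally show ?thesis using True by (simp add: tvec_def)
  next
    case False
    then show ?thesis using tangent_not_smooth[OF D] by (simp add: tvec_def)
  qed
qed

lemma coords_tvec:
  assumes V: "(V, \<phi>) \<in> A" "p \<in> V" shows "coords \<phi> (tvec V \<phi> p \<xi>) = \<xi>"
proof (rule euclidean_eqI)
  fix b :: 'e assume b: "b \<in> Basis"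
  have "((\<lambda>y. y \<bullet> b) has_derivative (\<lambda>\<xi>. \<xi> \<bullet> b)) (at (\<phi> p))" by (auto intro!: derivative_eq_intros)
  then have "((\<lambda>y. \<phi> (inv_into V \<phi> y) \<bullet> b) has_derivative (\<lambda>\<xi>. \<xi> \<bullet> b)) (at (\<phi> p))"
    by (rule has_derivative_transform_within_open[OF _ chartD(2)[OF V(1)]]) (use V chart_inv' in auto)
  from fun_cong[OF frechet_derivative_at[OF this], of \<xi>] show "coords \<phi> (tvec V \<phi> p \<xi>) \<bullet> b = \<xi> \<bullet> b"
    using b smooth_at_coord[OF V, of b] by (simp add: tvec_def)
qed

lemma smooth_at_tvec:
  assumes V: "(V, \<phi>) \<in> A" "p \<in> V" and f: "smooth_at A p f" and \<xi>: "\<And>b. b \<in> Basis \<Longrightarrow> smooth_at A p (\<lambda>q. \<xi> q \<bullet> b)"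
  shows "smooth_at A p (\<lambda>q. tvec V \<phi> q (\<xi> q) f)"
proof -
  have S: "smooth_at A p (\<lambda>q. \<Sum>b\<in>Basis. (\<xi> q \<bullet> b) * frechet_derivative (chart_fun V \<phi> f) (at (\<phi> q)) b)"
    using f unfolding smooth_at_iff[OF V, of f]
    by (intro smooth_at_sum smooth_at_mult \<xi> smooth_at_compose_chart[OF V, of "\<lambda>y. frechet_derivative (chart_fun V \<phi> f) (at y) b" for b] C_inf_at_frechet) auto
  have "eventually (\<lambda>q. q \<in> V \<and> smooth_at A q f) (nhds p)"
    using V chartD(1)[OF V(1)] smooth_at_eventually[OF f] by (intro eventually_conj) (auto simp: eventually_nhds_in_open)
  then have "eventually (\<lambda>q. (\<Sum>b\<in>Basis. (\<xi> q \<bullet> b) * frechet_derivative (chart_fun V \<phi> f) (at (\<phi> q)) b) = tvec V \<phi> q (\<xi> q) f) (nhds p)"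
  proof eventually_elim
    case (elim q)
    then show ?case
      using linear_expand[OF has_derivative_linear[OF chart_fun_derivative(1)[OF V(1), of q f]], of "\<xi> q"]
      by (simp add: tvec_def)
  qed
  from smooth_at_imp_cong[OF this S] show ?thesis .
qed

lemma vector_fields_iff:
  "X \<in> vector_fields A \<longleftrightarrow> (\<forall>p. X p \<in> T p) \<and> (\<forall>p f. smooth_at A p f \<longrightarrow> smooth_at A p (\<lambda>q. X q f))"
proof
  assume "X \<in> vector_fields A"
  then show "(\<forall>p. X p \<in> T p) \<and> (\<forall>p f. smooth_at A p f \<longrightarrow> smooth_at A p (\<lambda>q. X q f))"
    unfolding vector_fields_def smooth_at_def by blast
next
  assume "(\<forall>p. X p \<in> T p) \<and> (\<forall>p f. smooth_at A p f \<longrightarrow> smooth_at A p (\<lambda>q. X q f))"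
  then show "X \<in> vector_fields A" by (auto simp: vector_fields_def smooth_on_iff)
qed

text \<open>Vector fields here are globally defined, so local constructions have to be multiplied by
  such an \<open>\<eta>\<close>. The set \<open>K\<close> is the chart preimage of a closed ball;
  being compact in a Hausdorff space it is closed, which makes extension by \<open>0\<close>
  smooth.\<close>

lemma bump_at:
  assumes "open N" "p \<in> N"
  shows "\<exists>\<eta> K. (\<forall>q. smooth_at A q \<eta>) \<and> eventually (\<lambda>q. \<eta> q = 1) (nhds p) \<and>
    closed K \<and> K \<subseteq> N \<and> (\<forall>q. q \<notin> K \<longrightarrow> \<eta> q = (0::real))"
proof -
  obtain V \<phi> where V: "(V, \<phi>) \<in> A" "p \<in> V" using chart_at by blast
  obtain e where e: "e > 0" "cball (\<phi> p) e \<subseteq> \<phi> ` (V \<inter> N)"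
    using chart_open[OF V(1) assms(1)] assms(2) V(2) open_contains_cball[of "\<phi> ` (V \<inter> N)"] by blast
  obtain \<eta>0 :: "'e \<Rightarrow> real" where \<eta>0: "\<forall>y. C_inf_at y \<eta>0" "\<forall>y. dist (\<phi> p) y < e/2 \<longrightarrow> \<eta>0 y = 1"
    "\<forall>y. e \<le> dist (\<phi> p) y \<longrightarrow> \<eta>0 y = 0"
    using bump_function[OF e(1), of "\<phi> p"] by blast
  define K where "K = inv_into V \<phi> ` cball (\<phi> p) e"
  define \<eta> where "\<eta> q = (if q \<in> V then \<eta>0 (\<phi> q) else 0)" for q
  have "continuous_on (cball (\<phi> p) e) (inv_into V \<phi>)"
    using chartD(3)[OF V(1)] e(2) unfolding homeomorphism_def by (meson continuous_on_subset image_mono inf_le1)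
  then have K: "closed K" unfolding K_def by (intro compact_imp_closed compact_continuous_image) auto
  have KN: "K \<subseteq> V \<inter> N" using e(2) V by (fastforce simp: K_def)
  have off: "\<eta> q = 0" if "q \<notin> K" for q
  proof (cases "q \<in> V")
    case True
    then have "\<phi> q \<notin> cball (\<phi> p) e" using that V by (force simp: K_def)
    then show ?thesis using \<eta>0(3) by (auto simp: \<eta>_def)
  qed (simp add: \<eta>_def)
  have "smooth_at A q \<eta>" for q
  proof (cases "q \<in> V")
    case True
    have "eventually (\<lambda>q. \<eta>0 (\<phi> q) = \<eta> q) (nhds q)"
      using chartD(1)[OF V(1)] True by (auto simp: \<eta>_def eventually_nhds)
    from smooth_at_imp_cong[OF this smooth_at_compose_chart[OF V(1) True]] show ?thesis using \<eta>0(1) by simp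
  next
    case False
    have "eventually (\<lambda>q. 0 = \<eta> q) (nhds q)"
      unfolding eventually_nhds using K KN off False by (intro exI[of _ "- K"]) auto
    from smooth_at_imp_cong[OF this smooth_at_const] show ?thesis .
  qed
  moreover have "eventually (\<lambda>q. \<eta> q = 1) (nhds p)"
  proof -
    have "eventually (\<lambda>q. \<phi> q \<in> ball (\<phi> p) (e/2) \<and> q \<in> V) (nhds p)"
      using topological_tendstoD[OF chart_tendsto[OF V], of "ball (\<phi> p) (e/2)"] e chartD(1)[OF V(1)] V(2)
      by (intro eventually_conj) (auto simp: eventually_nhds_in_open)
    then show ?thesis by eventually_elim (use \<eta>0(2) in \<open>auto simp: \<eta>_def\<close>)
  qed
  ultimately show ?thesis using K KN off by (intro exI[of _ \<eta>] exI[of _ K]) auto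
qed

end

section \<open>b-vector fields\<close>

locale b_manifold = smooth_manifold A for A :: "('m::t2_space, 'e::euclidean_space) atlas" +
  fixes Z :: "'m set"
  assumes hyp: "hypersurface A Z"
begin

lemma closed_Z: "closed Z" using hyp by (simp add: hypersurface_def)

lemma eventually_off_Z: "p \<notin> Z \<Longrightarrow> eventually (\<lambda>q. q \<notin> Z) (nhds p)"
  using closed_Z eventually_nhds_in_open[of "- Z" p] by auto

text \<open>The germ version of \<open>defining_function_on\<close>: the differential is tested at
  \<open>p\<close> alone, which is what division by \<open>t\<close> near \<open>p\<close>
  requires.\<close>

definition defines_at :: "'m \<Rightarrow> ('m \<Rightarrow> real) \<Rightarrow> bool"
  where "defines_at p t \<longleftrightarrow> smooth_at A p t \<and> t p = 0 \<and> (\<exists>D\<in>T p. D t \<noteq> 0) \<and>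
    eventually (\<lambda>q. t q = 0 \<longleftrightarrow> q \<in> Z) (nhds p)"

lemma defining_function_defines_at:
  assumes "open U" "defining_function_on A Z U t" "p \<in> Z" "p \<in> U" shows "defines_at p t"
  unfolding defines_at_def eventually_nhds
  using assms smooth_on_iff[OF assms(1), of t] by (auto simp: defining_function_on_def)

lemma defines_at_exists: "p \<in> Z \<Longrightarrow> \<exists>t. defines_at p t"
  using hyp defining_function_defines_at unfolding hypersurface_def by meson

text \<open>A hypersurface has no interior: on an open subset of \<open>Z\<close> a defining
  function would vanish identically and be killed by every derivation.\<close>

lemma exists_off_Z: assumes "eventually P (nhds p)" shows "\<exists>q. q \<notin> Z \<and> P q"
proof (rule ccontr)
  assume "\<not> (\<exists>q. q \<notin> Z \<and> P q)"
  then have Z: "eventually (\<lambda>q. q \<in> Z) (nhds p)" using assms by (auto elim: eventually_mono)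
  then have "p \<in> Z" by (rule eventually_nhds_x_imp_x)
  then obtain t where t: "defines_at p t" using defines_at_exists by blast
  then obtain D where D: "D \<in> T p" "D t \<noteq> 0" by (auto simp: defines_at_def)
  have "eventually (\<lambda>q. t q = 0) (nhds p)"
    using Z t unfolding defines_at_def by (auto elim: eventually_elim2)
  from tangent_cong[OF D(1) this] show False using D tangent_const[OF D(1)] by simp
qed

text \<open>The density principle that carries identities from the complement of \<open>Z\<close> to
  \<open>Z\<close>: a nonzero value at \<open>p\<close> would persist at nearby points off
  \<open>Z\<close>.\<close>

lemma smooth_zero_off_Z:
  assumes "smooth_at A p f" "eventually (\<lambda>q. q \<notin> Z \<longrightarrow> f q = 0) (nhds p)" shows "f p = 0"
proof (rule ccontr)
  assume "f p \<noteq> 0"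
  from eventually_conj[OF smooth_at_eventually_neq[OF assms(1) this] assms(2)] exists_off_Z
  show False by blast
qed

lemma smooth_eq_off_Z:
  assumes "smooth_at A p f" "smooth_at A p g" "eventually (\<lambda>q. q \<notin> Z \<longrightarrow> f q = g q) (nhds p)" shows "f p = g p"
  using smooth_zero_off_Z[OF smooth_at_diff[OF assms(1,2)]] assms(3) by simp

lemma at_within_off_Z: assumes "p \<in> Z" shows "at p within - Z \<noteq> bot"
proof
  assume "at p within - Z = bot"
  then have "eventually (\<lambda>q. False) (at p within - Z)" by simp
  then have "eventually (\<lambda>q. q \<noteq> p \<longrightarrow> q \<in> - Z \<longrightarrow> False) (nhds p)" by (simp add: eventually_at_filter)
  then show False using exists_off_Z assms by blast
qed

lemma divide_by_defining_function:
  assumes t: "defines_at p t" and g: "smooth_at A p g" "eventually (\<lambda>q. q \<in> Z \<longrightarrow> g q = 0) (nhds p)"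
  shows "\<exists>h. smooth_at A p h \<and> eventually (\<lambda>q. g q = t q * h q) (nhds p)"
proof -
  obtain V \<phi> where V: "(V, \<phi>) \<in> A" "p \<in> V" using chart_at by blast
  obtain D where D: "D \<in> T p" "D t \<noteq> 0" using t by (auto simp: defines_at_def)
  have st: "smooth_at A p t" using t by (simp add: defines_at_def)
  have "eventually (\<lambda>q. t q = 0 \<longrightarrow> g q = 0) (nhds p)"
    using g(2) t unfolding defines_at_def by (auto elim: eventually_elim2)
  then have ev: "eventually (\<lambda>y. chart_fun V \<phi> t y = 0 \<longrightarrow> chart_fun V \<phi> g y = 0) (nhds (\<phi> p))"
    using eventually_chart[OF V, of "\<lambda>q. t q = 0 \<longrightarrow> g q = 0"] by simp
  have "frechet_derivative (chart_fun V \<phi> t) (at (\<phi> p)) (coords \<phi> D) \<noteq> 0"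
    using fun_cong[OF tangent_eq_tvec[OF V D(1)], of t] D(2) st by (simp add: tvec_def)
  then obtain h where h: "C_inf_at (\<phi> p) h" "eventually (\<lambda>y. chart_fun V \<phi> g y = chart_fun V \<phi> t y * h y) (nhds (\<phi> p))"
    using C_inf_at_divide_by_defining_function[of "\<phi> p" "chart_fun V \<phi> t" "chart_fun V \<phi> g"] ev st g(1) t V
    unfolding smooth_at_iff[OF V] defines_at_def by auto
  have "eventually (\<lambda>y. chart_fun V \<phi> g y = chart_fun V \<phi> t y * h (\<phi> (inv_into V \<phi> y))) (nhds (\<phi> p))"
    using h(2) eventually_chart_image[OF V] by eventually_elim (simp add: chart_inv'[OF V(1)])
  then have "eventually (\<lambda>q. g q = t q * h (\<phi> q)) (nhds p)"
    using eventually_chart[OF V, of "\<lambda>q. g q = t q * h (\<phi> q)"] by simp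
  then show ?thesis using smooth_at_compose_chart[OF V h(1)] by blast
qed

text \<open>A function vanishing on \<open>Z\<close> is locally a multiple of \<open>t\<close>, so
  the single equation \<open>D t = 0\<close> tests tangency against all of them.\<close>

lemma tangent_to_iff:
  assumes t: "defines_at p t" shows "D \<in> tangent_to A Z p \<longleftrightarrow> D \<in> T p \<and> D t = 0"
proof
  assume D: "D \<in> tangent_to A Z p"
  have "eventually (\<lambda>q. smooth_at A q t \<and> (t q = 0 \<longleftrightarrow> q \<in> Z)) (nhds p)"
    using t smooth_at_eventually unfolding defines_at_def by (auto intro: eventually_conj)
  then obtain U where U: "open U" "p \<in> U" "\<forall>q\<in>U. smooth_at A q t \<and> (t q = 0 \<longleftrightarrow> q \<in> Z)"
    unfolding eventually_nhds by blast
  then have "smooth_on A U t" "\<forall>q\<in>Z \<inter> U. t q = 0" by (auto simp: smooth_on_iff)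
  then show "D \<in> T p \<and> D t = 0" using D U(1,2) unfolding tangent_to_def by blast
next
  assume D: "D \<in> T p \<and> D t = 0"
  have "D h = 0" if U: "open U" "p \<in> U" "smooth_on A U h" "\<forall>q\<in>Z \<inter> U. h q = 0" for U h
  proof -
    have "smooth_at A p h" using U by (auto simp: smooth_at_def)
    moreover have "eventually (\<lambda>q. q \<in> Z \<longrightarrow> h q = 0) (nhds p)" using U unfolding eventually_nhds by blast
    ultimately obtain k where k: "smooth_at A p k" "eventually (\<lambda>q. h q = t q * k q) (nhds p)"
      using divide_by_defining_function[OF t] by blast
    have "D h = D (\<lambda>q. t q * k q)" by (rule tangent_cong[OF conjunct1[OF D] k(2)])
    also have "\<dots> = 0" using tangent_mult[of D p t k] D k t by (auto simp: defines_at_def)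
    finally show ?thesis .
  qed
  then show "D \<in> tangent_to A Z p" using D unfolding tangent_to_def by blast
qed

section \<open>Calculus of b-vector fields\<close>

abbreviation bvf where "bvf \<equiv> b_vector_fields A Z"

lemma bvf_tangent: "X \<in> bvf \<Longrightarrow> X p \<in> T p"
  by (simp add: b_vector_fields_def vector_fields_iff)

lemma bvf_smooth: "X \<in> bvf \<Longrightarrow> smooth_at A p f \<Longrightarrow> smooth_at A p (\<lambda>q. X q f)"
  by (simp add: b_vector_fields_def vector_fields_iff)

lemma bvf_tangent_to: "X \<in> bvf \<Longrightarrow> p \<in> Z \<Longrightarrow> X p \<in> tangent_to A Z p"
  by (simp add: b_vector_fields_def)

lemma bvf_defining_zero: "X \<in> bvf \<Longrightarrow> p \<in> Z \<Longrightarrow> defines_at p t \<Longrightarrow> X p t = 0"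
  using bvf_tangent_to tangent_to_iff by blast

lemma tangent_space_lincomb:
  assumes "\<And>i. i \<in> I \<Longrightarrow> D i \<in> T p" shows "(\<lambda>f. \<Sum>i\<in>I. c i * D i f) \<in> T p"
  using assms unfolding tangent_space_def
  by (auto simp: sum.distrib sum_distrib_left sum_distrib_right algebra_simps)

lemma tangent_to_lincomb:
  assumes "\<And>i. i \<in> I \<Longrightarrow> D i \<in> tangent_to A Z p" shows "(\<lambda>f. \<Sum>i\<in>I. c i * D i f) \<in> tangent_to A Z p"
proof -
  have "(\<lambda>f. \<Sum>i\<in>I. c i * D i f) \<in> T p" by (rule tangent_space_lincomb) (use assms in \<open>simp add: tangent_to_def\<close>)
  then show ?thesis unfolding tangent_to_def using assms by (fastforce simp: tangent_to_def intro!: sum.neutral)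
qed

lemma bvf_lincomb:
  assumes "\<And>i. i \<in> I \<Longrightarrow> Y i \<in> bvf" "\<And>i q. i \<in> I \<Longrightarrow> smooth_at A q (h i)"
  shows "(\<lambda>q f. \<Sum>i\<in>I. h i q * Y i q f) \<in> bvf"
  unfolding b_vector_fields_def vector_fields_iff
proof (intro CollectI conjI allI ballI impI)
  fix p
  show "(\<lambda>f. \<Sum>i\<in>I. h i p * Y i p f) \<in> T p"
    by (rule tangent_space_lincomb) (rule bvf_tangent[OF assms(1)])
  show "smooth_at A p (\<lambda>q. \<Sum>i\<in>I. h i q * Y i q f)" if "smooth_at A p f" for f
    by (intro smooth_at_sum smooth_at_mult assms(2) bvf_smooth[OF assms(1)] that)
  show "(\<lambda>f. \<Sum>i\<in>I. h i p * Y i p f) \<in> tangent_to A Z p" if "p \<in> Z"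
    by (rule tangent_to_lincomb) (rule bvf_tangent_to[OF assms(1) that])
qed

lemma vf_scale_bvf: "X \<in> bvf \<Longrightarrow> (\<And>q. smooth_at A q h) \<Longrightarrow> vf_scale h X \<in> bvf"
  using bvf_lincomb[of "{0::nat}" "\<lambda>_. X" "\<lambda>_. h"] by (simp add: vf_scale_def)

lemma vf_add_bvf: "X \<in> bvf \<Longrightarrow> Y \<in> bvf \<Longrightarrow> vf_add X Y \<in> bvf"
  using bvf_lincomb[of "{0,1::nat}" "\<lambda>i. if i = 0 then X else Y" "\<lambda>_ _. 1"] smooth_at_const
  by (simp add: vf_add_def)

section \<open>Cutoffs and local frames of the b-tangent bundle\<close>

lemma smooth_at_cutoff:
  assumes "\<And>q. smooth_at A q \<eta>" "closed K" "\<And>q. q \<notin> K \<Longrightarrow> \<eta> q = 0" "q \<in> K \<Longrightarrow> smooth_at A q g"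
  shows "smooth_at A q (\<lambda>q. \<eta> q * g q)"
proof (cases "q \<in> K")
  case True
  then show ?thesis using assms(1,4) by (simp add: smooth_at_mult)
next
  case False
  then have "eventually (\<lambda>q. 0 = \<eta> q * g q) (nhds q)"
    unfolding eventually_nhds using assms(2,3) by (intro exI[of _ "- K"]) auto
  from smooth_at_imp_cong[OF this smooth_at_const] show ?thesis .
qed

text \<open>Off the closed set \<open>K\<close> the product is locally zero, whatever
  \<open>Y\<close> does there. This turns frames on a chart into members of \<open>bvf\<close>, the
  only fields about which a b-form says anything.\<close>

lemma bvf_cutoff:
  assumes \<eta>: "\<And>q. smooth_at A q \<eta>" "closed K" "K \<subseteq> N" "\<And>q. q \<notin> K \<Longrightarrow> \<eta> q = 0"
    and Y: "\<And>q. q \<in> N \<Longrightarrow> Y q \<in> T q" "\<And>q. q \<in> N \<Longrightarrow> q \<in> Z \<Longrightarrow> Y q \<in> tangent_to A Z q"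
      "\<And>q f. q \<in> N \<Longrightarrow> smooth_at A q f \<Longrightarrow> smooth_at A q (\<lambda>q. Y q f)"
  shows "(\<lambda>q f. \<eta> q * Y q f) \<in> bvf"
  unfolding b_vector_fields_def vector_fields_iff
proof (intro CollectI conjI allI ballI impI)
  fix q
  show "(\<lambda>f. \<eta> q * Y q f) \<in> T q"
    using tangent_space_lincomb[of "{0::nat}" "\<lambda>_. Y q" q "\<lambda>_. \<eta> q"]
      tangent_space_lincomb[of "{}::nat set" "\<lambda>_. Y q" q "\<lambda>_. \<eta> q"] Y(1)[of q] \<eta>(3) \<eta>(4)[of q]
    by (cases "q \<in> K") auto
  show "smooth_at A q (\<lambda>q. \<eta> q * Y q f)" if "smooth_at A q f" for f
    by (rule smooth_at_cutoff[of \<eta> K]) (use \<eta> Y(3)[of q f] that in auto)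
  show "(\<lambda>f. \<eta> q * Y q f) \<in> tangent_to A Z q" if "q \<in> Z"
    using tangent_to_lincomb[of "{0::nat}" "\<lambda>_. Y q" q "\<lambda>_. \<eta> q"]
      tangent_to_lincomb[of "{}::nat set" "\<lambda>_. Y q" q "\<lambda>_. \<eta> q"] Y(2)[of q] \<eta>(3) \<eta>(4)[of q] that
    by (cases "q \<in> K") auto
qed

text \<open>The fibre being a quotient of a module of sections, a frame is encoded by its effect on
  germs of sections. Independence is required off \<open>Z\<close> only: over \<open>Z\<close> a
  frame of b-fields is dependent as a family of tangent vectors, since all its values are tangent to
  \<open>Z\<close>.\<close>

definition frame_at :: "'m \<Rightarrow> ('e \<Rightarrow> 'm vfield) \<Rightarrow> bool"
  where "frame_at p e \<longleftrightarrow>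
    (\<forall>X\<in>bvf. \<exists>c. (\<forall>b\<in>Basis. smooth_at A p (c b)) \<and>
       eventually (\<lambda>q. \<forall>f. X q f = (\<Sum>b\<in>Basis. c b q * e b q f)) (nhds p)) \<and>
    eventually (\<lambda>q. q \<notin> Z \<longrightarrow> (\<forall>a. (\<forall>f. (\<Sum>b\<in>Basis. a b * e b q f) = 0) \<longrightarrow> (\<forall>b\<in>Basis. a b = 0))) (nhds p)"

lemma frame_at_cong:
  assumes "frame_at p e" "eventually (\<lambda>q. \<forall>b\<in>Basis. \<forall>f. e' b q f = e b q f) (nhds p)"
  shows "frame_at p e'"
  unfolding frame_at_def
proof (intro conjI ballI)
  fix X assume "X \<in> bvf"
  then obtain c where c: "\<forall>b\<in>Basis. smooth_at A p (c b)"
    "eventually (\<lambda>q. \<forall>f. X q f = (\<Sum>b\<in>Basis. c b q * e b q f)) (nhds p)"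
    using assms(1) unfolding frame_at_def by blast
  have "eventually (\<lambda>q. \<forall>f. X q f = (\<Sum>b\<in>Basis. c b q * e' b q f)) (nhds p)"
    using c(2) assms(2) by eventually_elim simp
  then show "\<exists>c. (\<forall>b\<in>Basis. smooth_at A p (c b)) \<and>
       eventually (\<lambda>q. \<forall>f. X q f = (\<Sum>b\<in>Basis. c b q * e' b q f)) (nhds p)" using c(1) by blast
next
  have "eventually (\<lambda>q. q \<notin> Z \<longrightarrow> (\<forall>a. (\<forall>f. (\<Sum>b\<in>Basis. a b * e b q f) = 0) \<longrightarrow> (\<forall>b\<in>Basis. a b = 0))) (nhds p)"
    using assms(1) by (simp add: frame_at_def)
  then show "eventually (\<lambda>q. q \<notin> Z \<longrightarrow> (\<forall>a. (\<forall>f. (\<Sum>b\<in>Basis. a b * e' b q f) = 0) \<longrightarrow> (\<forall>b\<in>Basis. a b = 0))) (nhds p)"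
    using assms(2) by eventually_elim simp
qed

text \<open>Independence gives \<open>c b = 0\<close> at nearby points off \<open>Z\<close>, and
  smoothness of the coefficient carries this to \<open>p\<close>, also when \<open>p\<close> lies on
  \<open>Z\<close>.\<close>

lemma frame_at_unique:
  assumes "frame_at p e" "\<And>b. b \<in> Basis \<Longrightarrow> smooth_at A p (c b)"
    "eventually (\<lambda>q. \<forall>f. (\<Sum>b\<in>Basis. c b q * e b q f) = 0) (nhds p)" "b \<in> Basis"
  shows "c b p = 0"
proof (rule smooth_zero_off_Z[OF assms(2)[OF assms(4)]])
  have "eventually (\<lambda>q. q \<notin> Z \<longrightarrow> (\<forall>a. (\<forall>f. (\<Sum>b\<in>Basis. a b * e b q f) = 0) \<longrightarrow> (\<forall>b\<in>Basis. a b = 0))) (nhds p)"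
    using assms(1) by (simp add: frame_at_def)
  then show "eventually (\<lambda>q. q \<notin> Z \<longrightarrow> c b q = 0) (nhds p)"
    using assms(3) by eventually_elim (use assms(4) in auto)
qed

lemma tvec_sum:
  assumes "(V, \<phi>) \<in> A" "q \<in> V"
  shows "(\<Sum>b\<in>B. a b * tvec V \<phi> q (\<xi> b) f) = tvec V \<phi> q (\<Sum>b\<in>B. a b *\<^sub>R \<xi> b) f"
  using linear_sum[OF tvec_linear[OF assms], of "\<lambda>b. a b *\<^sub>R \<xi> b" B f] linear_scale[OF tvec_linear[OF assms]]
  by simp

lemma tvec_zero_imp:
  assumes "(V, \<phi>) \<in> A" "q \<in> V" "\<And>f. tvec V \<phi> q \<xi> f = 0" shows "\<xi> = 0"
proof -
  have "tvec V \<phi> q \<xi> = (\<lambda>f. 0)" using assms(3) by auto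
  then show ?thesis using coords_tvec[OF assms(1,2), of \<xi>] by (simp add: coords_def)
qed

text \<open>
  On \<open>Z\<close> the frame consists of the fields \<open>t \<partial>\<^sub>w\<close> and \<open>\<partial>\<^sub>b - (\<partial>\<^sub>b t / \<partial>\<^sub>w t) \<partial>\<^sub>w\<close>, where \<open>\<partial>\<^sub>w t \<noteq> 0\<close>.
\<close>

lemma local_frame:
  "\<exists>N E. open N \<and> p \<in> N \<and> (\<forall>q\<in>N. frame_at q E) \<and> (\<forall>b\<in>Basis. \<forall>q\<in>N. E b q \<in> T q \<and>
     (q \<in> Z \<longrightarrow> E b q \<in> tangent_to A Z q) \<and> (\<forall>f. smooth_at A q f \<longrightarrow> smooth_at A q (\<lambda>q. E b q f)))"
proof -
  obtain V \<phi> where V: "(V, \<phi>) \<in> A" "p \<in> V" using chart_at by blast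
  note oV = chartD(1)[OF V(1)]
  have coord: "smooth_at A q (\<lambda>q. X q (\<lambda>q. \<phi> q \<bullet> b))" if "X \<in> bvf" "q \<in> V" for X q b
    by (rule bvf_smooth[OF that(1) smooth_at_coord[OF V(1) that(2)]])
  have Xq: "X q f = tvec V \<phi> q (\<Sum>b\<in>Basis. X q (\<lambda>q. \<phi> q \<bullet> b) *\<^sub>R b) f" if "X \<in> bvf" "q \<in> V" for X q f
    using fun_cong[OF tangent_eq_tvec[OF V(1) that(2) bvf_tangent[OF that(1)]], of f] by (simp add: coords_def)
  show ?thesis
  proof (cases "p \<in> Z")
    case False
    define E where "E b q = tvec V \<phi> q b" for b q
    define N where "N = V \<inter> - Z"
    have N: "open N" "p \<in> N" using closed_Z oV V(2) False by (auto simp: N_def)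
    have fr: "frame_at q E" if q: "q \<in> N" for q
      unfolding frame_at_def
    proof (intro conjI ballI)
      fix X assume X: "X \<in> bvf"
      have "eventually (\<lambda>q. q \<in> N) (nhds q)" using N q by (simp add: eventually_nhds_in_open)
      then have "eventually (\<lambda>q. \<forall>f. X q f = (\<Sum>b\<in>Basis. X q (\<lambda>q. \<phi> q \<bullet> b) * E b q f)) (nhds q)"
      proof eventually_elim
        case (elim q)
        then have qV: "q \<in> V" by (simp add: N_def)
        show ?case unfolding E_def tvec_sum[OF V(1) qV] using Xq[OF X qV] by blast
      qed
      then show "\<exists>c. (\<forall>b\<in>Basis. smooth_at A q (c b)) \<and>
         eventually (\<lambda>q. \<forall>f. X q f = (\<Sum>b\<in>Basis. c b q * E b q f)) (nhds q)"
        using coord[OF X] q by (intro exI[of _ "\<lambda>b q. X q (\<lambda>q. \<phi> q \<bullet> b)"]) (auto simp: N_def)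
    next
      have "eventually (\<lambda>q. q \<in> N) (nhds q)" using N q by (simp add: eventually_nhds_in_open)
      then show "eventually (\<lambda>q. q \<notin> Z \<longrightarrow> (\<forall>a. (\<forall>f. (\<Sum>b\<in>Basis. a b * E b q f) = 0) \<longrightarrow> (\<forall>b\<in>Basis. a b = 0))) (nhds q)"
      proof eventually_elim
        case (elim q)
        then have q: "q \<in> V" by (simp add: N_def)
        have "a b = 0" if "\<forall>f. (\<Sum>b\<in>Basis. a b * E b q f) = 0" "b \<in> Basis" for a b
        proof -
          have "(\<Sum>b\<in>Basis. a b *\<^sub>R b) = (0::'e)"
            by (rule tvec_zero_imp[OF V(1) q]) (use that tvec_sum[OF V(1) q, of a "\<lambda>b. b"] in \<open>simp add: E_def\<close>)
          then have "(\<Sum>b\<in>Basis. a b *\<^sub>R b) \<bullet> b = 0" by simp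
          then show ?thesis using that(2) by (simp add: inner_sum_left inner_Basis if_distrib cong: if_cong)
        qed
        then show ?case by blast
      qed
    qed
    have "E b q \<in> T q \<and> (q \<in> Z \<longrightarrow> E b q \<in> tangent_to A Z q) \<and>
        (\<forall>f. smooth_at A q f \<longrightarrow> smooth_at A q (\<lambda>q. E b q f))" if "q \<in> N" for b q
      using that unfolding E_def N_def
      by (auto intro!: tvec_tangent[OF V(1)] smooth_at_tvec[OF V(1)] smooth_at_const)
    then show ?thesis using N fr by blast
  next
    case True
    then obtain U t where U: "open U" "p \<in> U" "defining_function_on A Z U t"
      using hyp unfolding hypersurface_def by blast
    have st: "smooth_at A q t" if "q \<in> U" for q using U smooth_on_iff[OF U(1)] that by (auto simp: defining_function_on_def)
    have tZ: "t q = 0 \<longleftrightarrow> q \<in> Z" if "q \<in> U" for q using U that by (auto simp: defining_function_on_def)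
    define d where "d b q = tvec V \<phi> q b t" for b q
    have sd: "smooth_at A q (d b)" if "q \<in> V \<inter> U" for q b
      unfolding d_def by (rule smooth_at_tvec[OF V(1)]) (use that st in \<open>auto intro: smooth_at_const\<close>)
    obtain w where w: "w \<in> Basis" "d w p \<noteq> 0"
    proof (rule ccontr)
      assume a: "\<not> thesis"
      obtain D where D: "D \<in> T p" "D t \<noteq> 0"
        using defining_function_defines_at[OF U(1,3) True U(2)] by (auto simp: defines_at_def)
      have "D t = (\<Sum>b\<in>Basis. (coords \<phi> D \<bullet> b) *\<^sub>R d b p)"
        using linear_expand[OF tvec_linear[OF V], of "coords \<phi> D" t] tangent_eq_tvec[OF V D(1)] unfolding d_def by metis
      also have "\<dots> = 0" using a that by (intro sum.neutral) auto
      finally show False using D by simp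
    qed
    obtain N0 where N0: "open N0" "p \<in> N0" "\<forall>q\<in>N0. d w q \<noteq> 0"
      using smooth_at_eventually_neq[OF sd w(2)] V U unfolding eventually_nhds by blast
    define N where "N = N0 \<inter> V \<inter> U"
    have N: "open N" "p \<in> N" using N0 oV V U by (auto simp: N_def)
    have dw: "d w q \<noteq> 0" if "q \<in> N" for q using N0 that by (simp add: N_def)
    define \<epsilon> where "\<epsilon> b q = (if b = w then t q *\<^sub>R w else b - (d b q * inverse (d w q)) *\<^sub>R w)" for b q
    define E where "E b q = tvec V \<phi> q (\<epsilon> b q)" for b q
    have def: "defines_at q t" if "q \<in> N" "q \<in> Z" for q
      using defining_function_defines_at[OF U(1,3) that(2)] that(1) by (simp add: N_def)
    have "E b q \<in> T q \<and> (q \<in> Z \<longrightarrow> E b q \<in> tangent_to A Z q) \<and>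
        (\<forall>f. smooth_at A q f \<longrightarrow> smooth_at A q (\<lambda>q. E b q f))" if q: "q \<in> N" for b q
    proof (intro conjI impI allI)
      have qV: "q \<in> V" "q \<in> U" using q by (auto simp: N_def)
      show ET: "E b q \<in> T q" unfolding E_def by (rule tvec_tangent[OF V(1) qV(1)])
      show "E b q \<in> tangent_to A Z q" if "q \<in> Z"
      proof -
        have lin: "linear (\<lambda>\<xi>. tvec V \<phi> q \<xi> t)" by (rule tvec_linear[OF V(1) qV(1)])
        have "E b q t = 0"
          using tZ[OF qV(2)] that dw[OF q] unfolding E_def \<epsilon>_def d_def
          by (simp add: linear_scale[OF lin] linear_diff[OF lin] linear_0[OF lin])
        then show ?thesis using tangent_to_iff[OF def[OF q that]] ET by blast
      qed
      show "smooth_at A q (\<lambda>q. E b q f)" if "smooth_at A q f" for f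
        unfolding E_def
      proof (rule smooth_at_tvec[OF V(1) qV(1) that])
        fix b' :: 'e
        show "smooth_at A q (\<lambda>q. \<epsilon> b q \<bullet> b')"
          using sd[of q] st[OF qV(2)] qV dw[OF q]
          by (cases "b = w") (auto simp: \<epsilon>_def inner_diff_left intro!: smooth_at_mult smooth_at_diff smooth_at_const smooth_at_inverse)
      qed
    qed
    moreover have "frame_at q E" if q: "q \<in> N" for q
      unfolding frame_at_def
    proof (intro conjI ballI)
      fix X assume X: "X \<in> bvf"
      have sX: "smooth_at A q (\<lambda>q. X q t)" using bvf_smooth[OF X st] q by (simp add: N_def)
      have evN: "eventually (\<lambda>q. q \<in> N) (nhds q)" using N q by (simp add: eventually_nhds_in_open)
      obtain h where h: "smooth_at A q h" "eventually (\<lambda>q. X q t = t q * h q) (nhds q)"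
      proof (cases "q \<in> Z")
        case True
        have "eventually (\<lambda>q. q \<in> Z \<longrightarrow> X q t = 0) (nhds q)"
          using evN by eventually_elim (use bvf_defining_zero[OF X] def in blast)
        then show ?thesis using divide_by_defining_function[OF def[OF q True] sX] that by blast
      next
        case False
        have tq: "t q \<noteq> 0" using tZ q False by (simp add: N_def)
        have stq: "smooth_at A q t" using st q by (simp add: N_def)
        have "eventually (\<lambda>q. X q t = t q * (X q t * inverse (t q))) (nhds q)"
          using smooth_at_eventually_neq[OF stq tq] by eventually_elim simp
        then show ?thesis using that smooth_at_mult[OF sX smooth_at_inverse[OF stq tq]] by blast
      qed
      \<comment> \<open>Forced by the frame. Comparing components along \<open>b \<noteq> w\<close>
        gives \<open>X\<close> applied to the coordinate. Applying the expansion to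
        \<open>t\<close>, which the fields with \<open>b \<noteq> w\<close> annihilate and for which
        \<open>E w t = t * d w\<close>, gives \<open>c w * d w = h\<close>.\<close>
      define c where "c b q = (if b = w then h q * inverse (d w q) else X q (\<lambda>q. \<phi> q \<bullet> b))" for b q
      have "smooth_at A q (c b)" for b
        using h(1) sd[of q] dw[OF q] coord[OF X] q
        by (cases "b = w") (auto simp: c_def[abs_def] N_def intro!: smooth_at_mult smooth_at_inverse)
      moreover have "eventually (\<lambda>q. \<forall>f. X q f = (\<Sum>b\<in>Basis. c b q * E b q f)) (nhds q)"
        using evN h(2)
      proof eventually_elim
        case (elim q)
        then have qV: "q \<in> V" by (simp add: N_def)
        let ?x = "\<lambda>b. X q (\<lambda>q. \<phi> q \<bullet> b)"
        have "t q * h q = (\<Sum>b\<in>Basis. ?x b * d b q)"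
          using Xq[OF X qV, of t] elim(2) tvec_sum[OF V(1) qV, of ?x "\<lambda>b. b" t Basis] by (simp add: d_def)
        also have "\<dots> = ?x w * d w q + (\<Sum>b\<in>Basis - {w}. ?x b * d b q)" using w(1) by (simp add: sum.remove)
        finally have th: "t q * h q * inverse (d w q) = ?x w + (\<Sum>b\<in>Basis - {w}. ?x b * d b q) * inverse (d w q)"
          using dw[OF elim(1)] by (simp add: field_simps)
        have "(\<Sum>b\<in>Basis. c b q *\<^sub>R \<epsilon> b q) = (t q * h q * inverse (d w q)) *\<^sub>R w +
            (\<Sum>b\<in>Basis - {w}. ?x b *\<^sub>R (b - (d b q * inverse (d w q)) *\<^sub>R w))"
          using w(1) by (subst sum.remove[of _ w]) (auto simp: c_def \<epsilon>_def mult_ac intro!: sum.cong)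
        also have "(\<Sum>b\<in>Basis - {w}. ?x b *\<^sub>R (b - (d b q * inverse (d w q)) *\<^sub>R w)) =
            (\<Sum>b\<in>Basis - {w}. ?x b *\<^sub>R b) - ((\<Sum>b\<in>Basis - {w}. ?x b * d b q) * inverse (d w q)) *\<^sub>R w"
          by (simp add: scaleR_diff_right sum_subtractf sum_distrib_right sum_distrib_left scaleR_sum_left mult_ac)
        finally have "(\<Sum>b\<in>Basis. c b q *\<^sub>R \<epsilon> b q) = ?x w *\<^sub>R w + (\<Sum>b\<in>Basis - {w}. ?x b *\<^sub>R b)"
          unfolding th by (simp add: scaleR_add_left)
        also have "\<dots> = (\<Sum>b\<in>Basis. ?x b *\<^sub>R b)" using w(1) by (simp add: sum.remove)
        finally have eq: "(\<Sum>b\<in>Basis. c b q *\<^sub>R \<epsilon> b q) = (\<Sum>b\<in>Basis. ?x b *\<^sub>R b)" .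
        show ?case unfolding E_def tvec_sum[OF V(1) qV] eq using Xq[OF X qV] by blast
      qed
      ultimately show "\<exists>c. (\<forall>b\<in>Basis. smooth_at A q (c b)) \<and>
         eventually (\<lambda>q. \<forall>f. X q f = (\<Sum>b\<in>Basis. c b q * E b q f)) (nhds q)" by blast
    next
      have "eventually (\<lambda>q. q \<in> N) (nhds q)" using N q by (simp add: eventually_nhds_in_open)
      then show "eventually (\<lambda>q. q \<notin> Z \<longrightarrow> (\<forall>a. (\<forall>f. (\<Sum>b\<in>Basis. a b * E b q f) = 0) \<longrightarrow> (\<forall>b\<in>Basis. a b = 0))) (nhds q)"
      proof eventually_elim
        case (elim q)
        then have q: "q \<in> V" "q \<in> U" by (simp_all add: N_def)
        have "a b = 0" if qZ: "q \<notin> Z" and a: "\<forall>f. (\<Sum>b\<in>Basis. a b * E b q f) = 0" and b: "b \<in> Basis" for a b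
        proof -
          have "(\<Sum>b\<in>Basis. a b *\<^sub>R \<epsilon> b q) = 0"
            by (rule tvec_zero_imp[OF V(1) q(1)]) (use a tvec_sum[OF V(1) q(1), of a "\<lambda>b. \<epsilon> b q"] in \<open>simp add: E_def\<close>)
          then have inner: "(\<Sum>b\<in>Basis. a b * (\<epsilon> b q \<bullet> b')) = 0" for b' by (metis (no_types, lifting) inner_scaleR_left inner_sum_left inner_zero_left sum.cong)
          have a0: "a b = 0" if "b \<in> Basis" "b \<noteq> w" for b
          proof -
            have "(\<Sum>b'\<in>Basis. a b' * (\<epsilon> b' q \<bullet> b)) = (\<Sum>b'\<in>Basis. if b' = b then a b else 0)"
              by (rule sum.cong) (use that w(1) in \<open>auto simp: \<epsilon>_def inner_diff_left inner_Basis\<close>)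
            then show ?thesis using inner[of b] that(1) by simp
          qed
          have "(\<Sum>b'\<in>Basis. a b' * (\<epsilon> b' q \<bullet> w)) = (\<Sum>b'\<in>Basis. if b' = w then a w * t q else 0)"
            by (rule sum.cong) (use a0 w(1) in \<open>auto simp: \<epsilon>_def inner_Basis\<close>)
          then have "a w = 0" using inner[of w] w(1) tZ[OF q(2)] qZ by simp
          then show ?thesis using a0 b by blast
        qed
        then show ?case by blast
      qed
    qed
    ultimately show ?thesis using N by blast
  qed
qed

text \<open>Being a frame is a property of germs, so the cut-off frame is still one wherever
  \<open>\<eta>\<close> is locally \<open>1\<close>.\<close>

lemma frame_exists:
  "\<exists>e. (\<forall>b\<in>Basis. e b \<in> bvf) \<and> eventually (\<lambda>q. frame_at q e) (nhds p)"
proof -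
  obtain N E where N: "open N" "p \<in> N" "\<forall>q\<in>N. frame_at q E" and E: "\<forall>b\<in>Basis. \<forall>q\<in>N. E b q \<in> T q \<and>
     (q \<in> Z \<longrightarrow> E b q \<in> tangent_to A Z q) \<and> (\<forall>f. smooth_at A q f \<longrightarrow> smooth_at A q (\<lambda>q. E b q f))"
    using local_frame[of p] by blast
  obtain \<eta> K where \<eta>: "\<forall>q. smooth_at A q \<eta>" "eventually (\<lambda>q. \<eta> q = 1) (nhds p)" "closed K" "K \<subseteq> N"
    "\<forall>q. q \<notin> K \<longrightarrow> \<eta> q = (0::real)" using bump_at[OF N(1,2)] by blast
  define e where "e b = (\<lambda>q f. \<eta> q * E b q f)" for b
  have "e b \<in> bvf" if "b \<in> Basis" for b
    unfolding e_def by (rule bvf_cutoff[of \<eta> K N]) (use \<eta> E that in auto)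
  moreover have "eventually (\<lambda>q. frame_at q e) (nhds p)"
  proof -
    obtain N1 where N1: "open N1" "p \<in> N1" "\<forall>q\<in>N1. \<eta> q = 1" using \<eta>(2) unfolding eventually_nhds by blast
    have "frame_at q e" if q: "q \<in> N \<inter> N1" for q
    proof (rule frame_at_cong)
      show "frame_at q E" using N(3) q by simp
      show "eventually (\<lambda>q. \<forall>b\<in>Basis. \<forall>f. e b q f = E b q f) (nhds q)"
        unfolding eventually_nhds using N1 q by (intro exI[of _ N1]) (auto simp: e_def)
    qed
    then show ?thesis unfolding eventually_nhds using N N1 by (intro exI[of _ "N \<inter> N1"]) auto
  qed
  ultimately show ?thesis by blast
qed

end

section \<open>Hamiltonian vector fields\<close>

context b_manifold
begin

section \<open>Differentials of b-functions\<close>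

lemma tangent_ln_abs:
  assumes D: "D \<in> T p" and t: "smooth_at A p t" "t p \<noteq> 0"
  shows "D (\<lambda>q. ln \<bar>t q\<bar>) = D t / t p"
proof -
  obtain V \<phi> where V: "(V, \<phi>) \<in> A" "p \<in> V" using chart_at by blast
  let ?\<xi> = "coords \<phi> D"
  have F: "(chart_fun V \<phi> t has_derivative (\<lambda>\<xi>. tvec V \<phi> p \<xi> t)) (at (\<phi> p))"
    by (rule chart_fun_derivative(2)[OF V t(1)])
  have "((\<lambda>x. ln \<bar>x\<bar>) has_real_derivative inverse (t p)) (at (t p))"
    by (rule has_real_derivative_ln_abs[OF t(2)])
  then have "((\<lambda>x. ln \<bar>x\<bar>) has_derivative (\<lambda>x. inverse (t p) * x)) (at (chart_fun V \<phi> t (\<phi> p)))"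
    using V by (simp add: has_field_derivative_def)
  from has_derivative_compose[OF F this]
  have "(chart_fun V \<phi> (\<lambda>q. ln \<bar>t q\<bar>) has_derivative (\<lambda>\<xi>. inverse (t p) * tvec V \<phi> p \<xi> t)) (at (\<phi> p))" .
  from fun_cong[OF frechet_derivative_at[OF this], of ?\<xi>]
  have "tvec V \<phi> p ?\<xi> (\<lambda>q. ln \<bar>t q\<bar>) = inverse (t p) * tvec V \<phi> p ?\<xi> t"
    using smooth_at_ln_abs[OF t] by (simp add: tvec_def)
  then show ?thesis
    unfolding tangent_eq_tvec[OF V D, symmetric] by (simp add: divide_inverse)
qed

lemma b_function_smooth_off_Z: "b_function A Z f \<Longrightarrow> p \<notin> Z \<Longrightarrow> smooth_at A p f"
  using closed_Z smooth_on_iff[of "- Z" f] by (auto simp: b_function_def)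

lemma b_function_at_Z:
  assumes "b_function A Z f"
  shows "\<exists>c. \<forall>p\<in>Z. \<exists>t g. defines_at p t \<and> smooth_at A p g \<and>
    eventually (\<lambda>q. q \<notin> Z \<longrightarrow> f q = c * ln \<bar>t q\<bar> + g q) (nhds p)"
proof -
  obtain c where c: "\<forall>p\<in>Z. \<exists>U t g. open U \<and> p \<in> U \<and> defining_function_on A Z U t \<and> smooth_on A U g \<and>
       (\<forall>q\<in>U - Z. f q = c * ln \<bar>t q\<bar> + g q)" using assms unfolding b_function_def by blast
  show ?thesis
  proof (intro exI[of _ c] ballI)
    fix p assume p: "p \<in> Z"
    then obtain U t g where U: "open U" "p \<in> U" "defining_function_on A Z U t" "smooth_on A U g"
      "\<forall>q\<in>U - Z. f q = c * ln \<bar>t q\<bar> + g q" using c by blast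
    have "eventually (\<lambda>q. q \<notin> Z \<longrightarrow> f q = c * ln \<bar>t q\<bar> + g q) (nhds p)"
      unfolding eventually_nhds using U by (intro exI[of _ U]) auto
    moreover have "smooth_at A p g" using U smooth_on_iff[OF U(1)] by blast
    ultimately show "\<exists>t g. defines_at p t \<and> smooth_at A p g \<and>
      eventually (\<lambda>q. q \<notin> Z \<longrightarrow> f q = c * ln \<bar>t q\<bar> + g q) (nhds p)"
      using defining_function_defines_at[OF U(1,3) p U(2)] by blast
  qed
qed

lemma b_diff_off_Z: "p \<notin> Z \<Longrightarrow> b_diff Z f v p = v p f" by (simp add: b_diff_def)

text \<open>On \<open>Z\<close> the value of \<open>b_diff\<close> is a limit along the complement,
  which accumulates at every point of \<open>Z\<close>; a smooth function agreeing with
  \<open>v f\<close> off \<open>Z\<close> must equal that limit. The argument applies at all points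
  near \<open>p\<close>, so the conclusion is an identity of germs.\<close>

lemma b_diff_extension:
  assumes f: "b_function A Z f" and v: "v \<in> bvf" and k: "smooth_at A p k"
    and ev: "eventually (\<lambda>q. q \<notin> Z \<longrightarrow> v q f = k q) (nhds p)"
  shows "eventually (\<lambda>q. b_diff Z f v q = k q) (nhds p)"
proof -
  have "eventually (\<lambda>q. eventually (\<lambda>q. q \<notin> Z \<longrightarrow> v q f = k q) (nhds q) \<and> smooth_at A q k) (nhds p)"
    using ev smooth_at_eventually[OF k] by (intro eventually_conj) (simp_all add: eventually_eventually)
  then show ?thesis
  proof eventually_elim
    case (elim q)
    show ?case
    proof (cases "q \<in> Z")
      case True
      have "(k \<longlongrightarrow> k q) (at q within - Z)"
        using smooth_at_tendsto[of q k] elim by (auto simp: tendsto_at_iff_tendsto_nhds[symmetric] intro: tendsto_within_subset)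
      moreover have "eventually (\<lambda>q. k q = v q f) (at q within - Z)"
        using elim by (auto simp: eventually_at_filter elim: eventually_mono)
      ultimately have "((\<lambda>q. v q f) \<longlongrightarrow> k q) (at q within - Z)" by (rule Lim_transform_eventually)
      then show ?thesis using tendsto_Lim at_within_off_Z[OF True] True by (auto simp: b_diff_def)
    next
      case False
      then show ?thesis using elim eventually_nhds_x_imp_x by (fastforce simp: b_diff_def)
    qed
  qed
qed

lemma bvf_eventually_zero_on_Z:
  assumes v: "v \<in> bvf" and t: "defines_at p t"
  shows "eventually (\<lambda>q. q \<in> Z \<longrightarrow> v q t = 0) (nhds p)"
proof -
  have st: "smooth_at A p t" using t by (simp add: defines_at_def)
  have "eventually (\<lambda>q. smooth_at A q t \<and> eventually (\<lambda>q. t q = 0 \<longleftrightarrow> q \<in> Z) (nhds q)) (nhds p)"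
    using t smooth_at_eventually[OF st] unfolding defines_at_def by (intro eventually_conj) (simp_all add: eventually_eventually)
  then show ?thesis
  proof eventually_elim
    case (elim q)
    obtain U where U: "open U" "q \<in> U" "\<forall>r\<in>U. smooth_at A r t \<and> (t r = 0 \<longleftrightarrow> r \<in> Z)"
      using eventually_conj[OF smooth_at_eventually[OF conjunct1[OF elim]] conjunct2[OF elim]] unfolding eventually_nhds by blast
    have "smooth_on A U t" "\<forall>r\<in>Z \<inter> U. t r = 0" using U by (auto simp: smooth_on_iff)
    then show ?case using bvf_tangent_to[OF v, of q] U(1,2) unfolding tangent_to_def by blast
  qed
qed

text \<open>Tangency to \<open>Z\<close> makes \<open>v t\<close> divisible by \<open>t\<close>, say
  \<open>v t = t h\<close>; then \<open>v (c ln |t| + g) = c h + v g\<close> and the pole has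
  cancelled.\<close>

lemma b_diff_local_smooth:
  assumes f: "b_function A Z f" and v: "v \<in> bvf"
  shows "\<exists>k. smooth_at A p k \<and> eventually (\<lambda>q. q \<notin> Z \<longrightarrow> v q f = k q) (nhds p)"
proof (cases "p \<in> Z")
  case False
  then show ?thesis using bvf_smooth[OF v b_function_smooth_off_Z[OF f]] by (intro exI[of _ "\<lambda>q. v q f"]) auto
next
  case True
  then obtain c t g where t: "defines_at p t" and g: "smooth_at A p g"
    and fe: "eventually (\<lambda>q. q \<notin> Z \<longrightarrow> f q = c * ln \<bar>t q\<bar> + g q) (nhds p)"
    using b_function_at_Z[OF f] by blast
  have st: "smooth_at A p t" using t by (simp add: defines_at_def)
  from bvf_eventually_zero_on_Z[OF v t]
  obtain h where h: "smooth_at A p h" "eventually (\<lambda>q. v q t = t q * h q) (nhds p)"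
    using divide_by_defining_function[OF t bvf_smooth[OF v st]] by blast
  have "smooth_at A p (\<lambda>q. c * h q + v q g)"
    by (intro smooth_at_add smooth_at_mult smooth_at_const h(1) bvf_smooth[OF v g])
  moreover have "eventually (\<lambda>q. q \<notin> Z \<longrightarrow> v q f = c * h q + v q g) (nhds p)"
  proof -
    have "eventually (\<lambda>q. eventually (\<lambda>q. q \<notin> Z \<longrightarrow> f q = c * ln \<bar>t q\<bar> + g q) (nhds q) \<and> v q t = t q * h q
       \<and> smooth_at A q t \<and> smooth_at A q g \<and> (t q = 0 \<longleftrightarrow> q \<in> Z)) (nhds p)"
      using fe h(2) smooth_at_eventually[OF st] smooth_at_eventually[OF g] t
      unfolding defines_at_def by (intro eventually_conj) (simp_all add: eventually_eventually)
    then show ?thesis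
    proof (eventually_elim, intro impI)
      fix q assume el: "eventually (\<lambda>q. q \<notin> Z \<longrightarrow> f q = c * ln \<bar>t q\<bar> + g q) (nhds q) \<and> v q t = t q * h q
       \<and> smooth_at A q t \<and> smooth_at A q g \<and> (t q = 0 \<longleftrightarrow> q \<in> Z)" and q: "q \<notin> Z"
      note vq = bvf_tangent[OF v, of q]
      have tq: "t q \<noteq> 0" using el q by blast
      have stq: "smooth_at A q t" using el by blast
      have sl: "smooth_at A q (\<lambda>q. ln \<bar>t q\<bar>)" using smooth_at_ln_abs el tq by blast
      have "eventually (\<lambda>q. f q = c * ln \<bar>t q\<bar> + g q) (nhds q)"
        using eventually_off_Z[OF q] conjunct1[OF el] by eventually_elim blast
      from tangent_cong[OF vq this] have "v q f = v q (\<lambda>q. c * ln \<bar>t q\<bar> + g q)" .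
      also have "\<dots> = c * v q (\<lambda>q. ln \<bar>t q\<bar>) + v q g"
        using tangent_lincomb[OF vq sl, of g c 1] el by simp
      also have "v q (\<lambda>q. ln \<bar>t q\<bar>) = h q" using tangent_ln_abs[OF vq stq tq] el tq by simp
      finally show "v q f = c * h q + v q g" .
    qed
  qed
  ultimately show ?thesis by blast
qed

lemma b_diff_smooth: assumes "b_function A Z f" "v \<in> bvf" shows "smooth_at A p (b_diff Z f v)"
proof -
  obtain k where k: "smooth_at A p k" "eventually (\<lambda>q. q \<notin> Z \<longrightarrow> v q f = k q) (nhds p)"
    using b_diff_local_smooth[OF assms] by blast
  have "eventually (\<lambda>q. k q = b_diff Z f v q) (nhds p)"
    using b_diff_extension[OF assms k] by eventually_elim simp
  then show ?thesis using smooth_at_imp_cong k(1) by blast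
qed

lemma b_diff_lincomb:
  assumes f: "b_function A Z f" and v: "v \<in> bvf" and e: "\<And>b. b \<in> B \<Longrightarrow> e b \<in> bvf"
    and c: "\<And>b. b \<in> B \<Longrightarrow> smooth_at A q (c b)"
    and ev: "eventually (\<lambda>q. \<forall>f. v q f = (\<Sum>b\<in>B. c b q * e b q f)) (nhds q)"
  shows "b_diff Z f v q = (\<Sum>b\<in>B. c b q * b_diff Z f (e b) q)"
proof (rule smooth_eq_off_Z)
  show "smooth_at A q (b_diff Z f v)" by (rule b_diff_smooth[OF f v])
  show "smooth_at A q (\<lambda>q. \<Sum>b\<in>B. c b q * b_diff Z f (e b) q)"
    by (intro smooth_at_sum smooth_at_mult c b_diff_smooth[OF f e])
  show "eventually (\<lambda>q. q \<notin> Z \<longrightarrow> b_diff Z f v q = (\<Sum>b\<in>B. c b q * b_diff Z f (e b) q)) (nhds q)"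
    using ev by eventually_elim (simp add: b_diff_off_Z)
qed

end

section \<open>The b-symplectic form and its Hamiltonian fields\<close>

locale b_symplectic = b_manifold A Z for A :: "('m::t2_space, 'e::euclidean_space) atlas" and Z +
  fixes \<omega> :: "'m two_form"
  assumes form: "b_two_form A Z \<omega>" and closed: "b_closed A Z \<omega>" and nondeg: "b_nondegenerate A Z \<omega>"
begin

lemma \<omega>_smooth: "v \<in> bvf \<Longrightarrow> w \<in> bvf \<Longrightarrow> smooth_at A p (\<omega> v w)"
  using form smooth_on_iff[OF open_UNIV] unfolding b_two_form_def by blast

lemma \<omega>_add:
  "u \<in> bvf \<Longrightarrow> v \<in> bvf \<Longrightarrow> w \<in> bvf \<Longrightarrow> \<omega> (vf_add u v) w p = \<omega> u w p + \<omega> v w p"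
  "u \<in> bvf \<Longrightarrow> v \<in> bvf \<Longrightarrow> w \<in> bvf \<Longrightarrow> \<omega> w (vf_add u v) p = \<omega> w u p + \<omega> w v p"
  using form unfolding b_two_form_def by blast+

lemma \<omega>_scale:
  assumes "\<And>q. smooth_at A q h" "v \<in> bvf" "w \<in> bvf"
  shows "\<omega> (vf_scale h v) w p = h p * \<omega> v w p" "\<omega> v (vf_scale h w) p = h p * \<omega> v w p"
proof -
  have "smooth_on A UNIV h" using assms(1) by (simp add: smooth_on_iff)
  then show "\<omega> (vf_scale h v) w p = h p * \<omega> v w p" "\<omega> v (vf_scale h w) p = h p * \<omega> v w p"
    using form assms(2,3) unfolding b_two_form_def by blast+
qed

lemma \<omega>_antisym: assumes "v \<in> bvf" "w \<in> bvf" shows "\<omega> v w p = - \<omega> w v p"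
proof -
  have z: "\<omega> u u p = 0" if "u \<in> bvf" for u using form that unfolding b_two_form_def by blast
  have "\<omega> (vf_add v w) (vf_add v w) p = \<omega> v v p + \<omega> v w p + (\<omega> w v p + \<omega> w w p)"
    using assms by (simp add: \<omega>_add vf_add_bvf)
  then show ?thesis using z assms vf_add_bvf by simp
qed

lemma \<omega>_lincomb:
  assumes "finite I" "\<And>i. i \<in> I \<Longrightarrow> Y i \<in> bvf" "\<And>i q. i \<in> I \<Longrightarrow> smooth_at A q (h i)" "w \<in> bvf"
  shows "\<omega> (\<lambda>q f. \<Sum>i\<in>I. h i q * Y i q f) w p = (\<Sum>i\<in>I. h i p * \<omega> (Y i) w p)"
  using assms(1,2,3)
proof (induction I)
  case empty
  have "\<omega> (vf_scale (\<lambda>_. 0) w) w p = 0" using \<omega>_scale(1)[OF smooth_at_const assms(4,4)] by simp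
  then show ?case by (simp add: vf_scale_def)
next
  case (insert i I)
  have "(\<lambda>q f. \<Sum>i\<in>insert i I. h i q * Y i q f) = vf_add (vf_scale (h i) (Y i)) (\<lambda>q f. \<Sum>i\<in>I. h i q * Y i q f)"
    using insert.hyps by (simp add: vf_add_def vf_scale_def)
  moreover have "vf_scale (h i) (Y i) \<in> bvf" "(\<lambda>q f. \<Sum>i\<in>I. h i q * Y i q f) \<in> bvf"
    using insert.prems by (auto intro!: vf_scale_bvf bvf_lincomb)
  ultimately show ?case
    using insert assms(4) by (simp add: \<omega>_add(1) \<omega>_scale(1))
qed

text \<open>Tensoriality: after multiplication by a cutoff with value \<open>1\<close> at
  \<open>p\<close>, the local expansion becomes a global identity with smooth coefficients, to which
  linearity over smooth functions applies.\<close>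

lemma \<omega>_local_lincomb:
  assumes v: "v \<in> bvf" and w: "w \<in> bvf" and B: "finite B" and e: "\<And>b. b \<in> B \<Longrightarrow> e b \<in> bvf"
    and c: "\<And>b. b \<in> B \<Longrightarrow> smooth_at A p (c b)"
    and ev: "eventually (\<lambda>q. \<forall>f. v q f = (\<Sum>b\<in>B. c b q * e b q f)) (nhds p)"
  shows "\<omega> v w p = (\<Sum>b\<in>B. c b p * \<omega> (e b) w p)"
proof -
  have "eventually (\<lambda>q. (\<forall>f. v q f = (\<Sum>b\<in>B. c b q * e b q f)) \<and> (\<forall>b\<in>B. smooth_at A q (c b))) (nhds p)"
    using ev B c smooth_at_eventually by (intro eventually_conj) (auto simp: eventually_ball_finite_distrib)
  then obtain N where N: "open N" "p \<in> N" "\<forall>q\<in>N. (\<forall>f. v q f = (\<Sum>b\<in>B. c b q * e b q f)) \<and> (\<forall>b\<in>B. smooth_at A q (c b))"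
    unfolding eventually_nhds by blast
  obtain \<eta> K where \<eta>: "\<forall>q. smooth_at A q \<eta>" "eventually (\<lambda>q. \<eta> q = 1) (nhds p)" "closed K" "K \<subseteq> N"
    "\<forall>q. q \<notin> K \<longrightarrow> \<eta> q = (0::real)" using bump_at[OF N(1,2)] by blast
  have \<eta>p: "\<eta> p = 1" using \<eta>(2) by (rule eventually_nhds_x_imp_x)
  have eq: "vf_scale \<eta> v = (\<lambda>q f. \<Sum>b\<in>B. (\<eta> q * c b q) * e b q f)"
  proof (intro ext)
    fix q f
    show "vf_scale \<eta> v q f = (\<Sum>b\<in>B. (\<eta> q * c b q) * e b q f)"
      using N(3) \<eta>(4,5) by (cases "q \<in> K") (auto simp: vf_scale_def sum_distrib_left mult_ac)
  qed
  have "smooth_at A q (\<lambda>q. \<eta> q * c b q)" if "b \<in> B" for b q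
    by (rule smooth_at_cutoff[of \<eta> K]) (use \<eta> N(3) that in auto)
  then have "\<omega> (vf_scale \<eta> v) w p = (\<Sum>b\<in>B. (\<eta> p * c b p) * \<omega> (e b) w p)"
    unfolding eq by (intro \<omega>_lincomb[OF B e _ w])
  then show ?thesis using \<omega>_scale(1)[of \<eta> v w p] \<eta>(1) v w \<eta>p by simp
qed

lemma \<omega>_local_lincomb_right:
  assumes v: "v \<in> bvf" and w: "w \<in> bvf" and B: "finite B" and e: "\<And>b. b \<in> B \<Longrightarrow> e b \<in> bvf"
    and c: "\<And>b. b \<in> B \<Longrightarrow> smooth_at A p (c b)"
    and ev: "eventually (\<lambda>q. \<forall>f. v q f = (\<Sum>b\<in>B. c b q * e b q f)) (nhds p)"
  shows "\<omega> w v p = (\<Sum>b\<in>B. c b p * \<omega> w (e b) p)"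
  using \<omega>_local_lincomb[OF v w B e c ev] \<omega>_antisym[OF w v] \<omega>_antisym[OF w e] by (simp add: sum_negf)

lemma \<omega>_local:
  assumes "v \<in> bvf" "v' \<in> bvf" "w \<in> bvf" "eventually (\<lambda>q. \<forall>f. v q f = v' q f) (nhds p)"
  shows "\<omega> v w p = \<omega> v' w p"
  using \<omega>_local_lincomb[of v w "{0::nat}" "\<lambda>_. v'" p "\<lambda>_ _. 1"] assms by (simp add: smooth_at_const)

text \<open>For points of \<open>Z\<close> the second conclusion, vanishing as an ordinary tangent
  vector, is weaker than the first. It is the one that matches \<open>regular_point\<close>, where
  linear independence is meant in the tangent space.\<close>

lemma nondegenerate_zero:
  assumes "v \<in> bvf" "\<And>w. w \<in> bvf \<Longrightarrow> \<omega> v w p = 0" shows "b_zero_at A Z p v" "v p f = 0"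
proof -
  show "b_zero_at A Z p v" using nondeg assms unfolding b_nondegenerate_def by blast
  then obtain k :: nat and h Y where "\<forall>i<k. h i p = 0" "v = (\<lambda>q f. \<Sum>i<k. h i q * Y i q f)"
    unfolding b_zero_at_def by blast
  then show "v p f = 0" by simp
qed

text \<open>Expanding the fields \<open>Y i\<close> from \<open>b_zero_at\<close> in the frame as
  well and comparing coefficients expresses \<open>a b\<close> through the \<open>h i\<close>, all
  of which vanish at \<open>q\<close>. With this, nondegeneracy becomes injectivity of the matrix of
  \<open>\<omega>\<close> in a frame.\<close>

lemma b_zero_frame_coefficient:
  assumes z: "b_zero_at A Z q (\<lambda>q f. \<Sum>b\<in>Basis. a b * e b q f)" and fr: "frame_at q e" and b: "(b::'e) \<in> Basis"
  shows "a b = 0"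
proof -
  obtain k :: nat and h Y where k: "\<forall>i<k. smooth_on A UNIV (h i) \<and> h i q = 0 \<and> Y i \<in> bvf"
    "(\<lambda>q f. \<Sum>b\<in>Basis. a b * e b q f) = (\<lambda>q f. \<Sum>i<k. h i q * Y i q f)"
    using z unfolding b_zero_at_def by blast
  have "\<forall>i. \<exists>c. i < k \<longrightarrow> (\<forall>b\<in>Basis. smooth_at A q (c b)) \<and>
       eventually (\<lambda>q. \<forall>f. Y i q f = (\<Sum>b\<in>Basis. c b q * e b q f)) (nhds q)"
    using fr k(1) unfolding frame_at_def by blast
  from choice[OF this] obtain c where c: "\<forall>i<k. (\<forall>b\<in>Basis. smooth_at A q (c i b)) \<and>
       eventually (\<lambda>q. \<forall>f. Y i q f = (\<Sum>b\<in>Basis. c i b q * e b q f)) (nhds q)" by (elim exE)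
  have h: "smooth_at A r (h i)" if "i < k" for i r using k(1) that by (simp add: smooth_on_iff)
  define u where "u b r = a b - (\<Sum>i<k. h i r * c i b r)" for b r
  have "u b q = 0"
  proof (rule frame_at_unique[OF fr _ _ b])
    show "smooth_at A q (u b)" if "b \<in> Basis" for b
      unfolding u_def using h c that by (auto intro!: smooth_at_diff smooth_at_const smooth_at_sum smooth_at_mult)
    have "eventually (\<lambda>q. \<forall>i\<in>{..<k}. \<forall>f. Y i q f = (\<Sum>b\<in>Basis. c i b q * e b q f)) (nhds q)"
      using c by (subst eventually_ball_finite_distrib) auto
    then show "eventually (\<lambda>q. \<forall>f. (\<Sum>b\<in>Basis. u b q * e b q f) = 0) (nhds q)"
    proof (eventually_elim, intro allI)
      fix r f assume Y: "\<forall>i\<in>{..<k}. \<forall>f. Y i r f = (\<Sum>b\<in>Basis. c i b r * e b r f)"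
      have "(\<Sum>b\<in>Basis. a b * e b r f) = (\<Sum>i<k. h i r * Y i r f)" using fun_cong[OF fun_cong[OF k(2)]] .
      also have "\<dots> = (\<Sum>i<k. \<Sum>b\<in>Basis. h i r * c i b r * e b r f)" using Y by (simp add: sum_distrib_left mult_ac)
      also have "\<dots> = (\<Sum>b\<in>Basis. (\<Sum>i<k. h i r * c i b r) * e b r f)"
        by (subst sum.swap) (simp add: sum_distrib_right)
      finally show "(\<Sum>b\<in>Basis. u b r * e b r f) = 0" by (simp add: u_def left_diff_distrib sum_subtractf)
    qed
  qed
  then show ?thesis using k(1) by (simp add: u_def)
qed

text \<open>In a frame the equation is a linear system whose matrix has the entries
  \<open>\<omega> (e b) (e b')\<close>. Nondegeneracy makes it injective,
  \<open>C_inf_on_linear_inverse\<close> makes the solution depend smoothly on the point, and a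
  cutoff turns its coefficients into global functions.\<close>

lemma local_hamiltonian_field:
  assumes f: "b_function A Z f"
  shows "\<exists>X\<in>bvf. eventually (\<lambda>q. \<forall>v\<in>bvf. \<omega> X v q = - b_diff Z f v q) (nhds p)"
proof -
  obtain e where e: "\<And>b. b \<in> Basis \<Longrightarrow> e b \<in> bvf" and efr: "eventually (\<lambda>q. frame_at q e) (nhds p)"
    using frame_exists[of p] by blast
  obtain V \<phi> where V: "(V, \<phi>) \<in> A" "p \<in> V" using chart_at by blast
  obtain N0 where N0: "open N0" "p \<in> N0" "\<forall>q\<in>N0. frame_at q e" using efr unfolding eventually_nhds by blast
  define N where "N = V \<inter> N0"
  have N: "open N" "p \<in> N" "\<And>q. q \<in> N \<Longrightarrow> frame_at q e" "N \<subseteq> V"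
    using N0 V chartD(1)[OF V(1)] by (auto simp: N_def)
  have oS: "open (\<phi> ` N)" unfolding N_def by (rule chart_open[OF V(1) N0(1)])
  \<comment> \<open>\<open>M y\<close> sends the coefficients \<open>u\<close> of a field to its
    pairings with the frame fields at the point with coordinates \<open>y\<close>;
    \<open>\<beta>\<close> collects the prescribed pairings.\<close>
  define M where "M y u = (\<Sum>b'\<in>Basis. (\<Sum>b\<in>Basis. (u \<bullet> b) * \<omega> (e b) (e b') (inv_into V \<phi> y)) *\<^sub>R b')" for y u :: 'e
  define \<beta> where "\<beta> y = (\<Sum>b\<in>Basis. (- b_diff Z f (e b) (inv_into V \<phi> y)) *\<^sub>R b)" for y :: 'e
  have Mb: "M y u \<bullet> b' = (\<Sum>b\<in>Basis. (u \<bullet> b) * \<omega> (e b) (e b') (inv_into V \<phi> y))" if "b' \<in> Basis" for y u b'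
    using that by (simp add: M_def inner_sum_left inner_Basis if_distrib cong: if_cong)
  have \<beta>b: "\<beta> y \<bullet> b = - b_diff Z f (e b) (inv_into V \<phi> y)" if "b \<in> Basis" for y b
    using that by (simp add: \<beta>_def inner_sum_left inner_Basis if_distrib cong: if_cong)
  have lin: "linear (M y)" for y
    unfolding M_def
    by (rule linearI) (simp_all add: inner_add_left sum.distrib distrib_right scaleR_add_left sum_distrib_left scaleR_sum_right mult.assoc)
  have inj: "inj (M y)" if "y \<in> \<phi> ` N" for y
    unfolding linear_injective_0[OF lin]
  proof (intro allI impI)
    fix u assume u: "M y u = 0"
    obtain q where q: "q \<in> N" "y = \<phi> q" using \<open>y \<in> \<phi> ` N\<close> by blast
    have qV: "inv_into V \<phi> y = q" using q N(4) V by auto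
    let ?X = "\<lambda>q f. \<Sum>b\<in>Basis. (u \<bullet> b) * e b q f"
    have X: "?X \<in> bvf" using bvf_lincomb[of "Basis::'e set" e "\<lambda>b _. u \<bullet> b"] e smooth_at_const by simp
    have "\<omega> ?X w q = 0" if w: "w \<in> bvf" for w
    proof -
      obtain c where c: "\<forall>b\<in>Basis. smooth_at A q (c b)"
        "eventually (\<lambda>q. \<forall>f. w q f = (\<Sum>b\<in>Basis. c b q * e b q f)) (nhds q)"
        using N(3)[OF q(1)] w unfolding frame_at_def by blast
      have "\<omega> ?X w q = (\<Sum>b'\<in>Basis. c b' q * \<omega> ?X (e b') q)"
        by (rule \<omega>_local_lincomb_right[OF w X finite_Basis e]) (use c in auto)
      also have "\<dots> = (\<Sum>b'\<in>Basis. c b' q * (M y u \<bullet> b'))"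
      proof (rule sum.cong[OF refl])
        fix b' :: 'e assume b': "b' \<in> Basis"
        have "\<omega> ?X (e b') q = (\<Sum>b\<in>Basis. (u \<bullet> b) * \<omega> (e b) (e b') q)"
          by (rule \<omega>_lincomb[OF finite_Basis e smooth_at_const e[OF b']])
        then show "c b' q * \<omega> ?X (e b') q = c b' q * (M y u \<bullet> b')" by (simp add: Mb[OF b'] qV)
      qed
      finally show ?thesis using u by simp
    qed
    then have z: "b_zero_at A Z q ?X" by (rule nondegenerate_zero(1)[OF X])
    have "u \<bullet> b = 0" if "b \<in> Basis" for b
      by (rule b_zero_frame_coefficient[where a="\<lambda>b. u \<bullet> b", OF z N(3)[OF q(1)] that])
    then show "u = 0" by (simp add: euclidean_eq_iff[of u 0])
  qed
  have MC: "C_inf_on (\<phi> ` N) (\<lambda>y. M y u)" for u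
    unfolding C_inf_on_iff_at[OF oS]
  proof safe
    fix q assume q: "q \<in> N"
    show "C_inf_at (\<phi> q) (\<lambda>y. M y u)"
    proof (rule C_inf_at_componentwise)
      fix b' :: 'e assume b': "b' \<in> Basis"
      have "smooth_at A q (\<lambda>q. \<Sum>b\<in>Basis. (u \<bullet> b) * \<omega> (e b) (e b') q)"
        by (intro smooth_at_sum smooth_at_mult smooth_at_const \<omega>_smooth e b')
      then show "C_inf_at (\<phi> q) (\<lambda>y. M y u \<bullet> b')"
        using smooth_at_iff[OF V(1), of q] q N(4) by (auto simp: Mb[OF b'])
    qed
  qed
  have \<beta>C: "C_inf_at (\<phi> q) \<beta>" if q: "q \<in> N" for q
  proof (rule C_inf_at_componentwise)
    fix b :: 'e assume b: "b \<in> Basis"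
    have "smooth_at A q (\<lambda>q. - b_diff Z f (e b) q)" by (intro smooth_at_minus b_diff_smooth[OF f e[OF b]])
    then show "C_inf_at (\<phi> q) (\<lambda>y. \<beta> y \<bullet> b)"
      using smooth_at_iff[OF V(1), of q] q N(4) by (auto simp: \<beta>b[OF b])
  qed
  define x where "x y = inv (M y) (\<beta> y)" for y
  have Mx: "M y (x y) = \<beta> y" if "y \<in> \<phi> ` N" for y
    using linear_injective_imp_surjective[OF lin inj[OF that]] by (simp add: x_def surj_f_inv_f)
  have xC: "C_inf_at (\<phi> q) x" if q: "q \<in> N" for q
  proof -
    have "C_inf_on (\<phi> ` N \<times> UNIV) (\<lambda>(y, v). inv (M y) v)"
      by (rule C_inf_on_linear_inverse[OF oS lin inj MC])
    then have 1: "C_inf_at (\<phi> q, \<beta> (\<phi> q)) (\<lambda>(y, v). inv (M y) v)"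
      using q C_inf_on_iff_at[OF open_Times[OF oS open_UNIV]] by blast
    have "C_inf_at (\<phi> q) (\<lambda>y. (y, 0) + (0, \<beta> y))"
      by (intro C_inf_at_add C_inf_at_bounded_linear[of "\<lambda>y. (y, 0)"] C_inf_at_linear_comp[OF _ \<beta>C[OF q], of "\<lambda>x. (0, x)"]
          bounded_linear_Pair bounded_linear_ident bounded_linear_zero)
    then have "C_inf_at (\<phi> q) (\<lambda>y. (y, \<beta> y))" by simp
    from C_inf_at_compose[OF this 1] show ?thesis by (simp add: x_def[abs_def])
  qed
  obtain \<eta> K where \<eta>: "\<forall>q. smooth_at A q \<eta>" "eventually (\<lambda>q. \<eta> q = 1) (nhds p)" "closed K" "K \<subseteq> N"
    "\<forall>q. q \<notin> K \<longrightarrow> \<eta> q = (0::real)" using bump_at[OF N(1,2)] by blast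
  define h where "h b q = \<eta> q * (x (\<phi> q) \<bullet> b)" for b q
  have hs: "smooth_at A q (h b)" for b q
    unfolding h_def
  proof (rule smooth_at_cutoff[of \<eta> K])
    assume q: "q \<in> K"
    then have qN: "q \<in> N" using \<eta>(4) by blast
    show "smooth_at A q (\<lambda>q. x (\<phi> q) \<bullet> b)"
      by (rule smooth_at_compose_chart[OF V(1), of q "\<lambda>y. x y \<bullet> b"])
        (use qN N(4) in \<open>auto intro!: C_inf_at_linear_comp[OF bounded_linear_inner_left xC[OF qN]]\<close>)
  qed (use \<eta> in auto)
  define X where "X = (\<lambda>q f. \<Sum>b\<in>Basis. h b q * e b q f)"
  have X: "X \<in> bvf" unfolding X_def by (rule bvf_lincomb[OF e hs])
  have "eventually (\<lambda>q. q \<in> N \<and> \<eta> q = 1) (nhds p)"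
    using \<eta>(2) N(1,2) by (intro eventually_conj) (auto simp: eventually_nhds_in_open)
  then have "eventually (\<lambda>q. \<forall>v\<in>bvf. \<omega> X v q = - b_diff Z f v q) (nhds p)"
  proof (eventually_elim, intro ballI)
    fix q v assume q: "q \<in> N \<and> \<eta> q = 1" and v: "v \<in> bvf"
    have qV: "inv_into V \<phi> (\<phi> q) = q" using q N(4) V by auto
    obtain c where c: "\<forall>b\<in>Basis. smooth_at A q (c b)"
      "eventually (\<lambda>q. \<forall>f. v q f = (\<Sum>b\<in>Basis. c b q * e b q f)) (nhds q)"
      using N(3)[of q] q v unfolding frame_at_def by blast
    have eq: "\<omega> X (e b') q = - b_diff Z f (e b') q" if b': "b' \<in> Basis" for b'
    proof -
      have "\<omega> X (e b') q = (\<Sum>b\<in>Basis. h b q * \<omega> (e b) (e b') q)"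
        unfolding X_def by (rule \<omega>_lincomb[OF finite_Basis e hs e[OF b']])
      also have "\<dots> = M (\<phi> q) (x (\<phi> q)) \<bullet> b'" using q by (simp add: Mb[OF b'] h_def qV)
      also have "\<dots> = - b_diff Z f (e b') q" using Mx[of "\<phi> q"] q by (simp add: \<beta>b[OF b'] qV)
      finally show ?thesis .
    qed
    have "\<omega> X v q = (\<Sum>b\<in>Basis. c b q * \<omega> X (e b) q)"
      by (rule \<omega>_local_lincomb_right[OF v X finite_Basis e]) (use c in auto)
    also have "\<dots> = - (\<Sum>b\<in>Basis. c b q * b_diff Z f (e b) q)" by (simp add: eq sum_negf)
    also have "(\<Sum>b\<in>Basis. c b q * b_diff Z f (e b) q) = b_diff Z f v q"
      by (rule b_diff_lincomb[OF f v e, symmetric]) (use c in auto)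
    finally show "\<omega> X v q = - b_diff Z f v q" .
  qed
  then show ?thesis using X by blast
qed

lemma \<omega>_eq_imp_eq:
  assumes "X \<in> bvf" "Y \<in> bvf" "\<And>v. v \<in> bvf \<Longrightarrow> \<omega> X v p = \<omega> Y v p" shows "X p = Y p"
proof
  fix f
  let ?W = "vf_add X (vf_scale (\<lambda>_. -1) Y)"
  have Y: "vf_scale (\<lambda>_. -1) Y \<in> bvf" by (rule vf_scale_bvf[OF assms(2) smooth_at_const])
  have "\<omega> ?W v p = 0" if "v \<in> bvf" for v
    using assms that Y by (simp add: \<omega>_add(1) \<omega>_scale(1) smooth_at_const)
  from nondegenerate_zero(2)[OF vf_add_bvf[OF assms(1) Y] this, of f] show "X p f = Y p f"
    by (simp add: vf_add_def vf_scale_def)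
qed

text \<open>Pointwise uniqueness takes the place of a partition of unity: local solutions agree
  wherever both solve the equation, so the diagonal \<open>Y q q\<close> coincides near
  \<open>p\<close> with the smooth field \<open>Y p\<close>.\<close>

lemma hamiltonian_field_exists:
  assumes f: "b_function A Z f"
  shows "\<exists>X\<in>bvf. \<forall>v\<in>bvf. \<forall>p. \<omega> X v p = - b_diff Z f v p"
proof -
  have "\<forall>p. \<exists>Y. Y \<in> bvf \<and> eventually (\<lambda>q. \<forall>v\<in>bvf. \<omega> Y v q = - b_diff Z f v q) (nhds p)"
    using local_hamiltonian_field[OF f] by blast
  from choice[OF this] obtain Y where Y: "\<And>p. Y p \<in> bvf"
    "\<And>p. eventually (\<lambda>q. \<forall>v\<in>bvf. \<omega> (Y p) v q = - b_diff Z f v q) (nhds p)" by blast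
  define X where "X q = Y q q" for q
  have XY: "eventually (\<lambda>q. X q = Y p q) (nhds p)" for p
    using Y(2)[of p]
  proof eventually_elim
    case (elim q)
    have "\<forall>v\<in>bvf. \<omega> (Y q) v q = - b_diff Z f v q" using Y(2)[of q] by (rule eventually_nhds_x_imp_x)
    then show ?case unfolding X_def by (intro \<omega>_eq_imp_eq Y(1)) (use elim in auto)
  qed
  have X: "X \<in> bvf"
    unfolding b_vector_fields_def vector_fields_iff
  proof (intro CollectI conjI allI ballI impI)
    fix p
    show "X p \<in> T p" unfolding X_def by (rule bvf_tangent[OF Y(1)])
    show "X p \<in> tangent_to A Z p" if "p \<in> Z" unfolding X_def by (rule bvf_tangent_to[OF Y(1) that])
    show "smooth_at A p (\<lambda>q. X q f)" if f: "smooth_at A p f" for f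
    proof -
      have "eventually (\<lambda>q. Y p q f = X q f) (nhds p)" using XY[of p] by eventually_elim simp
      from smooth_at_imp_cong[OF this bvf_smooth[OF Y(1) f]] show ?thesis .
    qed
  qed
  have "\<omega> X v p = - b_diff Z f v p" if v: "v \<in> bvf" for v p
  proof -
    have "eventually (\<lambda>q. \<forall>f. X q f = Y p q f) (nhds p)" using XY[of p] by eventually_elim simp
    from \<omega>_local[OF X Y(1) v this] have "\<omega> X v p = \<omega> (Y p) v p" .
    then show ?thesis using eventually_nhds_x_imp_x[OF Y(2)[of p]] v by simp
  qed
  then show ?thesis using X by blast
qed

text \<open>Existence and uniqueness together resolve the definite description; later facts on
  Hamiltonian fields come from these two properties.\<close>

lemma hamiltonian_field:
  assumes f: "b_function A Z f"
  shows "b_hamiltonian_field A Z \<omega> f \<in> bvf"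
    "v \<in> bvf \<Longrightarrow> \<omega> (b_hamiltonian_field A Z \<omega> f) v p = - b_diff Z f v p"
proof -
  obtain X where X: "X \<in> bvf" "\<forall>v\<in>bvf. \<forall>p. \<omega> X v p = - b_diff Z f v p"
    using hamiltonian_field_exists[OF f] by blast
  have "b_hamiltonian_field A Z \<omega> f = X"
    unfolding b_hamiltonian_field_def
  proof (rule the_equality)
    fix Y assume Y: "Y \<in> bvf \<and> (\<forall>v\<in>bvf. \<forall>p. \<omega> Y v p = - b_diff Z f v p)"
    then have "Y p = X p" for p using X by (intro \<omega>_eq_imp_eq) auto
    then show "Y = X" by auto
  qed (use X in blast)
  then show "b_hamiltonian_field A Z \<omega> f \<in> bvf"
    "v \<in> bvf \<Longrightarrow> \<omega> (b_hamiltonian_field A Z \<omega> f) v p = - b_diff Z f v p" using X by auto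
qed

end

section \<open>Lie brackets of b-vector fields\<close>

context b_manifold
begin

lemma tangent_to_zero:
  assumes D: "D \<in> tangent_to A Z p" and h: "smooth_at A p h" "eventually (\<lambda>q. q \<in> Z \<longrightarrow> h q = 0) (nhds p)"
  shows "D h = 0"
proof -
  obtain U where U: "open U" "p \<in> U" "\<forall>q\<in>U. smooth_at A q h \<and> (q \<in> Z \<longrightarrow> h q = 0)"
    using eventually_conj[OF smooth_at_eventually[OF h(1)] h(2)] unfolding eventually_nhds by blast
  have "smooth_on A U h" "\<forall>q\<in>Z \<inter> U. h q = 0" using U by (auto simp: smooth_on_iff)
  then show ?thesis using D U(1,2) unfolding tangent_to_def by blast
qed

lemma vf_lincomb_iterated:
  assumes X: "X \<in> bvf" and Y: "Y \<in> bvf" and f: "smooth_at A p f" and g: "smooth_at A p g"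
  shows "X p (\<lambda>q. Y q (\<lambda>r. a * f r + b * g r)) = a * X p (\<lambda>q. Y q f) + b * X p (\<lambda>q. Y q g)"
proof -
  have "eventually (\<lambda>q. Y q (\<lambda>r. a * f r + b * g r) = a * Y q f + b * Y q g) (nhds p)"
    using smooth_at_eventually[OF f] smooth_at_eventually[OF g]
    by eventually_elim (rule tangent_lincomb[OF bvf_tangent[OF Y]])
  from tangent_cong[OF bvf_tangent[OF X] this] show ?thesis
    using tangent_lincomb[OF bvf_tangent[OF X] bvf_smooth[OF Y f] bvf_smooth[OF Y g]] by simp
qed

lemma vf_mult_iterated:
  assumes X: "X \<in> bvf" and Y: "Y \<in> bvf" and f: "smooth_at A p f" and g: "smooth_at A p g"
  shows "X p (\<lambda>q. Y q (\<lambda>r. f r * g r)) =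
    f p * X p (\<lambda>q. Y q g) + Y p g * X p f + (g p * X p (\<lambda>q. Y q f) + Y p f * X p g)"
proof -
  have "eventually (\<lambda>q. Y q (\<lambda>r. f r * g r) = f q * Y q g + g q * Y q f) (nhds p)"
    using smooth_at_eventually[OF f] smooth_at_eventually[OF g]
    by eventually_elim (rule tangent_mult[OF bvf_tangent[OF Y]])
  from tangent_cong[OF bvf_tangent[OF X] this]
  have "X p (\<lambda>q. Y q (\<lambda>r. f r * g r)) = X p (\<lambda>q. f q * Y q g + g q * Y q f)" .
  also have "\<dots> = X p (\<lambda>q. f q * Y q g) + X p (\<lambda>q. g q * Y q f)"
    by (intro tangent_add[OF bvf_tangent[OF X]] smooth_at_mult f g bvf_smooth[OF Y])
  finally show ?thesis
    using tangent_mult[OF bvf_tangent[OF X] f bvf_smooth[OF Y g]] tangent_mult[OF bvf_tangent[OF X] g bvf_smooth[OF Y f]] by simp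
qed

text \<open>The function \<open>Y t\<close> vanishes on \<open>Z\<close>, so \<open>X\<close>
  annihilates it there, and symmetrically; hence the bracket annihilates \<open>t\<close> on
  \<open>Z\<close>. Closedness evaluates \<open>\<omega>\<close> on brackets, and the algebra of the
  form applies to them once they are known to be b-fields.\<close>

lemma lie_bracket_bvf:
  assumes X: "X \<in> bvf" and Y: "Y \<in> bvf" shows "lie_bracket A X Y \<in> bvf"
  unfolding b_vector_fields_def vector_fields_iff
proof (intro CollectI conjI allI ballI impI)
  fix p
  show T: "lie_bracket A X Y p \<in> T p"
    unfolding tangent_space_def
  proof (intro CollectI conjI allI impI)
    fix f g :: "'m \<Rightarrow> real" and a b
    show "\<not> smooth_at A p f \<Longrightarrow> lie_bracket A X Y p f = 0" by (simp add: lie_bracket_def)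
    assume f: "smooth_at A p f" and g: "smooth_at A p g"
    have "smooth_at A p (\<lambda>q. a * f q + b * g q)" by (intro smooth_at_add smooth_at_mult smooth_at_const f g)
    then show "lie_bracket A X Y p (\<lambda>q. a * f q + b * g q) = a * lie_bracket A X Y p f + b * lie_bracket A X Y p g"
      using f g by (simp add: lie_bracket_def vf_lincomb_iterated[OF X Y f g] vf_lincomb_iterated[OF Y X f g] algebra_simps)
    show "lie_bracket A X Y p (\<lambda>q. f q * g q) = f p * lie_bracket A X Y p g + g p * lie_bracket A X Y p f"
      using f g smooth_at_mult[OF f g]
      by (simp add: lie_bracket_def vf_mult_iterated[OF X Y f g] vf_mult_iterated[OF Y X f g] algebra_simps)
  qed
  show "smooth_at A p (\<lambda>q. lie_bracket A X Y q f)" if f: "smooth_at A p f" for f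
  proof -
    have "eventually (\<lambda>q. X q (\<lambda>r. Y r f) - Y q (\<lambda>r. X r f) = lie_bracket A X Y q f) (nhds p)"
      using smooth_at_eventually[OF f] by eventually_elim (simp add: lie_bracket_def)
    from smooth_at_imp_cong[OF this] show ?thesis
      by (simp add: smooth_at_diff bvf_smooth[OF X bvf_smooth[OF Y f]] bvf_smooth[OF Y bvf_smooth[OF X f]])
  qed
  assume p: "p \<in> Z"
  then obtain t where t: "defines_at p t" using defines_at_exists by blast
  then have st: "smooth_at A p t" by (simp add: defines_at_def)
  have "X p (\<lambda>r. Y r t) = 0" "Y p (\<lambda>r. X r t) = 0"
    using tangent_to_zero[OF bvf_tangent_to[OF X p] bvf_smooth[OF Y st] bvf_eventually_zero_on_Z[OF Y t]]
      tangent_to_zero[OF bvf_tangent_to[OF Y p] bvf_smooth[OF X st] bvf_eventually_zero_on_Z[OF X t]] by auto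
  then show "lie_bracket A X Y p \<in> tangent_to A Z p"
    using tangent_to_iff[OF t] T st by (simp add: lie_bracket_def)
qed

end

context b_symplectic
begin

abbreviation ham where "ham \<equiv> b_hamiltonian_field A Z \<omega>"

lemma hamiltonian_off_Z:
  "b_function A Z f \<Longrightarrow> v \<in> bvf \<Longrightarrow> q \<notin> Z \<Longrightarrow> \<omega> (ham f) v q = - v q f"
  by (simp add: hamiltonian_field(2) b_diff_off_Z)

lemma poisson_commute_apply:
  assumes "b_function A Z f" "b_function A Z g" "poisson_bracket A Z \<omega> f g q = 0" "q \<notin> Z"
  shows "ham g q f = 0"
  using hamiltonian_off_Z[OF assms(1) hamiltonian_field(1)[OF assms(2)] assms(4)] assms(3)
  by (simp add: poisson_bracket_def)

lemma poisson_bracket_antisym: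
  assumes "b_function A Z f" "b_function A Z g"
  shows "poisson_bracket A Z \<omega> f g q = - poisson_bracket A Z \<omega> g f q"
  unfolding poisson_bracket_def by (rule \<omega>_antisym[OF hamiltonian_field(1)[OF assms(1)] hamiltonian_field(1)[OF assms(2)]])

text \<open>Off \<open>Z\<close> the closedness identity for \<open>ham f\<close>,
  \<open>ham g\<close> and \<open>w\<close> collapses: the iterated derivatives of \<open>f\<close>
  and of \<open>g\<close> cancel in pairs, the remaining terms vanish with the Poisson bracket, and
  what is left says that the Lie bracket pairs to \<open>0\<close> with \<open>w\<close>.
  Nondegeneracy kills the Lie bracket there and density kills it on \<open>Z\<close>, where
  \<open>f\<close> and \<open>g\<close> may be singular.\<close>

lemma hamiltonian_fields_commute:
  assumes f: "b_function A Z f" and g: "b_function A Z g" and pb: "\<And>q. poisson_bracket A Z \<omega> f g q = 0"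
    and h: "smooth_at A p h"
  shows "ham f p (\<lambda>q. ham g q h) = ham g p (\<lambda>q. ham f q h)"
proof -
  let ?x = "ham f" and ?y = "ham g"
  let ?W = "lie_bracket A ?x ?y"
  note x = hamiltonian_field(1)[OF f] and y = hamiltonian_field(1)[OF g]
  note W = lie_bracket_bvf[OF x y]
  have W0: "?W q k = 0" if q: "q \<notin> Z" for q k
  proof (rule nondegenerate_zero(2)[OF W])
    fix w assume w: "w \<in> bvf"
    have sf: "smooth_at A q f" and sg: "smooth_at A q g"
      using b_function_smooth_off_Z f g q by blast+
    have ev: "eventually (\<lambda>r. r \<notin> Z) (nhds q)" by (rule eventually_off_Z[OF q])
    have "eventually (\<lambda>r. \<omega> ?y w r = (-1) * w r g) (nhds q)"
      using ev by eventually_elim (simp add: hamiltonian_off_Z[OF g w])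
    from tangent_cong[OF bvf_tangent[OF x] this] have 1: "?x q (\<omega> ?y w) = - ?x q (\<lambda>r. w r g)"
      using tangent_cmult[OF bvf_tangent[OF x] bvf_smooth[OF w sg], of "-1"] by simp
    have "eventually (\<lambda>r. \<omega> ?x w r = (-1) * w r f) (nhds q)"
      using ev by eventually_elim (simp add: hamiltonian_off_Z[OF f w])
    from tangent_cong[OF bvf_tangent[OF y] this] have 2: "?y q (\<omega> ?x w) = - ?y q (\<lambda>r. w r f)"
      using tangent_cmult[OF bvf_tangent[OF y] bvf_smooth[OF w sf], of "-1"] by simp
    have "\<omega> ?x ?y = (\<lambda>r. 0)" using pb by (auto simp: poisson_bracket_def)
    then have 3: "w q (\<omega> ?x ?y) = 0" using tangent_const[OF bvf_tangent[OF w]] by metis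
    have "eventually (\<lambda>r. ?x r g = 0) (nhds q)"
      using ev by eventually_elim (use poisson_commute_apply[OF g f] poisson_bracket_antisym[OF g f] pb in simp)
    from tangent_cong[OF bvf_tangent[OF w] this] have xg: "w q (\<lambda>r. ?x r g) = 0" using tangent_const[OF bvf_tangent[OF w]] by simp
    have "eventually (\<lambda>r. ?y r f = 0) (nhds q)"
      using ev by eventually_elim (use poisson_commute_apply[OF f g] pb in simp)
    from tangent_cong[OF bvf_tangent[OF w] this] have yf: "w q (\<lambda>r. ?y r f) = 0" using tangent_const[OF bvf_tangent[OF w]] by simp
    have 4: "\<omega> (lie_bracket A ?x w) ?y q = ?x q (\<lambda>r. w r g)"
      using \<omega>_antisym[OF lie_bracket_bvf[OF x w] y] hamiltonian_off_Z[OF g lie_bracket_bvf[OF x w] q] sg xg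
      by (simp add: lie_bracket_def)
    have 5: "\<omega> (lie_bracket A ?y w) ?x q = ?y q (\<lambda>r. w r f)"
      using \<omega>_antisym[OF lie_bracket_bvf[OF y w] x] hamiltonian_off_Z[OF f lie_bracket_bvf[OF y w] q] sf yf
      by (simp add: lie_bracket_def)
    have "?x q (\<omega> ?y w) - ?y q (\<omega> ?x w) + w q (\<omega> ?x ?y)
       - \<omega> (lie_bracket A ?x ?y) w q + \<omega> (lie_bracket A ?x w) ?y q - \<omega> (lie_bracket A ?y w) ?x q = 0"
      using closed x y w unfolding b_closed_def by blast
    then show "\<omega> ?W w q = 0" unfolding 1 2 3 4 5 by simp
  qed
  have "?W p h = 0"
    by (rule smooth_zero_off_Z[OF bvf_smooth[OF W h]]) (simp add: W0)
  then show ?thesis using h by (simp add: lie_bracket_def)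
qed

end

text \<open>Dimension count: the span of the \<open>\<xi> j\<close> has dimension \<open>n\<close>
  and lies in the common kernel of the \<open>l i\<close>, which has dimension
  \<open>2 n - n\<close>, so the two coincide.\<close>

lemma linear_annihilator_span:
  fixes \<xi> :: "nat \<Rightarrow> 'e::euclidean_space" and l :: "nat \<Rightarrow> 'e \<Rightarrow> real"
  assumes dim: "DIM('e) = 2 * n"
    and \<xi>: "\<And>a. (\<Sum>j=1..n. a j *\<^sub>R \<xi> j) = 0 \<Longrightarrow> \<forall>j\<in>{1..n}. a j = 0"
    and lin: "\<And>i. i \<in> {1..n} \<Longrightarrow> linear (l i)"
    and l: "\<And>a. (\<And>v. (\<Sum>i=1..n. a i * l i v) = 0) \<Longrightarrow> \<forall>i\<in>{1..n}. a i = 0"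
    and zero: "\<And>i j. i \<in> {1..n} \<Longrightarrow> j \<in> {1..n} \<Longrightarrow> l i (\<xi> j) = 0"
    and v: "\<And>i. i \<in> {1..n} \<Longrightarrow> l i v = 0"
  shows "\<exists>a. v = (\<Sum>j=1..n. a j *\<^sub>R \<xi> j)"
proof -
  \<comment> \<open>Independence of a family indexed by \<open>{1..n}\<close> says more than
    independence of its image as a set; the surplus, injectivity, follows by putting coefficients
    \<open>1\<close> and \<open>-1\<close> on two equal members.\<close>
  have fam: "independent (x ` {1..n}) \<and> inj_on x {1..n}"
    if x: "\<And>a. (\<Sum>j=1..n. a j *\<^sub>R x j) = 0 \<Longrightarrow> \<forall>j\<in>{1..n}. a j = 0" for x :: "nat \<Rightarrow> 'e"
  proof
    show inj: "inj_on x {1..n}"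
    proof (rule inj_onI, rule ccontr)
      fix i j assume ij: "i \<in> {1..n}" "j \<in> {1..n}" "x i = x j" "i \<noteq> j"
      let ?a = "\<lambda>k. if k = i then 1 else if k = j then -1 else (0::real)"
      have "(\<Sum>k=1..n. ?a k *\<^sub>R x k) = (\<Sum>k\<in>{i, j}. ?a k *\<^sub>R x k)"
        by (rule sum.mono_neutral_right) (use ij in auto)
      also have "\<dots> = 0" using ij by simp
      finally show False using x[of ?a] ij by (auto split: if_splits)
    qed
    show "independent (x ` {1..n})"
      unfolding independent_explicit_finite_subsets
    proof (intro allI impI ballI)
      fix B u y assume B: "B \<subseteq> x ` {1..n}" "finite B" "(\<Sum>y\<in>B. u y *\<^sub>R y) = 0" and y: "y \<in> B"
      let ?u = "\<lambda>y. if y \<in> B then u y else 0"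
      have "(\<Sum>j=1..n. ?u (x j) *\<^sub>R x j) = (\<Sum>y\<in>x ` {1..n}. ?u y *\<^sub>R y)" using inj by (simp add: sum.reindex)
      also have "\<dots> = (\<Sum>y\<in>B. ?u y *\<^sub>R y)" by (rule sum.mono_neutral_right) (use B in auto)
      also have "\<dots> = 0" using B(3) by simp
      finally have u0: "\<forall>j\<in>{1..n}. ?u (x j) = 0" by (rule x)
      obtain j where j: "j \<in> {1..n}" "y = x j" using y B(1) by blast
      then have "?u (x j) = 0" using u0 by blast
      then show "u y = 0" using y j by simp
    qed
  qed
  \<comment> \<open>The vectors representing the functionals, so that the common kernel becomes an
    orthogonal complement.\<close>
  define L where "L i = (\<Sum>b\<in>Basis. l i b *\<^sub>R b)" for i
  have Ll: "L i \<bullet> v = l i v" if "i \<in> {1..n}" for i v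
    using linear_expand[OF lin[OF that], of v] unfolding L_def inner_sum_left by (simp add: inner_commute mult.commute)
  have L: "\<forall>i\<in>{1..n}. a i = 0" if "(\<Sum>i=1..n. a i *\<^sub>R L i) = 0" for a
  proof (rule l)
    fix v
    have "(\<Sum>i=1..n. a i * l i v) = (\<Sum>i=1..n. a i *\<^sub>R L i) \<bullet> v" by (simp add: inner_sum_left Ll)
    then show "(\<Sum>i=1..n. a i * l i v) = 0" using that by simp
  qed
  let ?X = "span (\<xi> ` {1..n})" and ?L = "span (L ` {1..n})"
  have dX: "dim ?X = n" using fam[OF \<xi>] by (simp add: dim_span dim_eq_card_independent card_image)
  have dL: "dim ?L = n" using fam[OF L] by (simp add: dim_span dim_eq_card_independent card_image)
  let ?K = "{y \<in> UNIV. \<forall>x\<in>?L. orthogonal x y}"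
  have "dim ?K + dim ?L = dim (UNIV :: 'e set)"
    by (rule dim_subspace_orthogonal_to_vectors) (simp_all add: subspace_span)
  then have dK: "dim ?K = n" using dL dim by (simp add: dim_UNIV)
  have sK: "subspace ?K" by (auto simp: subspace_def orthogonal_def inner_add_right)
  have K: "y \<in> ?K" if "\<And>i. i \<in> {1..n} \<Longrightarrow> l i y = 0" for y
  proof -
    have "orthogonal y x" if "x \<in> ?L" for x
      by (rule orthogonal_to_span[OF that]) (use \<open>\<And>i. i \<in> {1..n} \<Longrightarrow> l i y = 0\<close> Ll in \<open>auto simp: orthogonal_def inner_commute\<close>)
    then show ?thesis by (simp add: orthogonal_commute)
  qed
  have "?X \<subseteq> ?K" by (rule span_minimal[OF _ sK]) (use K zero in blast)
  from subspace_dim_equal[OF subspace_span sK this] have "?X = ?K" by (simp only: dX dK order_refl)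
  then have "v \<in> ?X" using K v by blast
  then obtain u where "v = (\<Sum>y\<in>\<xi> ` {1..n}. u y *\<^sub>R y)" by (auto simp: span_finite)
  then show ?thesis using fam[OF \<xi>] by (intro exI[of _ "\<lambda>j. u (\<xi> j)"]) (simp add: sum.reindex)
qed

section \<open>Circle actions generated by a flow\<close>

context smooth_manifold
begin

lemma tangent_compose_chart:
  assumes V: "(V, \<phi>) \<in> A" "p \<in> V" and D: "D \<in> T p" and \<Gamma>: "C_inf_at (\<phi> p) \<Gamma>"
  shows "D (\<lambda>q. \<Gamma> (\<phi> q)) = (\<Sum>b\<in>Basis. D (\<lambda>q. \<phi> q \<bullet> b) * frechet_derivative \<Gamma> (at (\<phi> p)) b)"
proof -
  have d: "(\<Gamma> has_derivative frechet_derivative \<Gamma> (at (\<phi> p))) (at (\<phi> p))" by (rule C_inf_at_differentiable[OF \<Gamma>])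
  then have "((\<lambda>y. \<Gamma> (\<phi> (inv_into V \<phi> y))) has_derivative frechet_derivative \<Gamma> (at (\<phi> p))) (at (\<phi> p))"
    by (rule has_derivative_transform_within_open[OF _ chartD(2)[OF V(1)]]) (use V chart_inv' in auto)
  from fun_cong[OF frechet_derivative_at[OF this], of "coords \<phi> D"]
  have "tvec V \<phi> p (coords \<phi> D) (\<lambda>q. \<Gamma> (\<phi> q)) = frechet_derivative \<Gamma> (at (\<phi> p)) (coords \<phi> D)"
    using smooth_at_compose_chart[OF V \<Gamma>] by (simp add: tvec_def)
  then show ?thesis
    using linear_expand[OF has_derivative_linear[OF d], of "coords \<phi> D"]
    unfolding tangent_eq_tvec[OF V D, symmetric] by simp
qed

end

section \<open>A circle action together with its generating field\<close>

locale circle_flow = smooth_manifold A for A :: "('m::t2_space, 'e::euclidean_space) atlas" +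
  fixes U :: "'m set" and act :: "complex \<Rightarrow> 'm \<Rightarrow> 'm" and \<tau> :: real and X :: "'m vfield"
  assumes U: "open U" and action: "circle_action A U act" and \<tau>: "\<tau> > 0"
    and flow: "\<forall>x\<in>U. integral_curve A X UNIV (\<lambda>s. act (cis (2 * pi * s / \<tau>)) x)"
begin

lemma act_in: "norm z = 1 \<Longrightarrow> x \<in> U \<Longrightarrow> act z x \<in> U"
  using action unfolding circle_action_def by force

lemma act_one: "x \<in> U \<Longrightarrow> act 1 x = x"
  using action unfolding circle_action_def by blast

lemma act_mult: "norm z = 1 \<Longrightarrow> norm w = 1 \<Longrightarrow> x \<in> U \<Longrightarrow> act (z * w) x = act z (act w x)"
  using action unfolding circle_action_def by (simp add: dist_norm)

lemma act_continuous: "continuous_on (sphere 0 1 \<times> U) (\<lambda>(z, x). act z x)"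
  using action unfolding circle_action_def by blast

lemma act_open:
  assumes V: "(V, \<phi>) \<in> A" and W: "open W"
  shows "open {(s::real, y). y \<in> \<phi> ` (V \<inter> U) \<and> act (cis s) (inv_into V \<phi> y) \<in> W}"
proof -
  have inv: "continuous_on (\<phi> ` V) (inv_into V \<phi>)" using chartD(3)[OF V] by (simp add: homeomorphism_def)
  have "continuous_on (UNIV \<times> \<phi> ` (V \<inter> U)) (\<lambda>p. (\<lambda>(z, x). act z x) (cis (fst p), inv_into V \<phi> (snd p)))"
  proof (rule continuous_on_compose2[OF act_continuous])
    show "continuous_on (UNIV \<times> \<phi> ` (V \<inter> U)) (\<lambda>p::real \<times> 'e. (cis (fst p), inv_into V \<phi> (snd p)))"
      by (intro continuous_on_Pair continuous_on_compose2[OF inv] continuous_intros) auto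
    show "(\<lambda>p::real \<times> 'e. (cis (fst p), inv_into V \<phi> (snd p))) ` (UNIV \<times> \<phi> ` (V \<inter> U)) \<subseteq> sphere 0 1 \<times> U"
      using V by auto
  qed
  then have "open ((UNIV \<times> \<phi> ` (V \<inter> U)) \<inter> (\<lambda>p. (\<lambda>(z, x). act z x) (cis (fst p), inv_into V \<phi> (snd p))) -` W)"
    by (rule continuous_open_preimage) (simp_all add: W open_Times chart_open[OF V U])
  moreover have "(UNIV \<times> \<phi> ` (V \<inter> U)) \<inter> (\<lambda>p. (\<lambda>(z, x). act z x) (cis (fst p), inv_into V \<phi> (snd p))) -` W =
      {(s::real, y). y \<in> \<phi> ` (V \<inter> U) \<and> act (cis s) (inv_into V \<phi> y) \<in> W}" by auto
  ultimately show ?thesis by simp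
qed

text \<open>This is the smoothness clause of \<open>circle_action\<close> composed with
  \<open>h\<close> read in a chart at the image point. Smoothness jointly in angle and point is what
  later allows the flow to be expanded in time and then differentiated in space.\<close>

lemma act_joint_smooth:
  assumes V: "(V, \<phi>) \<in> A" "x \<in> V" and x: "x \<in> U" and h: "smooth_at A (act (cis s0) x) h"
  shows "C_inf_at (s0, \<phi> x) (\<lambda>p. h (act (cis (fst p)) (inv_into V \<phi> (snd p))))"
proof -
  obtain W \<psi> where W: "(W, \<psi>) \<in> A" "act (cis s0) x \<in> W" using chart_at by blast
  let ?\<Omega> = "{(s::real, y). y \<in> \<phi> ` (V \<inter> U) \<and> act (cis s) (inv_into V \<phi> y) \<in> W}"
  have \<Omega>: "open ?\<Omega>" "(s0, \<phi> x) \<in> ?\<Omega>" using act_open[OF V(1) chartD(1)[OF W(1)]] V x W by auto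
  have "\<forall>(V, \<phi>)\<in>A. \<forall>(W, \<psi>)\<in>A.
       C_inf_on {(s::real, y). y \<in> \<phi> ` (V \<inter> U) \<and> act (cis s) (inv_into V \<phi> y) \<in> W}
         (\<lambda>(s, y). \<psi> (act (cis s) (inv_into V \<phi> y)))"
    using action unfolding circle_action_def by (elim conjE)
  then have "C_inf_on ?\<Omega> (\<lambda>(s, y). \<psi> (act (cis s) (inv_into V \<phi> y)))" using V(1) W(1) by fast
  then have "C_inf_at (s0, \<phi> x) (\<lambda>(s, y). \<psi> (act (cis s) (inv_into V \<phi> y)))"
    unfolding C_inf_on_iff_at[OF \<Omega>(1)] using \<Omega>(2) by (rule bspec)
  then have 1: "C_inf_at (s0, \<phi> x) (\<lambda>p. \<psi> (act (cis (fst p)) (inv_into V \<phi> (snd p))))"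
    by (simp add: split_beta')
  have "C_inf_at (\<psi> (act (cis s0) x)) (chart_fun W \<psi> h)" using h smooth_at_iff[OF W] by blast
  then have "C_inf_at (\<psi> (act (cis (fst (s0, \<phi> x))) (inv_into V \<phi> (snd (s0, \<phi> x))))) (chart_fun W \<psi> h)"
    using V by simp
  from C_inf_at_compose[OF 1 this]
  have C: "C_inf_at (s0, \<phi> x) (\<lambda>p. chart_fun W \<psi> h (\<psi> (act (cis (fst p)) (inv_into V \<phi> (snd p)))))" .
  have "eventually (\<lambda>p. p \<in> ?\<Omega>) (nhds (s0, \<phi> x))" by (rule eventually_nhds_in_open[OF \<Omega>])
  then have "eventually (\<lambda>p. chart_fun W \<psi> h (\<psi> (act (cis (fst p)) (inv_into V \<phi> (snd p)))) =
      h (act (cis (fst p)) (inv_into V \<phi> (snd p)))) (nhds (s0, \<phi> x))"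
    by eventually_elim (use W(1) in auto)
  from C_inf_at_cong[OF this] show ?thesis using C by simp
qed

lemma act_smooth:
  assumes z: "norm z = 1" and x: "x \<in> U" and h: "smooth_at A (act z x) h"
  shows "smooth_at A x (\<lambda>q. h (act z q))"
proof -
  obtain V \<phi> where V: "(V, \<phi>) \<in> A" "x \<in> V" using chart_at by blast
  have "z \<noteq> 0" using z by auto
  then have "z = cis (Arg z)" using cis_Arg[of z] z by (simp add: sgn_div_norm)
  then obtain s where s: "z = cis s" by blast
  have 1: "C_inf_at (\<phi> x) (\<lambda>y. (0, y) + (s, 0))"
    by (intro C_inf_at_add C_inf_at_bounded_linear[of "\<lambda>y. (0, y)"] C_inf_at_const
        bounded_linear_Pair bounded_linear_ident bounded_linear_zero)
  have "C_inf_at ((0, \<phi> x) + (s, 0)) (\<lambda>p. h (act (cis (fst p)) (inv_into V \<phi> (snd p))))"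
    using act_joint_smooth[OF V x, of s h] h s by simp
  from C_inf_at_compose[OF 1 this] show ?thesis unfolding smooth_at_iff[OF V] s by simp
qed

text \<open>The flow in its own time parameter: a full turn by \<open>2 * pi\<close> takes time
  \<open>\<tau>\<close>.\<close>

definition fl :: "real \<Rightarrow> 'm \<Rightarrow> 'm" where "fl s x = act (cis (2 * pi * s / \<tau>)) x"

lemma fl_in: "x \<in> U \<Longrightarrow> fl s x \<in> U" by (simp add: fl_def act_in)

lemma fl_zero: "x \<in> U \<Longrightarrow> fl 0 x = x" by (simp add: fl_def act_one)

lemma fl_add: "x \<in> U \<Longrightarrow> fl (s + r) x = fl s (fl r x)"
  by (simp add: fl_def act_mult[symmetric] cis_mult add_divide_distrib distrib_left)

lemma fl_smooth: "x \<in> U \<Longrightarrow> smooth_at A (fl s x) h \<Longrightarrow> smooth_at A x (\<lambda>q. h (fl s q))"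
  unfolding fl_def by (rule act_smooth) auto

lemma fl_derivative:
  "x \<in> U \<Longrightarrow> smooth_at A (fl s x) k \<Longrightarrow> ((\<lambda>r. k (fl r x)) has_real_derivative X (fl s x) k) (at s)"
  using flow unfolding integral_curve_def fl_def by auto

lemma fl_tendsto: assumes "x \<in> U" shows "((\<lambda>r. fl r x) \<longlongrightarrow> fl s x) (nhds s)"
proof -
  have "continuous_on UNIV (\<lambda>r. (\<lambda>(z, x). act z x) (cis (2 * pi * r / \<tau>), x))"
    by (rule continuous_on_compose2[OF act_continuous]) (use assms \<tau> in \<open>auto intro!: continuous_intros\<close>)
  then have "isCont (\<lambda>r. fl r x) s" by (simp add: fl_def continuous_on_eq_continuous_at)
  then show ?thesis unfolding isCont_def by (subst tendsto_at_iff_tendsto_nhds[symmetric])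
qed

lemma fl_constant:
  assumes x: "x \<in> U" and u: "\<And>s. smooth_at A (fl s x) u" "\<And>s. X (fl s x) u = 0"
  shows "u (fl s x) = u x"
proof -
  have "((\<lambda>r. u (fl r x)) has_real_derivative 0) (at s)" for s
    using fl_derivative[OF x u(1), of s] u(2) by simp
  then have "u (fl s x) = u (fl 0 x)" using DERIV_isconst_all[of "\<lambda>r. u (fl r x)" s 0] by simp
  then show ?thesis using fl_zero[OF x] by simp
qed

text \<open>
  By Hadamard's lemma \<open>h (fl (-r) x) = h x + r G1 (r, x)\<close> with \<open>G1 (0, x) = - X h\<close>, so the
  derivative below is \<open>X (Y h) - Y (X h)\<close>.
\<close>

lemma push_forward_derivative:
  assumes X: "X \<in> vector_fields A" and Y: "Y \<in> vector_fields A" and q: "q \<in> U" and h: "smooth_at A q h"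
    and comm: "X q (\<lambda>x. Y x h) = Y q (\<lambda>x. X x h)"
  shows "((\<lambda>r. Y (fl r q) (\<lambda>x. h (fl (- r) x))) has_real_derivative 0) (at 0)"
proof -
  have YT: "Y p \<in> T p" and YS: "smooth_at A p k \<Longrightarrow> smooth_at A p (\<lambda>q. Y q k)"
    and XS: "smooth_at A p k \<Longrightarrow> smooth_at A p (\<lambda>q. X q k)" for p k
    using X Y by (auto simp: vector_fields_iff)
  obtain V \<phi> where V: "(V, \<phi>) \<in> A" "q \<in> V" using chart_at by blast
  obtain N where N: "open N" "q \<in> N" "\<forall>x\<in>N. smooth_at A x h"
    using smooth_at_eventually[OF h] unfolding eventually_nhds by blast
  \<comment> \<open>The function \<open>h\<close> composed with the backward flow, as a function of
    time and chart coordinates.\<close>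
  define G where "G p = h (fl (- fst p) (inv_into V \<phi> (snd p)))" for p :: "real \<times> 'e"
  have "C_inf_at (0, \<phi> q) G"
  proof -
    have 1: "C_inf_at (0, \<phi> q) (\<lambda>p::real \<times> 'e. ((- 2 * pi / \<tau>) * fst p, snd p))"
      by (intro C_inf_at_bounded_linear bounded_linear_Pair bounded_linear_snd
          bounded_linear_const_mult bounded_linear_fst)
    have "C_inf_at ((- 2 * pi / \<tau>) * fst (0, \<phi> q), snd (0, \<phi> q))
       (\<lambda>p. h (act (cis (fst p)) (inv_into V \<phi> (snd p))))"
      using act_joint_smooth[OF V q, of 0 h] h q by (simp add: act_one)
    from C_inf_at_compose[OF 1 this] show ?thesis by (simp add: G_def[abs_def] fl_def)
  qed
  then obtain S0 where S0: "open S0" "(0, \<phi> q) \<in> S0" "C_inf_on S0 G" unfolding C_inf_at_def by blast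
  define O' where "O' = V \<inter> (U \<inter> N)"
  have oO: "open (\<phi> ` O')" unfolding O'_def by (rule chart_open[OF V(1)]) (intro open_Int U N(1))
  have "open (S0 \<inter> UNIV \<times> \<phi> ` O')" "(0, \<phi> q) \<in> S0 \<inter> UNIV \<times> \<phi> ` O'"
    using S0 oO q V N by (auto simp: open_Times O'_def)
  then obtain d where d: "d > 0" "ball (0, \<phi> q) d \<subseteq> S0 \<inter> UNIV \<times> \<phi> ` O'"
    using open_contains_ball by blast
  define S where "S = ball (0::real, \<phi> q) d"
  have S: "open S" "(0, \<phi> q) \<in> S" using d by (auto simp: S_def)
  have SO: "snd p \<in> \<phi> ` O'" if "p \<in> S" for p using d that by (auto simp: S_def)
  have inS: "(0, snd p) \<in> S" if "p \<in> S" for p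
  proof -
    have "dist (0::real, \<phi> q) (0, snd p) \<le> dist (0, \<phi> q) p"
      using dist_snd_le[of "(0::real, \<phi> q)" p] by (simp add: dist_Pair_Pair)
    then show ?thesis using that by (simp add: S_def)
  qed
  let ?L = "\<lambda>p::real \<times> 'e. (fst p, 0::'e)"
  have bl: "bounded_linear ?L" by (intro bounded_linear_Pair bounded_linear_fst bounded_linear_zero)
  have seg: "\<forall>p\<in>S. \<forall>s\<in>{0..1}. p - s *\<^sub>R ?L (p - (0, \<phi> q)) \<in> S"
  proof (intro ballI)
    fix p s assume p: "p \<in> S" and s: "s \<in> {0..1::real}"
    have "p - s *\<^sub>R ?L (p - (0, \<phi> q)) = (1 - s) *\<^sub>R p + s *\<^sub>R (0, snd p)"
      by (cases p) (simp add: algebra_simps)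
    then show "p - s *\<^sub>R ?L (p - (0, \<phi> q)) \<in> S"
      using convexD_alt[of S p "(0, snd p)" s] p inS[OF p] s by (simp add: S_def)
  qed
  have GS: "C_inf_on S G" using S0(3) d(2) by (auto simp: S_def intro: C_inf_on_subset)
  obtain H where H: "\<forall>v. C_inf_on S (H v)"
    "\<forall>p\<in>S. G p - G (p - ?L (p - (0, \<phi> q))) = (\<Sum>b\<in>Basis. (?L (p - (0, \<phi> q)) \<bullet> b) * H b p)"
    "\<forall>p\<in>S. \<forall>v. ?L (p - (0, \<phi> q)) = 0 \<longrightarrow> H v p = frechet_derivative G (at p) v"
    using hadamard[OF S(1) bl GS seg] by blast
  \<comment> \<open>Only the basis vector \<open>(1, 0)\<close> contributes to the sum, so this is
    the Hadamard coefficient in the time direction.\<close>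
  define G1 where "G1 p = (\<Sum>b\<in>Basis. ((1::real, 0::'e) \<bullet> b) * H b p)" for p
  have G1C: "C_inf_at p G1" if "p \<in> S" for p
    unfolding G1_def using H(1) that S(1)
    by (intro C_inf_at_sum C_inf_at_mult C_inf_at_const) (auto simp: C_inf_on_iff_at)
  have G0: "G (0, \<phi> x) = h x" if "x \<in> V \<inter> U" for x using that V(1) by (simp add: G_def fl_zero)
  have GG1: "G p = G (0, snd p) + fst p * G1 p" if p: "p \<in> S" for p
  proof -
    have "p - ?L (p - (0, \<phi> q)) = (0, snd p)" by (cases p) simp
    moreover have "?L (p - (0, \<phi> q)) \<bullet> b = fst p * ((1, 0) \<bullet> b)" for b :: "real \<times> 'e" by (simp add: inner_prod_def)
    ultimately show ?thesis using H(2)[rule_format, OF p] by (simp add: G1_def sum_distrib_left mult.assoc)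
  qed
  have G10: "G1 (0, \<phi> x) = - X x h" if p: "(0, \<phi> x) \<in> S" and x: "x \<in> V" for x
  proof -
    have "\<phi> x \<in> \<phi> ` O'" using SO[OF p] by simp
    then have xO: "x \<in> U" "smooth_at A x h" using N(3) x V(1) inv_into_f_f chart_inv unfolding O'_def by (metis IntD1 IntD2 image_iff)+
    let ?D = "frechet_derivative G (at (0, \<phi> x))"
    have dG: "(G has_derivative ?D) (at (0, \<phi> x))" by (rule C_inf_on_differentiable[OF GS p])
    have "G1 (0, \<phi> x) = (\<Sum>b\<in>Basis. ((1::real, 0::'e) \<bullet> b) * ?D b)"
      unfolding G1_def using H(3)[rule_format, OF p] by (simp add: zero_prod_def)
    also have "\<dots> = ?D (1, 0)" using linear_expand[OF has_derivative_linear[OF dG], of "(1, 0)"] by simp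
    finally have e: "G1 (0, \<phi> x) = ?D (1, 0)" .
    have "((\<lambda>r::real. (r, \<phi> x)) has_derivative (\<lambda>r. (r, 0))) (at 0)"
      by (auto intro!: derivative_eq_intros)
    from has_derivative_compose[OF this dG]
    have dr: "((\<lambda>r. G (r, \<phi> x)) has_derivative (\<lambda>r. ?D (r, 0))) (at 0)" .
    have eq: "(\<lambda>r. ?D (r, 0)) = (*) (?D (1, 0))"
    proof
      fix r
      show "?D (r, 0) = ?D (1, 0) * r"
        using linear_scale[OF has_derivative_linear[OF dG], of r "(1, 0)"] by simp
    qed
    have d1: "((\<lambda>r. G (r, \<phi> x)) has_real_derivative ?D (1, 0)) (at 0)"
      unfolding has_field_derivative_def by (rule has_derivative_eq_rhs[OF dr eq])
    have "((\<lambda>r. h (fl r x)) has_real_derivative X x h) (at (- 0))"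
      using fl_derivative[OF xO(1), of 0 h] xO fl_zero by simp
    then have "((\<lambda>r. h (fl (- r) x)) has_real_derivative X x h * (-1)) (at 0)"
      by (rule DERIV_chain2[where g=uminus]) (auto intro!: derivative_eq_intros)
    then have "((\<lambda>r. G (r, \<phi> x)) has_real_derivative - X x h) (at 0)" using x V(1) by (simp add: G_def)
    then show ?thesis using DERIV_unique d1 e by metis
  qed
  \<comment> \<open>\<open>k r\<close> is \<open>Y\<close> at \<open>fl r q\<close> applied to
    \<open>G1 (r, _)\<close>, written in coordinates because in this form its continuity in
    \<open>r\<close> is visible.\<close>
  define k where "k r = (\<Sum>b\<in>Basis. Y (fl r q) (\<lambda>x. \<phi> x \<bullet> b) * frechet_derivative G1 (at (r, \<phi> (fl r q))) (0, b))" for r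
  have kY: "Y x (\<lambda>x. G1 (r, \<phi> x)) = (\<Sum>b\<in>Basis. Y x (\<lambda>x. \<phi> x \<bullet> b) * frechet_derivative G1 (at (r, \<phi> x)) (0, b))"
    and sG1: "smooth_at A x (\<lambda>x. G1 (r, \<phi> x))"
    if p: "(r, \<phi> x) \<in> S" and x: "x \<in> V" for r x
  proof -
    have 1: "C_inf_at (\<phi> x) (\<lambda>y. (0, y) + (r, 0))"
      by (intro C_inf_at_add C_inf_at_bounded_linear[of "\<lambda>y. (0, y)"] C_inf_at_const
          bounded_linear_Pair bounded_linear_ident bounded_linear_zero)
    have "C_inf_at ((0, \<phi> x) + (r, 0)) G1" using G1C[OF p] by simp
    from C_inf_at_compose[OF 1 this] have C: "C_inf_at (\<phi> x) (\<lambda>y. G1 (r, y))" by simp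
    show "smooth_at A x (\<lambda>x. G1 (r, \<phi> x))" by (rule smooth_at_compose_chart[OF V(1) x C])
    have "((\<lambda>y. (r, y)) has_derivative (\<lambda>v. (0, v))) (at (\<phi> x))" by (auto intro!: derivative_eq_intros)
    from has_derivative_compose[OF this C_inf_at_differentiable[OF G1C[OF p]]]
    have "frechet_derivative (\<lambda>y. G1 (r, y)) (at (\<phi> x)) = (\<lambda>v. frechet_derivative G1 (at (r, \<phi> x)) (0, v))"
      by (rule frechet_derivative_at[symmetric])
    then show "Y x (\<lambda>x. G1 (r, \<phi> x)) = (\<Sum>b\<in>Basis. Y x (\<lambda>x. \<phi> x \<bullet> b) * frechet_derivative G1 (at (r, \<phi> x)) (0, b))"
      using tangent_compose_chart[OF V(1) x YT C] by simp
  qed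
  have fq0: "fl 0 q = q" by (rule fl_zero[OF q])
  have tend: "((\<lambda>r. (r, \<phi> (fl r q))) \<longlongrightarrow> (0, \<phi> q)) (nhds 0)"
  proof (intro tendsto_Pair)
    show "((\<lambda>r. r) \<longlongrightarrow> (0::real)) (nhds 0)" by (simp add: filterlim_ident)
    show "((\<lambda>r. \<phi> (fl r q)) \<longlongrightarrow> \<phi> q) (nhds 0)"
      using filterlim_compose[OF chart_tendsto[OF V]] fl_tendsto[OF q, of 0] fq0 by simp
  qed
  have ev: "eventually (\<lambda>r. (r, \<phi> (fl r q)) \<in> S \<and> fl r q \<in> O') (nhds 0)"
  proof (intro eventually_conj)
    show "eventually (\<lambda>r. (r, \<phi> (fl r q)) \<in> S) (nhds 0)" by (rule topological_tendstoD[OF tend S])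
    have "open O'" "q \<in> O'" using chartD(1)[OF V(1)] U N q V by (auto simp: O'_def)
    then show "eventually (\<lambda>r. fl r q \<in> O') (nhds 0)"
      using topological_tendstoD[OF fl_tendsto[OF q, of 0], of O'] fq0 by simp
  qed
  have "eventually (\<lambda>r. Y (fl r q) (\<lambda>x. h (fl (- r) x)) = Y (fl r q) h + r * k r) (nhds 0)"
    using ev
  proof eventually_elim
    case (elim r)
    let ?x = "fl r q"
    have x: "?x \<in> V" "?x \<in> U" "?x \<in> N" using elim by (auto simp: O'_def)
    have "((\<lambda>x. (r, \<phi> x)) \<longlongrightarrow> (r, \<phi> ?x)) (nhds ?x)"
      by (intro tendsto_Pair tendsto_const chart_tendsto[OF V(1) x(1)])
    then have "eventually (\<lambda>x. (r, \<phi> x) \<in> S) (nhds ?x)" using topological_tendstoD S(1) elim by fast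
    moreover have "eventually (\<lambda>x. x \<in> V \<inter> U) (nhds ?x)"
      using eventually_nhds_in_open[OF open_Int[OF chartD(1)[OF V(1)] U]] x by simp
    ultimately have "eventually (\<lambda>x. h (fl (- r) x) = 1 * h x + r * G1 (r, \<phi> x)) (nhds ?x)"
    proof eventually_elim
      case (elim x)
      then show ?case using GG1[of "(r, \<phi> x)"] G0[of x] V(1) by (simp add: G_def)
    qed
    from tangent_cong[OF YT this]
    have "Y ?x (\<lambda>x. h (fl (- r) x)) = Y ?x (\<lambda>x. 1 * h x + r * G1 (r, \<phi> x))" .
    also have "\<dots> = 1 * Y ?x h + r * Y ?x (\<lambda>x. G1 (r, \<phi> x))"
      by (rule tangent_lincomb[OF YT]) (use N(3) x sG1 elim in auto)
    finally show ?case using kY[of r ?x] elim x by (simp add: k_def)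
  qed
  moreover have "((\<lambda>r. Y (fl r q) h + r * k r) has_real_derivative 0) (at 0)"
  proof -
    have d1: "((\<lambda>r. Y (fl r q) h) has_real_derivative X q (\<lambda>x. Y x h)) (at 0)"
      using fl_derivative[OF q, of 0 "\<lambda>x. Y x h"] YS[OF h] fq0 by simp
    have kc: "(k \<longlongrightarrow> k 0) (at 0)"
      unfolding k_def
    proof (intro tendsto_sum tendsto_mult)
      fix b :: 'e
      have "isCont (\<lambda>r. Y (fl r q) (\<lambda>x. \<phi> x \<bullet> b)) 0"
        using fl_derivative[OF q, of 0 "\<lambda>x. Y x (\<lambda>x. \<phi> x \<bullet> b)"] YS[OF smooth_at_coord[OF V]] fq0 DERIV_isCont by fastforce
      then show "((\<lambda>r. Y (fl r q) (\<lambda>x. \<phi> x \<bullet> b)) \<longlongrightarrow> Y (fl 0 q) (\<lambda>x. \<phi> x \<bullet> b)) (at 0)" by (simp add: isCont_def)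
      have "isCont (\<lambda>p. frechet_derivative G1 (at p) (0, b)) (0, \<phi> q)"
        by (rule C_inf_at_continuous[OF C_inf_at_frechet[OF G1C[OF S(2)]]])
      moreover have "((\<lambda>r. (r, \<phi> (fl r q))) \<longlongrightarrow> (0, \<phi> q)) (at 0)"
        using tend filterlim_mono[OF _ order_refl at_within_le_nhds] by blast
      ultimately show "((\<lambda>r. frechet_derivative G1 (at (r, \<phi> (fl r q))) (0, b)) \<longlongrightarrow>
          frechet_derivative G1 (at (0, \<phi> (fl 0 q))) (0, b)) (at 0)"
        unfolding fq0 by (rule isCont_tendsto_compose)
    qed
    \<comment> \<open>Continuity of \<open>k\<close> at \<open>0\<close> suffices here: the
      difference quotient of \<open>r * k r\<close> at \<open>0\<close> is \<open>k r\<close>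
      itself.\<close>
    have "((\<lambda>r. r * k r) has_real_derivative k 0) (at 0)"
      unfolding DERIV_def by (rule Lim_transform_eventually[OF kc]) (simp add: eventually_at_filter)
    from DERIV_add[OF d1 this]
    have "((\<lambda>r. Y (fl r q) h + r * k r) has_real_derivative X q (\<lambda>x. Y x h) + k 0) (at 0)" .
    moreover have "k 0 = - Y q (\<lambda>x. X x h)"
    proof -
      have "k 0 = Y q (\<lambda>x. G1 (0, \<phi> x))" using kY[OF S(2) V(2)] by (simp add: k_def fq0)
      also have "\<dots> = Y q (\<lambda>x. (-1) * X x h)"
      proof (rule tangent_cong[OF YT])
        have "((\<lambda>x. (0::real, \<phi> x)) \<longlongrightarrow> (0, \<phi> q)) (nhds q)"
          by (intro tendsto_Pair tendsto_const chart_tendsto[OF V])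
        then have "eventually (\<lambda>x. (0, \<phi> x) \<in> S) (nhds q)" using topological_tendstoD S by fast
        moreover have "eventually (\<lambda>x. x \<in> V) (nhds q)" using eventually_nhds_in_open[OF chartD(1)[OF V(1)] V(2)] .
        ultimately show "eventually (\<lambda>x. G1 (0, \<phi> x) = (-1) * X x h) (nhds q)"
          by eventually_elim (simp add: G10)
      qed
      also have "\<dots> = - Y q (\<lambda>x. X x h)" using tangent_cmult[OF YT XS[OF h], of "-1"] by simp
      finally show ?thesis .
    qed
    ultimately show ?thesis using comm by simp
  qed
  ultimately show ?thesis
    using DERIV_cong_ev[OF refl _ refl, of "\<lambda>r. Y (fl r q) (\<lambda>x. h (fl (- r) x))" "\<lambda>r. Y (fl r q) h + r * k r" 0 0] by blast
qed

text \<open>The function \<open>u\<close> of the proof tests on \<open>h\<close> the vector of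
  \<open>Y\<close> at \<open>fl r p\<close>, carried back to \<open>p\<close> by the flow. By the
  group law its derivative at any \<open>r\<close> is a derivative at time \<open>0\<close>, for the
  base point \<open>fl r p\<close> and the test function \<open>h\<close> composed with
  \<open>fl (- r)\<close>, and so vanishes by \<open>push_forward_derivative\<close>. At
  \<open>r = s\<close> the base point has returned to \<open>p\<close>.\<close>

lemma commuting_field_invariant:
  assumes X: "X \<in> vector_fields A" and Y: "Y \<in> vector_fields A"
    and comm: "\<And>q h. smooth_at A q h \<Longrightarrow> X q (\<lambda>x. Y x h) = Y q (\<lambda>x. X x h)"
    and p: "p \<in> U" and h: "smooth_at A p h" and s: "fl s p = p"
  shows "Y p (\<lambda>x. h (fl (- s) x)) = Y p h"
proof -
  have YT: "Y p \<in> T p" for p using Y by (simp add: vector_fields_iff)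
  define u where "u r = Y (fl r p) (\<lambda>x. h (fl (- r) x))" for r
  have "(u has_real_derivative 0) (at r)" for r
  proof -
    let ?q = "fl r p"
    have q: "?q \<in> U" by (rule fl_in[OF p])
    have ret: "fl (- r) ?q = p" using fl_add[OF p, of "- r" r] fl_zero[OF p] by simp
    have h': "smooth_at A ?q (\<lambda>x. h (fl (- r) x))" using fl_smooth[OF q, of "- r" h] ret h by simp
    have "Y (fl t ?q) (\<lambda>x. h (fl (- r) (fl (- t) x))) = u (t + r)" for t
    proof -
      have "eventually (\<lambda>x. h (fl (- r) (fl (- t) x)) = h (fl (- (t + r)) x)) (nhds (fl t ?q))"
        using eventually_nhds_in_open[OF U fl_in[OF q]]
        by eventually_elim (simp add: fl_add[symmetric] add.commute)
      from tangent_cong[OF YT this] show ?thesis by (simp add: u_def fl_add[OF p])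
    qed
    with push_forward_derivative[OF X Y q h' comm[OF h']]
    have "((\<lambda>t. u (t + r)) has_real_derivative 0) (at 0)" by simp
    then show ?thesis using DERIV_shift[of u 0 0 r] by simp
  qed
  then have "u s = u 0" using DERIV_isconst_all[of u s 0] by simp
  moreover have "u 0 = Y p h"
  proof -
    have "eventually (\<lambda>x. h (fl (- 0) x) = h x) (nhds p)"
      using eventually_nhds_in_open[OF U p] by eventually_elim (simp add: fl_zero)
    from tangent_cong[OF YT this] show ?thesis by (simp add: u_def fl_zero[OF p])
  qed
  ultimately show ?thesis by (simp add: u_def s)
qed

end

section \<open>Elements of the circle that fix a point\<close>

context circle_flow
begin

lemma act_tendsto:
  assumes z: "norm z = 1" and p: "p \<in> U" shows "(act z \<longlongrightarrow> act z p) (nhds p)"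
proof -
  have "continuous_on U (\<lambda>x. (\<lambda>(z, x). act z x) (z, x))"
    by (rule continuous_on_compose2[OF act_continuous]) (use z in \<open>auto intro!: continuous_intros\<close>)
  then have "isCont (act z) p" using U p by (simp add: continuous_on_eq_continuous_at)
  then show ?thesis unfolding isCont_def by (subst tendsto_at_iff_tendsto_nhds[symmetric])
qed

lemma act_power_fixed:
  assumes z: "norm z = 1" and p: "p \<in> U" "act z p = p" shows "act (z ^ i) p = p"
  using z p by (induction i) (simp_all add: act_one act_mult norm_power)

text \<open>
  The average over the finite group generated by \<open>z\<close> of the iterates, in a chart, is invariant under
  \<open>z\<close> and locally injective.
\<close>

lemma finite_order_trivial_differential:
  assumes p: "p \<in> U" and z: "norm z = 1" "act z p = p" and k: "0 < k" "z ^ k = 1"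
    and D: "\<And>D h i. D \<in> T p \<Longrightarrow> smooth_at A p h \<Longrightarrow> D (\<lambda>q. h (act (z ^ i) q)) = D h"
  shows "eventually (\<lambda>q. act z q = q) (nhds p)"
proof -
  obtain V \<phi> where V: "(V, \<phi>) \<in> A" "p \<in> V" using chart_at by blast
  have zi: "norm (z ^ i) = 1" for i using z by (simp add: norm_power)
  have ap: "act (z ^ i) p = p" for i by (rule act_power_fixed[OF z(1) p z(2)])
  let ?c = "\<lambda>i b q. \<phi> (act (z ^ i) q) \<bullet> b"
  have sc: "smooth_at A p (?c i b)" for i b
    using act_smooth[OF zi p, of i "\<lambda>q. \<phi> q \<bullet> b"] smooth_at_coord[OF V] ap by simp
  define F where "F y = (\<Sum>i<k. \<phi> (act (z ^ i) (inv_into V \<phi> y)))" for y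
  have FC: "C_inf_at (\<phi> p) F"
  proof (rule C_inf_at_componentwise)
    fix b :: 'e assume b: "b \<in> Basis"
    have "smooth_at A p (\<lambda>q. \<Sum>i<k. ?c i b q)" by (intro smooth_at_sum sc)
    then show "C_inf_at (\<phi> p) (\<lambda>y. F y \<bullet> b)"
      unfolding smooth_at_iff[OF V] by (simp add: F_def inner_sum_left)
  qed
  \<comment> \<open>By \<open>D\<close> every iterate has the identity as its differential at
    \<open>p\<close>, so the sum of \<open>k\<close> iterates has \<open>k\<close> times the
    identity, which is invertible.\<close>
  have F': "(F has_derivative (\<lambda>\<xi>. real k *\<^sub>R \<xi>)) (at (\<phi> p))"
    unfolding has_derivative_componentwise_within[of F]
  proof
    fix b :: 'e assume b: "b \<in> Basis"
    have "((\<lambda>y. \<Sum>i<k. chart_fun V \<phi> (?c i b) y) has_derivative (\<lambda>\<xi>. \<Sum>i<k. tvec V \<phi> p \<xi> (?c i b))) (at (\<phi> p))"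
      by (intro has_derivative_sum chart_fun_derivative(2)[OF V sc])
    moreover have "tvec V \<phi> p \<xi> (?c i b) = \<xi> \<bullet> b" for \<xi> i
    proof -
      have "tvec V \<phi> p \<xi> (?c i b) = tvec V \<phi> p \<xi> (\<lambda>q. \<phi> q \<bullet> b)"
        by (rule D[OF tvec_tangent[OF V] smooth_at_coord[OF V]])
      also have "\<dots> = coords \<phi> (tvec V \<phi> p \<xi>) \<bullet> b" using b by simp
      finally show ?thesis by (simp add: coords_tvec[OF V])
    qed
    ultimately show "((\<lambda>y. F y \<bullet> b) has_derivative (\<lambda>\<xi>. (real k *\<^sub>R \<xi>) \<bullet> b)) (at (\<phi> p))"
      by (simp add: F_def inner_sum_left)
  qed
  obtain S where S: "open S" "\<phi> p \<in> S" "C_inf_on S F" using FC unfolding C_inf_at_def by blast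
  define f' where "f' y = Blinfun (frechet_derivative F (at y))" for y
  have f': "blinfun_apply (f' y) = frechet_derivative F (at y)" if "y \<in> S" for y
    unfolding f'_def
    by (rule bounded_linear_Blinfun_apply) (use C_inf_on_differentiable[OF S(3) that] in \<open>auto simp: has_derivative_def\<close>)
  have d: "(F has_derivative blinfun_apply (f' y)) (at y)" if "y \<in> S" for y
    unfolding f'[OF that] by (rule C_inf_on_differentiable[OF S(3) that])
  have c: "continuous_on S f'"
  proof (rule continuous_on_blinfun_componentwise)
    fix v :: 'e
    show "continuous_on S (\<lambda>y. blinfun_apply (f' y) v)"
      using C_inf_on_continuous[OF C_inf_on_frechet[OF S(3), of v]] by (rule continuous_on_eq) (simp add: f')
  qed
  have b0: "blinfun_apply (f' (\<phi> p)) = (\<lambda>\<xi>. real k *\<^sub>R \<xi>)"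
    using f'[OF S(2)] frechet_derivative_at[OF F'] by simp
  have i: "blinfun_scaleR_right (1 / real k) o\<^sub>L f' (\<phi> p) = id_blinfun"
    by (rule blinfun_eqI) (use k in \<open>simp add: b0\<close>)
  obtain U' W g g' where inv: "open U'" "U' \<subseteq> S" "\<phi> p \<in> U'" "homeomorphism U' W F g"
    using inverse_function_theorem[OF S(1) d c S(2) i] by metis
  have inj: "y = y'" if "y \<in> U'" "y' \<in> U'" "F y = F y'" for y y'
    using inv(4) that by (metis homeomorphism_apply1)
  have oVU: "open (V \<inter> \<phi> -` U')" by (rule chart_open_vimage[OF V(1) inv(1)])
  have e1: "eventually (\<lambda>q. q \<in> V \<inter> \<phi> -` U') (nhds p)"
    by (rule eventually_nhds_in_open[OF oVU]) (use V inv in simp)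
  have e2: "eventually (\<lambda>q. act z q \<in> V \<inter> \<phi> -` U') (nhds p)"
    by (rule topological_tendstoD[OF act_tendsto[OF z(1) p] oVU]) (use V inv z in simp)
  have e3: "eventually (\<lambda>q. q \<in> U) (nhds p)" by (rule eventually_nhds_in_open[OF U p])
  from e1 e2 e3 show ?thesis
  proof eventually_elim
    case (elim q)
    let ?a = "\<lambda>i. \<phi> (act (z ^ i) q)"
    \<comment> \<open>Acting by \<open>z\<close> shifts the orbit sum by one place; the term gained
      equals the term lost because \<open>z ^ k = 1\<close>.\<close>
    have "F (\<phi> (act z q)) = (\<Sum>i<k. ?a (Suc i))"
      using elim V(1) act_mult[OF zi z(1), of q] by (simp add: F_def mult.commute)
    also have "\<dots> = (\<Sum>i<k. ?a i)"
    proof -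
      have "?a 0 + (\<Sum>i<k. ?a (Suc i)) = (\<Sum>i<k. ?a i) + ?a k"
        using sum.lessThan_Suc_shift[of ?a k] unfolding sum.lessThan_Suc by (rule sym)
      moreover have "?a 0 = ?a k" using k(2) by simp
      ultimately show ?thesis by simp
    qed
    also have "\<dots> = F (\<phi> q)" using elim V(1) by (simp add: F_def)
    finally have "\<phi> (act z q) = \<phi> q" using inj elim by blast
    then show ?case using chart_inv[OF V(1)] elim by (metis IntD1)
  qed
qed

text \<open>Let \<open>g\<close> be the differential of \<open>z\<close> at \<open>p\<close>. For a
  tangent vector \<open>D\<close> the difference \<open>D' = g D - D\<close> kills the invariant
  functions \<open>u i\<close>, hence is a combination of the \<open>Y j\<close> by
  \<open>linear_annihilator_span\<close>, and these are fixed by \<open>g\<close>. So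
  \<open>g^i D = D + i D'\<close>, and \<open>i = k\<close> forces \<open>D' = 0\<close>.\<close>

lemma isotropy_acts_trivially:
  assumes dim: "DIM('e) = 2 * n" and p: "p \<in> U" and z: "norm z = 1" "act z p = p" and k: "0 < k" "z ^ k = 1"
    and Y: "\<And>j. j \<in> {1..n} \<Longrightarrow> Y j \<in> T p"
    and Yind: "\<And>a. (\<forall>h. (\<Sum>j=1..n. a j * Y j h) = 0) \<Longrightarrow> \<forall>j\<in>{1..n}. a j = 0"
    and Yz: "\<And>j h. j \<in> {1..n} \<Longrightarrow> smooth_at A p h \<Longrightarrow> Y j (\<lambda>q. h (act z q)) = Y j h"
    and u: "\<And>i. i \<in> {1..n} \<Longrightarrow> smooth_at A p (u i)"
    and uz: "\<And>i. i \<in> {1..n} \<Longrightarrow> eventually (\<lambda>q. u i (act z q) = u i q) (nhds p)"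
    and uind: "\<And>a. (\<forall>D\<in>T p. (\<Sum>i=1..n. a i * D (u i)) = 0) \<Longrightarrow> \<forall>i\<in>{1..n}. a i = 0"
    and uY: "\<And>i j. i \<in> {1..n} \<Longrightarrow> j \<in> {1..n} \<Longrightarrow> Y j (u i) = 0"
  shows "eventually (\<lambda>q. act z q = q) (nhds p)"
proof (rule finite_order_trivial_differential[OF p z k])
  fix D h i assume D: "D \<in> T p" and h: "smooth_at A p h"
  obtain V \<phi> where V: "(V, \<phi>) \<in> A" "p \<in> V" using chart_at by blast
  have sz: "smooth_at A p (\<lambda>q. h (act z q))" if "smooth_at A p h" for h
    by (rule act_smooth[OF z(1) p]) (use that z(2) in simp)
  \<comment> \<open>The case distinction enforces the convention of \<open>tangent_space\<close>
    that derivations vanish on functions not smooth at \<open>p\<close>.\<close>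
  define D' where "D' h = (if smooth_at A p h then D (\<lambda>q. h (act z q)) - D h else 0)" for h
  have D': "D' \<in> T p"
    unfolding tangent_space_def
  proof (intro CollectI conjI allI impI)
    fix f g :: "'m \<Rightarrow> real" and a b
    show "\<not> smooth_at A p f \<Longrightarrow> D' f = 0" by (simp add: D'_def)
    assume f: "smooth_at A p f" and g: "smooth_at A p g"
    have "smooth_at A p (\<lambda>q. a * f q + b * g q)" by (intro smooth_at_add smooth_at_mult smooth_at_const f g)
    then show "D' (\<lambda>q. a * f q + b * g q) = a * D' f + b * D' g"
      using f g tangent_lincomb[OF D f g] tangent_lincomb[OF D sz[OF f] sz[OF g]] by (simp add: D'_def algebra_simps)
    show "D' (\<lambda>q. f q * g q) = f p * D' g + g p * D' f"
      using f g smooth_at_mult[OF f g] tangent_mult[OF D f g] tangent_mult[OF D sz[OF f] sz[OF g]] z(2)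
      by (simp add: D'_def algebra_simps)
  qed
  have Yt: "Y j = tvec V \<phi> p (coords \<phi> (Y j))" if "j \<in> {1..n}" for j by (rule tangent_eq_tvec[OF V Y[OF that]])
  have lin: "linear (\<lambda>\<xi>. tvec V \<phi> p \<xi> h)" for h by (rule tvec_linear[OF V])
  have tsum: "tvec V \<phi> p (\<Sum>j=1..n. a j *\<^sub>R coords \<phi> (Y j)) h = (\<Sum>j=1..n. a j * Y j h)" for a h
  proof -
    have "tvec V \<phi> p (\<Sum>j=1..n. a j *\<^sub>R coords \<phi> (Y j)) h = (\<Sum>j=1..n. a j * tvec V \<phi> p (coords \<phi> (Y j)) h)"
      by (simp add: linear_sum[OF lin] linear_scale[OF lin])
    also have "\<dots> = (\<Sum>j=1..n. a j * Y j h)" by (rule sum.cong[OF refl]) (simp add: Yt[symmetric])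
    finally show ?thesis .
  qed
  have "\<exists>a. coords \<phi> D' = (\<Sum>j=1..n. a j *\<^sub>R coords \<phi> (Y j))"
  proof (rule linear_annihilator_span[OF dim, where l="\<lambda>i \<xi>. tvec V \<phi> p \<xi> (u i)"])
    fix a :: "nat \<Rightarrow> real"
    assume a0: "(\<Sum>j=1..n. a j *\<^sub>R coords \<phi> (Y j)) = 0"
    have "(\<Sum>j=1..n. a j * Y j h) = 0" for h using tsum[of a h] linear_0[OF lin[of h]] unfolding a0 by simp
    then show "\<forall>j\<in>{1..n}. a j = 0" using Yind by blast
  next
    fix a :: "nat \<Rightarrow> real"
    assume a0: "\<And>\<xi>. (\<Sum>i=1..n. a i * tvec V \<phi> p \<xi> (u i)) = 0"
    have "(\<Sum>i=1..n. a i * D (u i)) = 0" if "D \<in> T p" for D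
      using a0[of "coords \<phi> D"] unfolding tangent_eq_tvec[OF V that, symmetric] .
    then show "\<forall>i\<in>{1..n}. a i = 0" using uind by blast
  next
    fix i j assume ij: "i \<in> {1..n}" "j \<in> {1..n}"
    show "tvec V \<phi> p (coords \<phi> (Y j)) (u i) = 0" unfolding Yt[OF ij(2), symmetric] by (rule uY[OF ij])
  next
    fix i assume i: "i \<in> {1..n}"
    show "tvec V \<phi> p (coords \<phi> D') (u i) = 0"
      unfolding tangent_eq_tvec[OF V D', symmetric]
      using u[OF i] tangent_cong[OF D uz[OF i]] by (simp add: D'_def)
  qed (rule lin)
  then obtain a where a: "coords \<phi> D' = (\<Sum>j=1..n. a j *\<^sub>R coords \<phi> (Y j))" by blast
  have D'a: "D' h = (\<Sum>j=1..n. a j * Y j h)" for h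
    using tsum[of a h] unfolding a[symmetric] tangent_eq_tvec[OF V D', symmetric] .
  have D'z: "D' (\<lambda>q. h (act z q)) = D' h" if "smooth_at A p h" for h
    unfolding D'a by (rule sum.cong[OF refl]) (simp add: Yz that)
  define H where "H i q = h (act (z ^ i) q)" for i q
  have Hs: "smooth_at A p (H i)" for i
    unfolding H_def
    by (rule act_smooth[OF _ p]) (use z h act_power_fixed[OF z(1) p z(2)] in \<open>auto simp: norm_power\<close>)
  have HS: "eventually (\<lambda>q. H (Suc i) q = H i (act z q)) (nhds p)" for i
    using eventually_nhds_in_open[OF U p]
  proof eventually_elim
    case (elim q)
    then show ?case using act_mult[of "z ^ i" z q] z(1) by (simp add: H_def norm_power mult.commute)
  qed
  have D'H: "D' (H i) = D' (H 0)" for i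
  proof (induction i)
    case (Suc i)
    have "D' (H (Suc i)) = D' (H i)" using tangent_cong[OF D' HS[of i]] D'z[OF Hs[of i]] by simp
    then show ?case using Suc by simp
  qed simp
  have DH: "D (H i) = D (H 0) + real i * D' (H 0)" for i
  proof (induction i)
    case (Suc i)
    have "D (H (Suc i)) = D (H i) + D' (H i)" using tangent_cong[OF D HS[of i]] Hs[of i] by (simp add: D'_def)
    then show ?case using Suc D'H[of i] by (simp add: algebra_simps)
  qed simp
  have "H k = H 0" using k(2) by (simp add: H_def[abs_def])
  then have "D' (H 0) = 0" using DH[of k] k(1) by simp
  moreover have "D (H 0) = D h"
  proof (rule tangent_cong[OF D])
    show "eventually (\<lambda>q. H 0 q = h q) (nhds p)"
      using eventually_nhds_in_open[OF U p] by eventually_elim (simp add: H_def act_one)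
  qed
  ultimately show "D (\<lambda>q. h (act (z ^ i) q)) = D h" using DH[of i] by (simp add: H_def[abs_def])
qed

end

section \<open>b-integrable systems\<close>

context b_manifold
begin

text \<open>Two defining functions differ by a smooth factor \<open>h\<close> with
  \<open>h p \<noteq> 0\<close>, whose logarithm goes into the smooth part. All members of the
  system can thus be written with the same \<open>t\<close> as \<open>f 1\<close>.\<close>

lemma b_function_normal_form:
  assumes f: "b_function A Z f" and p: "p \<in> Z" and t: "defines_at p t"
  shows "\<exists>c k. smooth_at A p k \<and> eventually (\<lambda>q. q \<notin> Z \<longrightarrow> f q = c * ln \<bar>t q\<bar> + k q) (nhds p)"
proof -
  obtain c t' g where t': "defines_at p t'" and g: "smooth_at A p g"
    and fe: "eventually (\<lambda>q. q \<notin> Z \<longrightarrow> f q = c * ln \<bar>t' q\<bar> + g q) (nhds p)"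
    using b_function_at_Z[OF f] p by blast
  have st: "smooth_at A p t" "t p = 0" and st': "smooth_at A p t'"
    and tZ: "eventually (\<lambda>q. t q = 0 \<longleftrightarrow> q \<in> Z) (nhds p)"
    and tZ': "eventually (\<lambda>q. t' q = 0 \<longleftrightarrow> q \<in> Z) (nhds p)"
    using t t' by (auto simp: defines_at_def)
  have "eventually (\<lambda>q. q \<in> Z \<longrightarrow> t' q = 0) (nhds p)" using tZ' by eventually_elim simp
  then obtain h where h: "smooth_at A p h" "eventually (\<lambda>q. t' q = t q * h q) (nhds p)"
    using divide_by_defining_function[OF t st'] by blast
  obtain D where D: "D \<in> T p" "D t' \<noteq> 0" using t' by (auto simp: defines_at_def)
  have "D t' = h p * D t"
    using tangent_cong[OF D(1) h(2)] tangent_mult[OF D(1) st(1) h(1)] st(2) by simp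
  then have hp: "h p \<noteq> 0" using D(2) by auto
  have "smooth_at A p (\<lambda>q. c * ln \<bar>h q\<bar> + g q)"
    by (intro smooth_at_add smooth_at_mult smooth_at_const smooth_at_ln_abs h(1) hp g)
  moreover have "eventually (\<lambda>q. q \<notin> Z \<longrightarrow> f q = c * ln \<bar>t q\<bar> + (c * ln \<bar>h q\<bar> + g q)) (nhds p)"
    using fe h(2) tZ smooth_at_eventually_neq[OF h(1) hp]
  proof eventually_elim
    case (elim q)
    then show ?case by (simp add: abs_mult ln_mult distrib_left)
  qed
  ultimately show ?thesis by blast
qed

end

context b_symplectic
begin

text \<open>A relation among the b-differentials at \<open>p\<close> makes the same combination of
  Hamiltonian fields pair to \<open>0\<close> with every b-field. By contraposition, independence of
  the Hamiltonian vectors in the tangent space gives independence of the b-differentials.\<close>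

lemma hamiltonian_lincomb_zero:
  assumes f: "\<And>i. i \<in> I \<Longrightarrow> b_function A Z (f i)" and I: "finite I"
    and zero: "\<And>w. w \<in> bvf \<Longrightarrow> (\<Sum>i\<in>I. a i * b_diff Z (f i) w p) = 0"
  shows "(\<Sum>i\<in>I. a i * ham (f i) p h) = 0"
proof -
  let ?W = "\<lambda>q h. \<Sum>i\<in>I. a i * ham (f i) q h"
  have W: "?W \<in> bvf" by (rule bvf_lincomb[OF hamiltonian_field(1)[OF f] smooth_at_const])
  have "\<omega> ?W w p = 0" if w: "w \<in> bvf" for w
  proof -
    have "\<omega> ?W w p = (\<Sum>i\<in>I. a i * \<omega> (ham (f i)) w p)"
      by (rule \<omega>_lincomb[OF I hamiltonian_field(1)[OF f] smooth_at_const w])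
    also have "\<dots> = - (\<Sum>i\<in>I. a i * b_diff Z (f i) w p)"
      using f w by (simp add: hamiltonian_field(2) sum_negf)
    finally show ?thesis using zero[OF w] by simp
  qed
  from nondegenerate_zero(2)[OF W this, of h] show ?thesis .
qed

end

section \<open>Regularity and isotropy for a b-integrable system\<close>

locale b_integrable = b_symplectic A Z \<omega>
  for A :: "('m::t2_space, 'e::euclidean_space) atlas" and Z and \<omega> :: "'m two_form" +
  fixes n :: nat and f :: "nat \<Rightarrow> 'm \<Rightarrow> real" and U :: "'m set" and t :: "'m \<Rightarrow> real" and c :: real
    and act :: "complex \<Rightarrow> 'm \<Rightarrow> 'm" and \<tau> :: real
  assumes dim: "DIM('e) = 2 * n"
    and bf: "\<And>i. i \<in> {1..n} \<Longrightarrow> b_function A Z (f i)"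
    and pb: "\<And>i j p. i \<in> {1..n} \<Longrightarrow> j \<in> {1..n} \<Longrightarrow> poisson_bracket A Z \<omega> (f i) (f j) p = 0"
    and open_U: "open U"
    and defining: "defining_function_on A Z U t"
    and c0: "c \<noteq> 0"
    and f1: "\<forall>q\<in>U - Z. f 1 q = c * ln \<bar>t q\<bar>"
    and act: "circle_action A U act" and \<tau>0: "\<tau> > 0"
    and flow1: "\<forall>x\<in>U. integral_curve A (ham (f 1)) UNIV (\<lambda>s. act (cis (2 * pi * s / \<tau>)) x)"
begin

sublocale circle_flow A U act \<tau> "ham (f 1)"
  by unfold_locales (use open_U act \<tau>0 flow1 in auto)

lemma one_in: "1 \<in> {1..n}" using dim DIM_positive[where 'a='e] by auto

lemma smooth_t: "q \<in> U \<Longrightarrow> smooth_at A q t"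
  using defining smooth_on_iff[OF open_U, of t] by (simp add: defining_function_on_def)

lemma t_zero_iff: "q \<in> U \<Longrightarrow> t q = 0 \<longleftrightarrow> q \<in> Z"
  using defining by (simp add: defining_function_on_def)

lemma ham_bvf: "i \<in> {1..n} \<Longrightarrow> ham (f i) \<in> bvf" by (rule hamiltonian_field(1)[OF bf])

lemma ham_apply_zero: "i \<in> {1..n} \<Longrightarrow> j \<in> {1..n} \<Longrightarrow> q \<notin> Z \<Longrightarrow> ham (f j) q (f i) = 0"
  by (rule poisson_commute_apply[OF bf bf pb])

text \<open>On \<open>Z\<close> this is tangency. Off \<open>Z\<close> the function
  \<open>f 1\<close> Poisson commutes with itself, which reads \<open>0 = c * (X t / t)\<close> with
  \<open>c \<noteq> 0\<close> for its field \<open>X\<close>. It follows that the action preserves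
  \<open>t\<close>, hence \<open>Z\<close> and its complement in \<open>U\<close>.\<close>

lemma ham_one_t_zero: assumes q: "q \<in> U" shows "ham (f 1) q t = 0"
proof (cases "q \<in> Z")
  case True
  then show ?thesis
    using bvf_defining_zero[OF ham_bvf[OF one_in] True] defining_function_defines_at[OF open_U defining True q] by blast
next
  case False
  have tq: "t q \<noteq> 0" using t_zero_iff[OF q] False by simp
  note T = bvf_tangent[OF ham_bvf[OF one_in], of q]
  have "eventually (\<lambda>r. f 1 r = c * ln \<bar>t r\<bar>) (nhds q)"
    using eventually_nhds_in_open[OF open_U q] eventually_off_Z[OF False] by eventually_elim (use f1 in auto)
  from tangent_cong[OF T this] have "0 = ham (f 1) q (\<lambda>r. c * ln \<bar>t r\<bar>)"
    using ham_apply_zero[OF one_in one_in False] by simp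
  also have "\<dots> = c * (ham (f 1) q t / t q)"
    using tangent_cmult[OF T smooth_at_ln_abs[OF smooth_t[OF q] tq]] tangent_ln_abs[OF T smooth_t[OF q] tq] by simp
  finally show ?thesis using c0 tq by simp
qed

text \<open>The sign matches \<open>commuting_field_invariant\<close>, where functions are composed
  with \<open>fl (- s)\<close>.\<close>

lemma act_eq_fl: assumes "norm z = 1" shows "\<exists>s. \<forall>x. act z x = fl (- s) x"
proof -
  have "z \<noteq> 0" using assms by auto
  then have z: "cis (Arg z) = z" using cis_Arg[of z] assms by (simp add: sgn_div_norm)
  have "2 * pi * (- (- (Arg z * \<tau> / (2 * pi)))) / \<tau> = Arg z" using \<tau>0 by simp
  then have "act z x = fl (- (- (Arg z * \<tau> / (2 * pi)))) x" for x unfolding fl_def using z by simp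
  then show ?thesis by blast
qed

lemma fl_t: "x \<in> U \<Longrightarrow> t (fl s x) = t x"
  by (rule fl_constant[OF _ smooth_t[OF fl_in] ham_one_t_zero[OF fl_in]])

lemma fl_off_Z: "x \<in> U \<Longrightarrow> fl s x \<in> Z \<longleftrightarrow> x \<in> Z"
  using fl_t[of x s] t_zero_iff fl_in by metis

lemma fl_f:
  assumes i: "i \<in> {1..n}" and x: "x \<in> U" "x \<notin> Z" shows "f i (fl s x) = f i x"
proof (rule fl_constant[OF x(1)])
  fix s
  have "fl s x \<notin> Z" using fl_off_Z x by blast
  then show "smooth_at A (fl s x) (f i)" "ham (f 1) (fl s x) (f i) = 0"
    using b_function_smooth_off_Z[OF bf[OF i]] ham_apply_zero[OF i one_in] by auto
qed

lemma act_t: "norm z = 1 \<Longrightarrow> x \<in> U \<Longrightarrow> t (act z x) = t x"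
  using act_eq_fl[of z] fl_t by metis

lemma act_off_Z: "norm z = 1 \<Longrightarrow> x \<in> U \<Longrightarrow> act z x \<in> Z \<longleftrightarrow> x \<in> Z"
  using act_eq_fl[of z] fl_off_Z by metis

lemma act_f: "i \<in> {1..n} \<Longrightarrow> norm z = 1 \<Longrightarrow> x \<in> U \<Longrightarrow> x \<notin> Z \<Longrightarrow> f i (act z x) = f i x"
  using act_eq_fl[of z] fl_f by metis

lemma ham_act_invariant:
  assumes j: "j \<in> {1..n}" and p: "p \<in> U" and z: "norm z = 1" "act z p = p" and h: "smooth_at A p h"
  shows "ham (f j) p (\<lambda>q. h (act z q)) = ham (f j) p h"
proof -
  obtain s where s: "\<forall>x. act z x = fl (- s) x" using act_eq_fl[OF z(1)] by blast
  have "fl s p = fl s (fl (- s) p)" using s z(2) by simp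
  also have "\<dots> = p" using fl_add[OF p, of s "- s"] fl_zero[OF p] by simp
  finally have fp: "fl s p = p" .
  have vf: "ham (f i) \<in> vector_fields A" if "i \<in> {1..n}" for i
    using ham_bvf[OF that] by (simp add: b_vector_fields_def)
  have "ham (f j) p (\<lambda>x. h (fl (- s) x)) = ham (f j) p h"
    by (rule commuting_field_invariant[OF vf[OF one_in] vf[OF j] _ p h fp])
      (rule hamiltonian_fields_commute[OF bf[OF one_in] bf[OF j] pb[OF one_in j]])
  then show ?thesis using s by simp
qed

lemma regular_isotropy_trivial:
  assumes reg: "regular_point A Z \<omega> n f p" and p: "p \<in> U"
    and z: "norm z = 1" "act z p = p" and k: "0 < k" "z ^ k = 1"
  shows "eventually (\<lambda>q. act z q = q) (nhds p)"
proof -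
  have Yind: "\<forall>j\<in>{1..n}. a j = 0" if "\<forall>h. (\<Sum>j=1..n. a j * ham (f j) p h) = 0" for a
    using reg that unfolding regular_point_def by blast
  \<comment> \<open>What remains to be supplied, separately off and on \<open>Z\<close>, are
    \<open>n\<close> invariant functions \<open>u\<close> with independent differentials.\<close>
  note trivial = isotropy_acts_trivially[OF dim p z k, where Y="\<lambda>j. ham (f j) p",
      OF bvf_tangent[OF ham_bvf] Yind ham_act_invariant[OF _ p z]]
  show ?thesis
  proof (cases "p \<in> Z")
    case False
    show ?thesis
    proof (rule trivial[where u=f])
      show "smooth_at A p (f i)" if "i \<in> {1..n}" for i by (rule b_function_smooth_off_Z[OF bf[OF that] False])
      show "eventually (\<lambda>q. f i (act z q) = f i q) (nhds p)" if "i \<in> {1..n}" for i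
        using eventually_nhds_in_open[OF open_U p] eventually_off_Z[OF False]
        by eventually_elim (rule act_f[OF that z(1)])
      show "ham (f j) p (f i) = 0" if "i \<in> {1..n}" "j \<in> {1..n}" for i j by (rule ham_apply_zero[OF that False])
      show "\<forall>i\<in>{1..n}. a i = 0" if a: "\<forall>D\<in>T p. (\<Sum>i=1..n. a i * D (f i)) = 0" for a
      proof (rule Yind, rule allI)
        fix h
        show "(\<Sum>j=1..n. a j * ham (f j) p h) = 0"
          by (rule hamiltonian_lincomb_zero[OF bf]) (use a bvf_tangent b_diff_off_Z[OF False] in auto)
      qed
    qed auto
  next
    case True
    have t: "defines_at p t" by (rule defining_function_defines_at[OF open_U defining True p])
    have "\<forall>i. \<exists>ck. i \<in> {1..n} \<longrightarrow> smooth_at A p (snd ck) \<and>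
        eventually (\<lambda>q. q \<notin> Z \<longrightarrow> f i q = fst ck * ln \<bar>t q\<bar> + snd ck q) (nhds p)"
      using b_function_normal_form[OF bf True t] by fastforce
    from choice[OF this] obtain ck where ck: "\<forall>i. i \<in> {1..n} \<longrightarrow> smooth_at A p (snd (ck i)) \<and>
        eventually (\<lambda>q. q \<notin> Z \<longrightarrow> f i q = fst (ck i) * ln \<bar>t q\<bar> + snd (ck i) q) (nhds p)" by (elim exE)
    define k\<^sub>0 where "k\<^sub>0 i = snd (ck i)" for i
    \<comment> \<open>The ratio of the logarithmic coefficients. Since \<open>f 1\<close> is exactly
      \<open>c * ln \<bar>t\<bar>\<close> off \<open>Z\<close>, subtracting
      \<open>\<kappa> i * f 1\<close> from \<open>f i\<close> leaves the smooth part
      \<open>k\<^sub>0 i\<close>.\<close>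
    define \<kappa> where "\<kappa> i = fst (ck i) / c" for i
    have sk: "smooth_at A p (k\<^sub>0 i)" if "i \<in> {1..n}" for i using ck that by (simp add: k\<^sub>0_def)
    have fk: "eventually (\<lambda>q. q \<notin> Z \<longrightarrow> f i q - \<kappa> i * f 1 q = k\<^sub>0 i q) (nhds p)" if i: "i \<in> {1..n}" for i
      using eventually_nhds_in_open[OF open_U p] ck[rule_format, OF i, THEN conjunct2]
      by eventually_elim (use f1 c0 in \<open>auto simp: \<kappa>_def k\<^sub>0_def\<close>)
    have vk: "eventually (\<lambda>q. q \<notin> Z \<longrightarrow> v q (f i) - \<kappa> i * v q (f 1) = v q (k\<^sub>0 i)) (nhds p)"
      if i: "i \<in> {1..n}" and v: "v \<in> bvf" for i v
    proof -
      have "eventually (\<lambda>q. eventually (\<lambda>q. q \<notin> Z \<longrightarrow> f i q - \<kappa> i * f 1 q = k\<^sub>0 i q) (nhds q)) (nhds p)"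
        using fk[OF i] by (simp add: eventually_eventually)
      then show ?thesis
      proof (eventually_elim, intro impI)
        fix q assume ev: "eventually (\<lambda>q. q \<notin> Z \<longrightarrow> f i q - \<kappa> i * f 1 q = k\<^sub>0 i q) (nhds q)" and q: "q \<notin> Z"
        have "eventually (\<lambda>q. 1 * f i q + (- \<kappa> i) * f 1 q = k\<^sub>0 i q) (nhds q)"
          using ev eventually_off_Z[OF q] by eventually_elim simp
        from tangent_cong[OF bvf_tangent[OF v] this]
        show "v q (f i) - \<kappa> i * v q (f 1) = v q (k\<^sub>0 i)"
          using tangent_lincomb[OF bvf_tangent[OF v] b_function_smooth_off_Z[OF bf[OF i] q]
              b_function_smooth_off_Z[OF bf[OF one_in] q], of 1 "- \<kappa> i"] by simp
      qed
    qed
    \<comment> \<open>For \<open>i = 1\<close> the combination with \<open>f 1\<close> gives nothing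
      new; its place is taken by \<open>t\<close>, whose differential detects the direction
      transverse to \<open>Z\<close>.\<close>
    define u where "u i = (if i = 1 then t else k\<^sub>0 i)" for i
    show ?thesis
    proof (rule trivial[where u=u])
      show "smooth_at A p (u i)" if "i \<in> {1..n}" for i using smooth_t[OF p] sk[OF that] by (simp add: u_def)
      show "eventually (\<lambda>q. u i (act z q) = u i q) (nhds p)" if i: "i \<in> {1..n}" for i
      proof (cases "i = 1")
        case True
        show ?thesis
          using eventually_nhds_in_open[OF open_U p] by eventually_elim (simp add: True u_def act_t z)
      next
        case False
        define P where "P q \<longleftrightarrow> smooth_at A q (k\<^sub>0 i) \<and> (q \<notin> Z \<longrightarrow> f i q - \<kappa> i * f 1 q = k\<^sub>0 i q)" for q
        have evP: "eventually P (nhds p)"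
          unfolding P_def using smooth_at_eventually[OF sk[OF i]] fk[OF i] by (rule eventually_conj)
        have "eventually (\<lambda>q. P (act z q)) (nhds p)"
          using act_tendsto[OF z(1) p] evP unfolding z(2) by (rule eventually_compose_filterlim[rotated])
        with evP eventually_nhds_in_open[OF open_U p]
        have "eventually (\<lambda>q. P q \<and> q \<in> U \<and> P (act z q)) (nhds p)" by eventually_elim simp
        \<comment> \<open>Invariance of \<open>k\<^sub>0 i\<close> comes from that of
          \<open>f i\<close> and \<open>f 1\<close>, hence is available off \<open>Z\<close> only.
          Having \<open>P\<close> around each nearby \<open>q\<close>, and not just at
          \<open>q\<close>, lets the density principle be applied at \<open>q\<close>.\<close>
        then have "eventually (\<lambda>q. eventually (\<lambda>q. P q \<and> q \<in> U \<and> P (act z q)) (nhds q)) (nhds p)"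
          by (simp add: eventually_eventually)
        then show ?thesis
        proof eventually_elim
          case (elim q)
          have q: "P q" "q \<in> U" "P (act z q)" using eventually_nhds_x_imp_x[OF elim] by auto
          have "k\<^sub>0 i (act z q) = k\<^sub>0 i q"
          proof (rule smooth_eq_off_Z)
            show "smooth_at A q (\<lambda>q. k\<^sub>0 i (act z q))" by (rule act_smooth[OF z(1) q(2)]) (use q in \<open>simp add: P_def\<close>)
            show "smooth_at A q (k\<^sub>0 i)" using q by (simp add: P_def)
            show "eventually (\<lambda>q. q \<notin> Z \<longrightarrow> k\<^sub>0 i (act z q) = k\<^sub>0 i q) (nhds q)"
              using elim
            proof eventually_elim
              case (elim r)
              show ?case
              proof
                assume r: "r \<notin> Z"
                have "act z r \<notin> Z" using act_off_Z[OF z(1)] elim r by blast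
                then have "k\<^sub>0 i (act z r) = f i (act z r) - \<kappa> i * f 1 (act z r)" using elim by (simp add: P_def)
                also have "\<dots> = f i r - \<kappa> i * f 1 r"
                  using act_f[OF i z(1) _ r] act_f[OF one_in z(1) _ r] elim by simp
                finally show "k\<^sub>0 i (act z r) = k\<^sub>0 i r" using elim r by (simp add: P_def)
              qed
            qed
          qed
          then show ?case using False by (simp add: u_def)
        qed
      qed
      show "ham (f j) p (u i) = 0" if i: "i \<in> {1..n}" and j: "j \<in> {1..n}" for i j
      proof (cases "i = 1")
        case True
        then show ?thesis using bvf_defining_zero[OF ham_bvf[OF j] \<open>p \<in> Z\<close> t] by (simp add: u_def)
      next
        case False
        have "ham (f j) p (k\<^sub>0 i) = 0"
        proof (rule smooth_zero_off_Z[OF bvf_smooth[OF ham_bvf[OF j] sk[OF i]]])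
          show "eventually (\<lambda>q. q \<notin> Z \<longrightarrow> ham (f j) q (k\<^sub>0 i) = 0) (nhds p)"
            using vk[OF i ham_bvf[OF j]]
            by eventually_elim (use ham_apply_zero[OF i j] ham_apply_zero[OF one_in j] in auto)
        qed
        then show ?thesis using False by (simp add: u_def)
      qed
      show "\<forall>i\<in>{1..n}. a i = 0" if a: "\<forall>D\<in>T p. (\<Sum>i=1..n. a i * D (u i)) = 0" for a
      proof -
        \<comment> \<open>\<open>a'\<close> drops the coefficient of \<open>t\<close>, which
          b-fields annihilate at \<open>p\<close>. The correction in \<open>\<beta> 1\<close>
          gathers the multiples of \<open>f 1\<close> contained in the \<open>k\<^sub>0 i\<close>,
          so that on b-fields the \<open>\<beta>\<close>-combination of the b-differentials of the
          \<open>f i\<close> equals the \<open>a'\<close>-combination of the differentials of the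
          \<open>k\<^sub>0 i\<close>. The latter is \<open>0\<close>, and regularity yields
          \<open>\<beta> = 0\<close>.\<close>
        define a' where "a' i = (if i = 1 then 0 else a i)" for i :: nat
        define \<beta> where "\<beta> i = a' i - (if i = 1 then (\<Sum>j=1..n. a' j * \<kappa> j) else 0)" for i :: nat
        have split1: "(\<Sum>i=1..n. (if i = 1 then r else 0) * s i) = r * s 1" for r and s :: "nat \<Rightarrow> real"
        proof -
          have "(\<Sum>i=1..n. (if i = 1 then r else 0) * s i) = (\<Sum>i=1..n. if i = 1 then r * s 1 else 0)"
            by (rule sum.cong) auto
          then show ?thesis using one_in by simp
        qed
        have ones: "(\<Sum>i=1..n. a i * D (u i)) = a 1 * D t + (\<Sum>i=1..n. a' i * D (k\<^sub>0 i))" for D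
        proof -
          have "(\<Sum>i=1..n. a i * D (u i)) = (\<Sum>i=1..n. (if i = 1 then a 1 else 0) * D t + a' i * D (k\<^sub>0 i))"
            by (rule sum.cong) (auto simp: u_def a'_def)
          then show ?thesis by (simp only: sum.distrib split1[of "a 1" "\<lambda>_. D t"])
        qed
        have "(\<Sum>i=1..n. \<beta> i * b_diff Z (f i) w p) = 0" if w: "w \<in> bvf" for w
        proof -
          have bd: "b_diff Z (f i) w p - \<kappa> i * b_diff Z (f 1) w p = w p (k\<^sub>0 i)" if i: "i \<in> {1..n}" for i
          proof (rule smooth_eq_off_Z)
            show "smooth_at A p (\<lambda>q. b_diff Z (f i) w q - \<kappa> i * b_diff Z (f 1) w q)"
              by (intro smooth_at_diff smooth_at_mult smooth_at_const b_diff_smooth bf i one_in w)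
            show "smooth_at A p (\<lambda>q. w q (k\<^sub>0 i))" by (rule bvf_smooth[OF w sk[OF i]])
            show "eventually (\<lambda>q. q \<notin> Z \<longrightarrow> b_diff Z (f i) w q - \<kappa> i * b_diff Z (f 1) w q = w q (k\<^sub>0 i)) (nhds p)"
              using vk[OF i w] by eventually_elim (simp add: b_diff_off_Z)
          qed
          have "(\<Sum>i=1..n. \<beta> i * b_diff Z (f i) w p) =
              (\<Sum>i=1..n. a' i * b_diff Z (f i) w p) - (\<Sum>j=1..n. a' j * \<kappa> j) * b_diff Z (f 1) w p"
            by (simp only: \<beta>_def left_diff_distrib sum_subtractf split1)
          also have "\<dots> = (\<Sum>i=1..n. a' i * (b_diff Z (f i) w p - \<kappa> i * b_diff Z (f 1) w p))"
            by (simp add: sum_distrib_right sum_subtractf right_diff_distrib mult.assoc)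
          also have "\<dots> = (\<Sum>i=1..n. a' i * w p (k\<^sub>0 i))" by (rule sum.cong[OF refl]) (simp only: bd)
          also have "\<dots> = 0"
            using ones[of "w p"] a bvf_tangent[OF w] bvf_defining_zero[OF w \<open>p \<in> Z\<close> t] by simp
          finally show ?thesis .
        qed
        then have "\<forall>h. (\<Sum>i=1..n. \<beta> i * ham (f i) p h) = 0"
          by (intro allI hamiltonian_lincomb_zero[OF bf]) auto
        then have \<beta>0: "\<forall>i\<in>{1..n}. \<beta> i = 0" by (rule Yind)
        have a'0: "a' i = 0" if "i \<in> {1..n}" for i using \<beta>0[rule_format, OF that] by (cases "i = 1") (simp_all add: \<beta>_def a'_def)
        \<comment> \<open>Only the term with \<open>t\<close> is left; a vector transverse to
          \<open>Z\<close> isolates its coefficient.\<close>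
        obtain D where D: "D \<in> T p" "D t \<noteq> 0" using t by (auto simp: defines_at_def)
        have "a 1 = 0" using ones[of D] a D a'0 by simp
        moreover have "a i = 0" if "i \<in> {1..n}" "i \<noteq> 1" for i using a'0[OF that(1)] that(2) by (simp add: a'_def)
        ultimately show ?thesis by metis
      qed
    qed auto
  qed
qed

text \<open>The circle is commutative, so an element \<open>z\<close> fixing \<open>x\<close> fixes
  every point of its orbit; and \<open>z\<close> has finite order because its powers lie in a finite
  isotropy group. These are the hypotheses under which regularity at \<open>p\<close> makes
  \<open>z\<close> trivial near \<open>p\<close>.\<close>

lemma exceptional_not_regular:
  assumes p: "p \<in> \<Union> (exceptional_orbits U act)" shows "\<not> regular_point A Z \<omega> n f p"
proof
  assume reg: "regular_point A Z \<omega> n f p"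
  obtain x H where x: "p \<in> circle_orbit act x" "x \<in> U" "finite (isotropy_group act x)"
    and H: "principal_isotropy U act x H" "H \<subset> isotropy_group act x"
    using p unfolding exceptional_orbits_def by blast
  obtain w where w: "norm w = 1" "p = act w x" using x(1) by (auto simp: circle_orbit_def)
  have pU: "p \<in> U" using act_in w x by simp
  obtain W where W: "open W" "connected_component_set U x \<subseteq> closure W" "\<forall>y\<in>W. isotropy_group act y = H"
    using H(1) unfolding principal_isotropy_def by blast
  \<comment> \<open>Principal isotropy refers to the component of \<open>x\<close> in
    \<open>U\<close>; connectedness of the orbit puts \<open>p\<close> into the same component,
    hence into the closure of \<open>W\<close>.\<close>
  have "connected ((\<lambda>z. act z x) ` sphere 0 1)"
  proof (rule connected_continuous_image)
    have "continuous_on (sphere 0 1) (\<lambda>z. (\<lambda>(z, x). act z x) (z, x))"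
      by (rule continuous_on_compose2[OF act_continuous]) (use x in \<open>auto intro!: continuous_intros\<close>)
    then show "continuous_on (sphere 0 1) (\<lambda>z. act z x)" by simp
    show "connected (sphere (0::complex) 1)" by (rule connected_sphere) simp
  qed
  moreover have "(\<lambda>z. act z x) ` sphere 0 1 \<subseteq> U" using act_in x(2) by auto
  moreover have "x \<in> (\<lambda>z. act z x) ` sphere 0 1" using act_one[OF x(2)] by (intro image_eqI[of _ _ 1]) auto
  moreover have "p \<in> (\<lambda>z. act z x) ` sphere 0 1" using w by auto
  ultimately have "p \<in> connected_component_set U x" unfolding connected_component_def by blast
  then have pW: "p \<in> closure W" using W(2) by blast
  have "z \<in> H" if z: "z \<in> isotropy_group act x" for z
  proof -
    have zx: "norm z = 1" "act z x = x" using z by (auto simp: isotropy_group_def)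
    have zp: "act z p = p"
      using act_mult[OF zx(1) w(1) x(2)] act_mult[OF w(1) zx(1) x(2)] zx w by (simp add: mult.commute)
    have "range (\<lambda>i::nat. z ^ i) \<subseteq> isotropy_group act x"
      using zx act_power_fixed[OF zx(1) x(2) zx(2)] by (auto simp: isotropy_group_def norm_power)
    then have "finite (range (\<lambda>i::nat. z ^ i))" using x(3) finite_subset by blast
    then have "\<not> inj (\<lambda>i::nat. z ^ i)" using finite_imageD infinite_UNIV_nat by blast
    then obtain i j :: nat where ij: "i < j" "z ^ i = z ^ j" unfolding inj_def by (metis linorder_neqE_nat)
    have "z ^ i * z ^ (j - i) = z ^ (i + (j - i))" by (rule power_add[symmetric])
    then have "z ^ i * z ^ (j - i) = z ^ i * 1" using ij by simp
    moreover have "z ^ i \<noteq> 0" using zx by auto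
    ultimately have k: "z ^ (j - i) = 1" using mult_cancel_left by blast
    have "eventually (\<lambda>q. act z q = q) (nhds p)"
      by (rule regular_isotropy_trivial[OF reg pU zx(1) zp _ k]) (use ij in simp)
    then obtain N where N: "open N" "p \<in> N" "\<forall>q\<in>N. act z q = q" unfolding eventually_nhds by blast
    then have "N \<inter> closure W \<noteq> {}" using pW by blast
    then obtain y where y: "y \<in> W" "y \<in> N" using open_Int_closure_eq_empty[OF N(1)] by blast
    then have "z \<in> isotropy_group act y" using N zx by (simp add: isotropy_group_def)
    then show ?thesis using W(3) y by blast
  qed
  then show False using H(2) by blast
qed

end

theorem corollary28:
  fixes A :: "('m::{t2_space, second_countable_topology}, 'e::euclidean_space) atlas"
    and Z U T :: "'m set"
    and \<omega> :: "'m two_form"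
    and n :: nat
    and f :: "nat \<Rightarrow> 'm \<Rightarrow> real"
    and t :: "'m \<Rightarrow> real"
    and c :: real
    and act :: "complex \<Rightarrow> 'm \<Rightarrow> 'm"
  assumes dim: "DIM('e) = 2 * n"
    and b_symplectic: "b_symplectic_manifold A Z \<omega>"
    and compact_leaf: "\<exists>p\<in>Z. compact (symplectic_leaf A Z \<omega> p)"
    and integrable: "b_integrable_system A Z \<omega> n f"
    and nbhd: "open U" "Z \<subseteq> U"
    and defining: "defining_function_on A Z U t"
    and c_nonzero: "c \<noteq> 0"
    and f_one: "\<forall>q\<in>U - Z. f 1 q = c * ln \<bar>t q\<bar>"
    and action: "flow_induces_circle_action A U (b_hamiltonian_field A Z \<omega> (f 1)) act"
    and T_def: "T = \<Union> (exceptional_orbits U act)"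
  shows "\<forall>p\<in>T. \<not> regular_point A Z \<omega> n f p"
proof -
  obtain \<tau> where \<tau>: "circle_action A U act" "\<tau> > 0"
    "\<forall>x\<in>U. integral_curve A (b_hamiltonian_field A Z \<omega> (f 1)) UNIV (\<lambda>s. act (cis (2 * pi * s / \<tau>)) x)"
    using action unfolding flow_induces_circle_action_def by blast
  interpret b_integrable A Z \<omega> n f U t c act \<tau>
    by unfold_locales
      (use b_symplectic integrable dim nbhd(1) defining c_nonzero f_one \<tau> in
        \<open>auto simp: b_symplectic_manifold_def b_integrable_system_def\<close>)
  show ?thesis using exceptional_not_regular unfolding T_def by blast
qed

end
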